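(* Let $M$ be a quaternionic contact manifold of dimension $4n+3$, with associated corank three subbundle $Q\subset TM$ and two-sphere bundle $\mathbb{I}$ of complex structures of $Q$. Then there exists a quaternionic CR structure on $M$ having $(Q,\mathbb{I})$ as the underlying structure.
   Context: Everything is smooth; $(a,b,c)$ always denotes a cyclic permutation of $(1,2,3)$. $M$ is a connected orientable manifold of dimension $4n+3$. Quaternionic contact structure. On a $(4n+3)$-manifold $M$ this is a corank three subbundle $Q\subset TM$ with a conformal class $[\gamma]$ of metrics on $Q$ and a two-sphere bundle $\mathbb{I}$ over $M$ of complex structures $I:Q\to Q$, $I^2=-\mathrm{Id}$, such that: (i) $\gamma(IX,IY)=\gamma(X,Y)$ for $I\in\mathbb{I}$, $X,Y\in Q$; (ii) $\mathbb{I}$ locally admits sections $I_1,I_2,I_3$ with $I_1I_2=-I_2I_1=I_3$ and $\mathbb{I}=\{v_1I_1+v_2I_2+v_3I_3:v_1^2+v_2^2+v_3^2=1\}$; (iii) $Q$ is locally the kernel of an $\mathbb{R}^3$-valued one-form $\eta=(\eta_1,\eta_2,\eta_3)$ with $\gamma(I_aX,Y)=d\eta_a(X,Y)$, $a=1,2,3$, $X,Y\in Q$. Almost hyper CR structures. An almost CR structure is a corank one subbundle of the tangent bundle together with a complex structure on it. An almost hyper CR structure is a pair of almost CR structures $(Q_1,I_1)$, $(Q_2,I_2)$ such that $Q_1,Q_2$ are transversal to each other and $I_1I_2=-I_2I_1$ on $I_1(Q_1\cap Q_2)\cap I_2(Q_1\cap Q_2)$. A third almost CR structure $(Q_3,I_3)$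 is defined by $Q_3=I_1(Q_1\cap Q_2)+I_2(Q_1\cap Q_2)$, $I_3=-I_2I_1$ on $I_1(Q_1\cap Q_2)$ and $I_3=I_1I_2$ on $I_2(Q_1\cap Q_2)$. The bundle $Q_1\cap Q_2\cap Q_3$ is a corank three subbundle (denoted $Q$) preserved by $I_1,I_2,I_3$, which satisfy the quaternion relations on it. An admissible triple is a triple $(T_1,T_2,T_3)$ of vector fields transverse to $Q$ with $T_a\in\Gamma(Q_b\cap Q_c)$ and $I_aT_b=T_c$. Given one, extend $I_a$ to endomorphisms $\widetilde{I_a}$ of the tangent bundle by $\widetilde{I_a}T_a=0$; for an $S^2$-valued function $\mathbf v=(v_1,v_2,v_3)$ put $Q_{\mathbf v}=Q\oplus\{\sum x_aT_a:\sum x_av_a=0\}$ and $I_{\mathbf v}=(\sum v_a\widetilde{I_a})|_{Q_{\mathbf v}}$ (independent of the admissible triple). The almost hyper CR structure is integrable, and is then called a hyper CR structure, if for $a=1,2,3$ and all $X,Y\in\Gamma(Q)$: $[X,Y]-[I_aX,I_aY]\in\Gamma(Q_a)$ and $I_a([X,Y]-[I_aX,I_aY])-[X,I_aY]-[I_aX,Y]\in\Gamma(Q)$. Quaternionic CR structure. A covering of $M$ by open sets $U$ carrying hyper CR structures such that for any two of them, $\{(Q_a,I_a)\}$ on $U$ and $\{(Q_a',I_a')\}$ on $U'$ with $U\cap U'\ne\emptyset$, there is a function $S:U\cap U'\to SO(3)$ with $Q'_{\mathbf v}=Q_{S\mathbf v}$, $I'_{\mathbf v}=I_{S\mathbf v}$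 for all $\mathbf v\in S^2$. The local corank three bundles then agree and define a global bundle $Q$, and the complex structures $I_{\mathbf v}|_Q$ form a two-sphere bundle $\mathbb{I}$ over $M$; $(Q,\mathbb{I})$ is called the underlying structure. *)

theory Defs
  imports "HOL-Analysis.Analysis"
begin

section \<open>Smooth manifolds\<close>

primrec C_on :: "nat \<Rightarrow> 'a::real_normed_vector set \<Rightarrow> ('a \<Rightarrow> 'b::real_normed_vector) \<Rightarrow> bool" where
  "C_on 0 S f \<longleftrightarrow> continuous_on S f"
| "C_on (Suc k) S f \<longleftrightarrow> (\<forall>x\<in>S. f differentiable (at x)) \<and>
     (\<forall>v. C_on k S (\<lambda>x. frechet_derivative f (at x) v))"

text \<open>Only used for open \<open>S\<close>.\<close>
definition smooth_on :: "'a::real_normed_vector set \<Rightarrow> ('a \<Rightarrow> 'b::real_normed_vector) \<Rightarrow> bool" where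
  "smooth_on S f \<longleftrightarrow> (\<forall>k. C_on k S f)"

text \<open>A chart is a pair of its domain and its coordinate map. The underlying space of the
  manifold is the whole type \<open>'m\<close>.\<close>
type_synonym ('m, 'e) chart = "'m set \<times> ('m \<Rightarrow> 'e)"

definition chart_inv :: "('m, 'e) chart \<Rightarrow> 'e \<Rightarrow> 'm" where
  "chart_inv c = inv_into (fst c) (snd c)"

definition is_chart :: "('m::topological_space, 'e::euclidean_space) chart \<Rightarrow> bool" where
  "is_chart c \<longleftrightarrow> open (fst c) \<and> open (snd c ` fst c) \<and>
     homeomorphism (fst c) (snd c ` fst c) (snd c) (chart_inv c)"

definition smooth_atlas :: "('m::topological_space, 'e::euclidean_space) chart set \<Rightarrow> bool" where
  "smooth_atlas A \<longleftrightarrow> (\<forall>c\<in>A. is_chart c) \<and> (\<Union>c\<in>A. fst c) = UNIV \<and>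
     (\<forall>c\<in>A. \<forall>d\<in>A. smooth_on (snd c ` (fst c \<inter> fst d)) (snd d \<circ> chart_inv c))"

definition orientable :: "('m::topological_space, real^'d) chart set \<Rightarrow> bool" where
  "orientable A \<longleftrightarrow> (\<exists>B. smooth_atlas B \<and> smooth_atlas (A \<union> B) \<and>
     (\<forall>c\<in>B. \<forall>d\<in>B. \<forall>p\<in>fst c \<inter> fst d. det (jacobian (snd d \<circ> chart_inv c) (at (snd c p))) > 0))"

text \<open>Every point \<open>p\<close> has a preferred chart \<open>chart_at A p\<close>, and the tangent space at \<open>p\<close> is the
  model space \<open>'e\<close>: a vector of \<open>'e\<close> stands for the tangent vector at \<open>p\<close> having these components
  in the preferred chart. The Jacobian \<open>chart_change c d p\<close> converts the components at \<open>p\<close>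
  with respect to \<open>c\<close> into those with respect to \<open>d\<close>.\<close>
definition chart_at :: "('m, 'e) chart set \<Rightarrow> 'm \<Rightarrow> ('m, 'e) chart" where
  "chart_at A p = (SOME c. c \<in> A \<and> p \<in> fst c)"

definition chart_change ::
  "('m, 'e::euclidean_space) chart \<Rightarrow> ('m, 'e) chart \<Rightarrow> 'm \<Rightarrow> 'e \<Rightarrow> 'e" where
  "chart_change c d p = frechet_derivative (snd d \<circ> chart_inv c) (at (snd c p))"

text \<open>In what follows, objects on an open set \<open>U\<close> are total functions whose values outside \<open>U\<close>
  are irrelevant.\<close>

definition smooth_fun ::
  "('m, 'e::euclidean_space) chart set \<Rightarrow> 'm set \<Rightarrow> ('m \<Rightarrow> real) \<Rightarrow> bool" where
  "smooth_fun A U f \<longleftrightarrow> (\<forall>c\<in>A. smooth_on (snd c ` (U \<inter> fst c)) (f \<circ> chart_inv c))"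

definition vf_rep ::
  "('m, 'e::euclidean_space) chart set \<Rightarrow> ('m, 'e) chart \<Rightarrow> ('m \<Rightarrow> 'e) \<Rightarrow> 'e \<Rightarrow> 'e" where
  "vf_rep A c X x = (let p = chart_inv c x in chart_change (chart_at A p) c p (X p))"

definition smooth_vf ::
  "('m, 'e::euclidean_space) chart set \<Rightarrow> 'm set \<Rightarrow> ('m \<Rightarrow> 'e) \<Rightarrow> bool" where
  "smooth_vf A U X \<longleftrightarrow> (\<forall>c\<in>A. smooth_on (snd c ` (U \<inter> fst c)) (vf_rep A c X))"

definition lie_bracket ::
  "('m, 'e::euclidean_space) chart set \<Rightarrow> ('m \<Rightarrow> 'e) \<Rightarrow> ('m \<Rightarrow> 'e) \<Rightarrow> 'm \<Rightarrow> 'e" where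
  "lie_bracket A X Y p =
     (let c = chart_at A p; x = snd c p in
       frechet_derivative (vf_rep A c Y) (at x) (vf_rep A c X x)
       - frechet_derivative (vf_rep A c X) (at x) (vf_rep A c Y x))"

definition form_rep ::
  "('m, 'e::euclidean_space) chart set \<Rightarrow> ('m, 'e) chart \<Rightarrow> ('m \<Rightarrow> 'e \<Rightarrow> real) \<Rightarrow> 'e \<Rightarrow> 'e \<Rightarrow> real" where
  "form_rep A c \<alpha> x w = (let p = chart_inv c x in \<alpha> p (chart_change c (chart_at A p) p w))"

definition smooth_form ::
  "('m, 'e::euclidean_space) chart set \<Rightarrow> 'm set \<Rightarrow> ('m \<Rightarrow> 'e \<Rightarrow> real) \<Rightarrow> bool" where
  "smooth_form A U \<alpha> \<longleftrightarrow> (\<forall>p\<in>U. linear (\<alpha> p)) \<and>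
     (\<forall>c\<in>A. \<forall>w. smooth_on (snd c ` (U \<inter> fst c)) (\<lambda>x. form_rep A c \<alpha> x w))"

text \<open>Convention: \<open>d\<alpha>(X,Y) = X(\<alpha>(Y)) - Y(\<alpha>(X)) - \<alpha>([X,Y])\<close>, without a factor 1/2.\<close>
definition ext_deriv ::
  "('m, 'e::euclidean_space) chart set \<Rightarrow> ('m \<Rightarrow> 'e \<Rightarrow> real) \<Rightarrow> 'm \<Rightarrow> 'e \<Rightarrow> 'e \<Rightarrow> real" where
  "ext_deriv A \<alpha> p v w =
     (let c = chart_at A p; x = snd c p in
       frechet_derivative (\<lambda>y. form_rep A c \<alpha> y w) (at x) v
       - frechet_derivative (\<lambda>y. form_rep A c \<alpha> y v) (at x) w)"


section \<open>Subbundles of the tangent bundle\<close>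

definition subbundle ::
  "('m::topological_space, 'e::euclidean_space) chart set \<Rightarrow> 'm set \<Rightarrow> nat \<Rightarrow> ('m \<Rightarrow> 'e set) \<Rightarrow> bool" where
  "subbundle A U k E \<longleftrightarrow> (\<forall>p\<in>U. subspace (E p) \<and> dim (E p) = k) \<and>
     (\<forall>p\<in>U. \<exists>V X. open V \<and> p \<in> V \<and> V \<subseteq> U \<and> (\<forall>i<k. smooth_vf A V (X i)) \<and>
        (\<forall>q\<in>V. E q = span ((\<lambda>i. X i q) ` {..<k})))"

definition corank_subbundle ::
  "('m::topological_space, 'e::euclidean_space) chart set \<Rightarrow> 'm set \<Rightarrow> nat \<Rightarrow> ('m \<Rightarrow> 'e set) \<Rightarrow> bool" where
  "corank_subbundle A U r E \<longleftrightarrow> (\<exists>k. k + r = DIM('e) \<and> subbundle A U k E)"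

definition section_of ::
  "('m, 'e::euclidean_space) chart set \<Rightarrow> 'm set \<Rightarrow> ('m \<Rightarrow> 'e set) \<Rightarrow> ('m \<Rightarrow> 'e) \<Rightarrow> bool" where
  "section_of A U E X \<longleftrightarrow> smooth_vf A U X \<and> (\<forall>p\<in>U. X p \<in> E p)"

definition linear_on :: "'a::real_vector set \<Rightarrow> ('a \<Rightarrow> 'b::real_vector) \<Rightarrow> bool" where
  "linear_on V f \<longleftrightarrow> (\<forall>x\<in>V. \<forall>y\<in>V. f (x + y) = f x + f y) \<and> (\<forall>r. \<forall>x\<in>V. f (r *\<^sub>R x) = r *\<^sub>R f x)"

definition linear_complex_structure :: "'a::real_vector set \<Rightarrow> ('a \<Rightarrow> 'a) \<Rightarrow> bool" where
  "linear_complex_structure V J \<longleftrightarrow> linear_on V J \<and> (\<forall>x\<in>V. J x \<in> V \<and> J (J x) = - x)"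

definition complex_structure ::
  "('m::topological_space, 'e::euclidean_space) chart set \<Rightarrow> 'm set \<Rightarrow> ('m \<Rightarrow> 'e set)
    \<Rightarrow> ('m \<Rightarrow> 'e \<Rightarrow> 'e) \<Rightarrow> bool" where
  "complex_structure A U E J \<longleftrightarrow> (\<forall>p\<in>U. linear_complex_structure (E p) (J p)) \<and>
     (\<forall>V X. open V \<and> V \<subseteq> U \<and> section_of A V E X \<longrightarrow> smooth_vf A V (\<lambda>p. J p (X p)))"

definition bundle_metric ::
  "('m::topological_space, 'e::euclidean_space) chart set \<Rightarrow> ('m \<Rightarrow> 'e set)
    \<Rightarrow> ('m \<Rightarrow> 'e \<Rightarrow> 'e \<Rightarrow> real) \<Rightarrow> bool" where
  "bundle_metric A E \<gamma> \<longleftrightarrow>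
     (\<forall>p. \<forall>x\<in>E p. linear_on (E p) (\<gamma> p x) \<and> (\<forall>y\<in>E p. \<gamma> p x y = \<gamma> p y x) \<and> (x \<noteq> 0 \<longrightarrow> \<gamma> p x x > 0)) \<and>
     (\<forall>V X Y. open V \<and> section_of A V E X \<and> section_of A V E Y \<longrightarrow>
        smooth_fun A V (\<lambda>p. \<gamma> p (X p) (Y p)))"

definition conformal_class ::
  "('m::topological_space, 'e::euclidean_space) chart set \<Rightarrow> ('m \<Rightarrow> 'e set)
    \<Rightarrow> ('m \<Rightarrow> 'e \<Rightarrow> 'e \<Rightarrow> real) set \<Rightarrow> bool" where
  "conformal_class A E G \<longleftrightarrow> (\<exists>\<gamma>0. bundle_metric A E \<gamma>0 \<and>
     G = {\<gamma>. bundle_metric A E \<gamma> \<and> (\<exists>f. smooth_fun A UNIV f \<and> (\<forall>p. f p > 0) \<and>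
            (\<forall>p. \<forall>x\<in>E p. \<forall>y\<in>E p. \<gamma> p x y = f p * \<gamma>0 p x y))})"


section \<open>Quaternionic contact structures\<close>

text \<open>Indices range over the type \<open>3\<close>, whose arithmetic is modulo 3: the cyclic permutations
  of \<open>(1,2,3)\<close> are the triples \<open>(a, a + 1, a + 2)\<close>.

  A bundle of complex structures of \<open>Q\<close> assigns to \<open>p\<close> a set of maps on \<open>Q p\<close>; since functions
  are total, these maps are made unique by \<open>restrict\<close> to \<open>Q p\<close>.\<close>
definition sphere_comb :: "'e::real_vector set \<Rightarrow> (3 \<Rightarrow> 'e \<Rightarrow> 'e) \<Rightarrow> real^3 \<Rightarrow> 'e \<Rightarrow> 'e" where
  "sphere_comb V J v = restrict (\<lambda>x. \<Sum>a\<in>UNIV. v $ a *\<^sub>R J a x) V"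

text \<open>The injectivity requirement says that the fibre of \<open>\<I>\<close> is indeed a two-sphere. It holds
  automatically unless \<open>Q = 0\<close>, i.e. unless the manifold has dimension 3.\<close>
definition qc_structure ::
  "('m::topological_space, 'e::euclidean_space) chart set \<Rightarrow> ('m \<Rightarrow> 'e set)
    \<Rightarrow> ('m \<Rightarrow> 'e \<Rightarrow> 'e \<Rightarrow> real) set \<Rightarrow> ('m \<Rightarrow> ('e \<Rightarrow> 'e) set) \<Rightarrow> bool" where
  "qc_structure A Q G \<I> \<longleftrightarrow>
     corank_subbundle A UNIV 3 Q \<and> conformal_class A Q G \<and>
     (\<forall>p. \<forall>J\<in>\<I> p. linear_complex_structure (Q p) J) \<and>
     (\<forall>\<gamma>\<in>G. \<forall>p. \<forall>J\<in>\<I> p. \<forall>x\<in>Q p. \<forall>y\<in>Q p. \<gamma> p (J x) (J y) = \<gamma> p x y) \<and>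
     (\<forall>p0. \<exists>U I \<eta>. \<exists>\<gamma>\<in>G. open U \<and> p0 \<in> U \<and>
        (\<forall>a::3. complex_structure A U Q (I a) \<and> smooth_form A U (\<eta> a)) \<and>
        (\<forall>p\<in>U.
           (\<forall>x\<in>Q p. I 1 p (I 2 p x) = I 3 p x \<and> - I 2 p (I 1 p x) = I 3 p x) \<and>
           \<I> p = sphere_comb (Q p) (\<lambda>a. I a p) ` sphere 0 1 \<and>
           inj_on (sphere_comb (Q p) (\<lambda>a. I a p)) (sphere 0 1) \<and>
           Q p = {x. \<forall>a. \<eta> a p x = 0} \<and>
           (\<forall>a. \<forall>x\<in>Q p. \<forall>y\<in>Q p. \<gamma> p (I a p x) y = ext_deriv A (\<eta> a) p x y)))"


section \<open>Hyper CR structures\<close>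

type_synonym ('m, 'e) almost_CR = "('m \<Rightarrow> 'e set) \<times> ('m \<Rightarrow> 'e \<Rightarrow> 'e)"
type_synonym ('m, 'e) almost_hyper_CR = "('m, 'e) almost_CR \<times> ('m, 'e) almost_CR"

definition almost_CR_structure ::
  "('m::topological_space, 'e::euclidean_space) chart set \<Rightarrow> 'm set \<Rightarrow> ('m, 'e) almost_CR \<Rightarrow> bool" where
  "almost_CR_structure A U C \<longleftrightarrow>
     corank_subbundle A U 1 (fst C) \<and> complex_structure A U (fst C) (snd C)"

definition third_space :: "'e::real_vector set \<Rightarrow> ('e \<Rightarrow> 'e) \<Rightarrow> 'e set \<Rightarrow> ('e \<Rightarrow> 'e) \<Rightarrow> 'e set" where
  "third_space Q1 I1 Q2 I2 = {x + y |x y. x \<in> I1 ` (Q1 \<inter> Q2) \<and> y \<in> I2 ` (Q1 \<inter> Q2)}"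

definition third_map :: "'e::real_vector set \<Rightarrow> ('e \<Rightarrow> 'e) \<Rightarrow> 'e set \<Rightarrow> ('e \<Rightarrow> 'e) \<Rightarrow> 'e \<Rightarrow> 'e" where
  "third_map Q1 I1 Q2 I2 z = (THE w. \<exists>x\<in>I1 ` (Q1 \<inter> Q2). \<exists>y\<in>I2 ` (Q1 \<inter> Q2).
     z = x + y \<and> w = - I2 (I1 x) + I1 (I2 y))"

fun hQ :: "('m, 'e::real_vector) almost_hyper_CR \<Rightarrow> 3 \<Rightarrow> 'm \<Rightarrow> 'e set" where
  "hQ ((Q1, I1), (Q2, I2)) a p =
     (if a = 1 then Q1 p else if a = 2 then Q2 p else third_space (Q1 p) (I1 p) (Q2 p) (I2 p))"

fun hI :: "('m, 'e::real_vector) almost_hyper_CR \<Rightarrow> 3 \<Rightarrow> 'm \<Rightarrow> 'e \<Rightarrow> 'e" where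
  "hI ((Q1, I1), (Q2, I2)) a p =
     (if a = 1 then I1 p else if a = 2 then I2 p else third_map (Q1 p) (I1 p) (Q2 p) (I2 p))"

definition hcore :: "('m, 'e::real_vector) almost_hyper_CR \<Rightarrow> 'm \<Rightarrow> 'e set" where
  "hcore H p = (\<Inter>a. hQ H a p)"

fun almost_hyper_CR_structure ::
  "('m::topological_space, 'e::euclidean_space) chart set \<Rightarrow> 'm set
    \<Rightarrow> ('m, 'e) almost_hyper_CR \<Rightarrow> bool" where
  "almost_hyper_CR_structure A U ((Q1, I1), (Q2, I2)) \<longleftrightarrow>
     almost_CR_structure A U (Q1, I1) \<and> almost_CR_structure A U (Q2, I2) \<and>
     (\<forall>p\<in>U. {x + y |x y. x \<in> Q1 p \<and> y \<in> Q2 p} = UNIV \<and>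
        (\<forall>x \<in> I1 p ` (Q1 p \<inter> Q2 p) \<inter> I2 p ` (Q1 p \<inter> Q2 p). I1 p (I2 p x) = - I2 p (I1 p x)))"

definition hyper_CR_structure ::
  "('m::topological_space, 'e::euclidean_space) chart set \<Rightarrow> 'm set
    \<Rightarrow> ('m, 'e) almost_hyper_CR \<Rightarrow> bool" where
  "hyper_CR_structure A U H \<longleftrightarrow> almost_hyper_CR_structure A U H \<and>
     (\<forall>a X Y. section_of A U (hcore H) X \<and> section_of A U (hcore H) Y \<longrightarrow>
        (let IX = (\<lambda>p. hI H a p (X p)); IY = (\<lambda>p. hI H a p (Y p));
             Z = (\<lambda>p. lie_bracket A X Y p - lie_bracket A IX IY p)
         in \<forall>p\<in>U. Z p \<in> hQ H a p \<and>
              hI H a p (Z p) - lie_bracket A X IY p - lie_bracket A IX Y p \<in> hcore H p))"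

definition admissible_triple ::
  "('m, 'e::euclidean_space) chart set \<Rightarrow> 'm set
    \<Rightarrow> ('m, 'e) almost_hyper_CR \<Rightarrow> (3 \<Rightarrow> 'm \<Rightarrow> 'e) \<Rightarrow> bool" where
  "admissible_triple A V H T \<longleftrightarrow> (\<forall>a. smooth_vf A V (T a)) \<and>
     (\<forall>p\<in>V. span (hcore H p \<union> range (\<lambda>a. T a p)) = UNIV \<and>
        (\<forall>a. T a p \<in> hQ H (a + 1) p \<inter> hQ H (a + 2) p \<and> hI H a p (T (a + 1) p) = T (a + 2) p))"

text \<open>An admissible triple need only exist locally. As \<open>hQv\<close> and \<open>hIv\<close> do not depend on it, their
  values at \<open>p\<close> are defined by an admissible triple on some neighbourhood of \<open>p\<close>.\<close>
definition some_triple ::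
  "('m::topological_space, 'e::euclidean_space) chart set \<Rightarrow> ('m, 'e) almost_hyper_CR
    \<Rightarrow> 'm \<Rightarrow> 3 \<Rightarrow> 'e" where
  "some_triple A H p =
     (\<lambda>a. (SOME T. \<exists>V. open V \<and> p \<in> V \<and> admissible_triple A V H T) a p)"

definition hI_ext ::
  "('m::topological_space, 'e::euclidean_space) chart set \<Rightarrow> ('m, 'e) almost_hyper_CR
    \<Rightarrow> 3 \<Rightarrow> 'm \<Rightarrow> 'e \<Rightarrow> 'e" where
  "hI_ext A H a p x = (THE w. \<exists>y\<in>hQ H a p. \<exists>r. x = y + r *\<^sub>R some_triple A H p a \<and> w = hI H a p y)"

definition hQv ::
  "('m::topological_space, 'e::euclidean_space) chart set \<Rightarrow> ('m, 'e) almost_hyper_CR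
    \<Rightarrow> real^3 \<Rightarrow> 'm \<Rightarrow> 'e set" where
  "hQv A H v p = {x + (\<Sum>a\<in>UNIV. t $ a *\<^sub>R some_triple A H p a) |x t.
     x \<in> hcore H p \<and> (\<Sum>a\<in>UNIV. t $ a * v $ a) = 0}"

definition hIv ::
  "('m::topological_space, 'e::euclidean_space) chart set \<Rightarrow> ('m, 'e) almost_hyper_CR
    \<Rightarrow> real^3 \<Rightarrow> 'm \<Rightarrow> 'e \<Rightarrow> 'e" where
  "hIv A H v p = restrict (\<lambda>x. \<Sum>a\<in>UNIV. v $ a *\<^sub>R hI_ext A H a p x) (hQv A H v p)"


section \<open>Quaternionic CR structures\<close>

definition quaternionic_CR_structure ::
  "('m::topological_space, 'e::euclidean_space) chart set
    \<Rightarrow> ('m set \<times> ('m, 'e) almost_hyper_CR) set \<Rightarrow> bool" where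
  "quaternionic_CR_structure A \<U> \<longleftrightarrow>
     (\<forall>(U, H)\<in>\<U>. open U \<and> hyper_CR_structure A U H) \<and> (\<Union>(U, H)\<in>\<U>. U) = UNIV \<and>
     (\<forall>(U, H)\<in>\<U>. \<forall>(U', H')\<in>\<U>. U \<inter> U' \<noteq> {} \<longrightarrow>
        (\<exists>S :: 'm \<Rightarrow> real^3^3.
           (\<forall>a b. smooth_fun A (U \<inter> U') (\<lambda>p. S p $ a $ b)) \<and>
           (\<forall>p\<in>U \<inter> U'. rotation_matrix (S p) \<and>
              (\<forall>v\<in>sphere 0 1. hQv A H' v p = hQv A H (S p *v v) p \<and>
                               hIv A H' v p = hIv A H (S p *v v) p))))"

definition underlying_structure ::
  "('m::topological_space, 'e::euclidean_space) chart set
    \<Rightarrow> ('m set \<times> ('m, 'e) almost_hyper_CR) set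
    \<Rightarrow> ('m \<Rightarrow> 'e set) \<Rightarrow> ('m \<Rightarrow> ('e \<Rightarrow> 'e) set) \<Rightarrow> bool" where
  "underlying_structure A \<U> Q \<I> \<longleftrightarrow>
     (\<forall>(U, H)\<in>\<U>. \<forall>p\<in>U. Q p = hcore H p \<and>
        \<I> p = (\<lambda>v. restrict (hIv A H v p) (hcore H p)) ` sphere 0 1)"

end

theory Submission
  imports Defs
begin

text \<open>Locally, choose vector fields \<open>T\<^sub>a\<close> with \<open>\<eta>\<^sub>a(T\<^sub>b) = \<delta>\<^sub>a\<^sub>b\<close>, put \<open>Q\<^sub>a = ker \<eta>\<^sub>a\<close> and extend \<open>I\<^sub>a\<close> to \<open>Q\<^sub>a\<close>
  by \<open>I\<^sub>a T\<^sub>b = T\<^sub>c\<close>. Modulo \<open>Q\<close> the bracket of two sections of \<open>Q\<close> is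
  \<open>- \<Sum>\<^sub>b \<gamma>(I\<^sub>b X, Y) T\<^sub>b\<close>, and integrability becomes a consequence of the quaternion relations, whatever the
  choice of \<open>T\<close>. The choice matters on overlaps: two transverse frames with the same \<open>\<eta>\<close> define the same
  structures \<open>I\<^sub>v\<close> iff they differ by \<open>X\<^sub>b = I\<^sub>b Y\<close> for some section \<open>Y\<close> of \<open>Q\<close>.

  Consider the part \<open>M\<^sub>a\<^sub>b(X) = d\<eta>\<^sub>a(T\<^sub>b, X) + d\<eta>\<^sub>b(T\<^sub>a, X)\<close> of \<open>d\<eta>\<close>. Shifting \<open>T\<^sub>b\<close> by
  \<open>X\<^sub>b\<close> changes \<open>n\<^sub>b(X) = \<Sum>\<^sub>a M\<^sub>a\<^sub>b(I\<^sub>a I\<^sub>b X)\<close> by \<open>5 \<gamma>(X\<^sub>b, I\<^sub>b X)\<close> minus a term independent of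
  \<open>b\<close>. Hence the condition that \<open>n\<^sub>b\<close> be independent of \<open>b\<close> can be achieved smoothly by one explicit shift, and
  determines \<open>T\<close> up to shifts of the form \<open>I\<^sub>b Y\<close>. As \<open>\<eta>' = f S \<eta>\<close> with \<open>S\<close> in \<open>SO(3)\<close> on overlaps and
  the derivatives of \<open>f S\<close> add to \<open>M\<close> only a multiple of the identity matrix, the condition is independent of the
  local data, so that the normalised local structures fit together.\<close>

section \<open>Smooth maps on open sets\<close>

text \<open>The difficulty is gluing, not integrability: two frames \<open>T\<close> dual to the
  same \<open>\<eta>\<close> generally give different \<open>I_v\<close>, so a rule is needed that
  fixes \<open>T\<close> up to harmless shifts and reads the same in every local presentation.
  Shifts \<open>I_b Y\<close> are harmless because they change the extended \<open>I_a\<close> only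
  by a term \<open>\<eta>_a(x) Y\<close>, up to sign, and on \<open>Q_v\<close> the sum of the
  \<open>v_a \<eta>_a(x)\<close> is zero. The same cancellation removes the dependence on the
  admissible triple that the definitions pick by choice. The derivative of the rotation
  \<open>S\<close> is antisymmetric and disappears on symmetrising \<open>d\<eta>_a(T_b, x)\<close>;
  the derivative of the factor \<open>f\<close> enters every \<open>n_b\<close> in the same way.
  Hence the \<open>n_b\<close> are compared with each other and not set to zero. The constant 5 is 3
  + 1 + 1: \<open>X_b\<close> occurs in all three summands over \<open>a\<close>, once more in the
  summand \<open>a = b\<close>, and once to complete the subtracted sum over all \<open>a\<close>.
  As 5 is nonzero, the shift is found by Riesz representation in the metric of
  \<open>Q\<close>.\<close>

lemma frechet_derivative_eq:
  "(f has_derivative f') (at x) \<Longrightarrow> frechet_derivative f (at x) = f'"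
  using frechet_derivative_at by metis

lemma has_derivative_transform_on:
  assumes "(f has_derivative f') (at x)" "open S" "x \<in> S" "\<And>y. y \<in> S \<Longrightarrow> f y = g y"
  shows "(g has_derivative f') (at x)"
  using has_derivative_transform_within_open[OF assms(1-3)] assms(4) by blast

text \<open>Both functions satisfy \<open>has_derivative\<close> for the same candidates, so the
  choice operator picks the same map even where no derivative exists.\<close>

lemma frechet_derivative_cong_on:
  assumes "open S" "x \<in> S" "\<And>y. y \<in> S \<Longrightarrow> f y = g y"
  shows "frechet_derivative f (at x) = frechet_derivative g (at x)"
proof -
  have "(f has_derivative f') (at x) \<longleftrightarrow> (g has_derivative f') (at x)" for f'
    using has_derivative_transform_on[OF _ assms(1,2)] assms(3) by metis
  then show ?thesis unfolding frechet_derivative_def by presburger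
qed

section \<open>Calculus of the classes \<open>C_on k\<close> and \<open>smooth_on\<close>\<close>

lemma C_on_cong:
  assumes "open S" "\<And>y. y \<in> S \<Longrightarrow> f y = g y" "C_on k S f"
  shows "C_on k S g"
  using assms
proof (induction k arbitrary: f g)
  case 0
  then show ?case using continuous_on_cong[of S S f g] by simp
next
  case (Suc k)
  have d: "g differentiable (at x)" if "x \<in> S" for x
    using Suc.prems that has_derivative_transform_on[of f _ x S g]
    unfolding C_on.simps differentiable_def by metis
  have "C_on k S (\<lambda>x. frechet_derivative g (at x) v)" for v
    using Suc.IH[of "\<lambda>x. frechet_derivative f (at x) v" "\<lambda>x. frechet_derivative g (at x) v"]
      Suc.prems frechet_derivative_cong_on[of S _ f g] by simp
  with d show ?case by simp
qed

text \<open>The recursion never states continuity above level 0, so lowering the order needs an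
  induction whose base is that differentiable maps are continuous.\<close>

lemma C_on_SucD: "C_on (Suc k) S f \<Longrightarrow> C_on k S f"
proof (induction k arbitrary: f)
  case 0
  then show ?case
    by (auto intro!: continuous_at_imp_continuous_on differentiable_imp_continuous_within)
next
  case (Suc k)
  then show ?case by (metis C_on.simps(2))
qed

lemma C_on_subset: "C_on k S f \<Longrightarrow> T \<subseteq> S \<Longrightarrow> C_on k T f"
proof (induction k arbitrary: f)
  case 0
  then show ?case using continuous_on_subset by auto
next
  case (Suc k)
  then show ?case by (meson C_on.simps(2) subsetD)
qed

lemma C_on_bounded_linear:
  assumes "bounded_linear h" "open S" "C_on k S f"
  shows "C_on k S (\<lambda>x. h (f x))"
  using assms(3)
proof (induction k arbitrary: f)
  case 0
  then show ?case
    using bounded_linear.continuous_on[OF assms(1)] by simp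
next
  case (Suc k)
  have d: "((\<lambda>x. h (f x)) has_derivative (\<lambda>v. h (frechet_derivative f (at x) v))) (at x)"
    if "x \<in> S" for x
    using Suc.prems that bounded_linear.has_derivative[OF assms(1)] frechet_derivative_works
    by (metis C_on.simps(2))
  have "C_on k S (\<lambda>x. frechet_derivative (\<lambda>x. h (f x)) (at x) v)" for v
  proof (rule C_on_cong[OF assms(2)])
    show "C_on k S (\<lambda>x. h (frechet_derivative f (at x) v))"
      using Suc by simp
  qed (simp add: frechet_derivative_eq[OF d])
  with d show ?case by (auto simp: differentiable_def)
qed

lemma C_on_const: "C_on k S (\<lambda>x. c)"
  by (induction k arbitrary: c) auto

lemma C_on_add:
  assumes "open S" "C_on k S f" "C_on k S g"
  shows "C_on k S (\<lambda>x. f x + g x)"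
  using assms(2,3)
proof (induction k arbitrary: f g)
  case 0
  then show ?case using continuous_on_add by simp
next
  case (Suc k)
  have d: "((\<lambda>x. f x + g x) has_derivative
      (\<lambda>v. frechet_derivative f (at x) v + frechet_derivative g (at x) v)) (at x)"
    if "x \<in> S" for x
    using Suc.prems that by (intro has_derivative_add) (auto simp: frechet_derivative_works[symmetric])
  have "C_on k S (\<lambda>x. frechet_derivative (\<lambda>x. f x + g x) (at x) v)" for v
  proof (rule C_on_cong[OF assms(1)])
    show "C_on k S (\<lambda>x. frechet_derivative f (at x) v + frechet_derivative g (at x) v)"
      using Suc by simp
  qed (simp add: frechet_derivative_eq[OF d])
  with d show ?case by (auto simp: differentiable_def)
qed

lemma C_on_bounded_bilinear:
  assumes "bounded_bilinear h" "open S" "C_on k S f" "C_on k S g"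
  shows "C_on k S (\<lambda>x. h (f x) (g x))"
  using assms(3,4)
proof (induction k arbitrary: f g)
  case 0
  then show ?case using bounded_bilinear.continuous_on[OF assms(1)] by simp
next
  case (Suc k)
  have d: "((\<lambda>x. h (f x) (g x)) has_derivative
      (\<lambda>v. h (f x) (frechet_derivative g (at x) v) + h (frechet_derivative f (at x) v) (g x))) (at x)"
    if "x \<in> S" for x
    using Suc.prems that
    by (intro bounded_bilinear.FDERIV[OF assms(1)]) (auto simp: frechet_derivative_works[symmetric])
  have "C_on k S (\<lambda>x. frechet_derivative (\<lambda>x. h (f x) (g x)) (at x) v)" for v
  proof (rule C_on_cong[OF assms(2)])
    show "C_on k S (\<lambda>x. h (f x) (frechet_derivative g (at x) v) + h (frechet_derivative f (at x) v) (g x))"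
      using Suc by (intro C_on_add[OF assms(2)] Suc.IH) (auto dest: C_on_SucD simp del: C_on.simps,
          auto)
  qed (simp add: frechet_derivative_eq[OF d])
  with d show ?case by (auto simp: differentiable_def)
qed

lemma C_on_sum:
  assumes "open S" "finite B" "\<And>i. i \<in> B \<Longrightarrow> C_on k S (f i)"
  shows "C_on k S (\<lambda>x. \<Sum>i\<in>B. f i x)"
  using assms(2,3)
  by (induction B rule: finite_induct) (auto intro!: C_on_const C_on_add[OF assms(1)])

lemma C_on_inverse:
  fixes f :: "'a::real_normed_vector \<Rightarrow> real"
  assumes "open S" "C_on k S f" "\<And>x. x \<in> S \<Longrightarrow> f x \<noteq> 0"
  shows "C_on k S (\<lambda>x. inverse (f x))"
  using assms(2)
proof (induction k)
  case 0
  then show ?case using continuous_on_inverse[of S f] assms(3) by simp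
next
  case (Suc k)
  have d: "((\<lambda>x. inverse (f x)) has_derivative
      (\<lambda>v. - (inverse (f x) * frechet_derivative f (at x) v * inverse (f x)))) (at x)"
    if "x \<in> S" for x
    using Suc.prems that assms(3)
    by (intro Deriv.has_derivative_inverse) (auto simp: frechet_derivative_works[symmetric])
  have "C_on k S (\<lambda>x. frechet_derivative (\<lambda>x. inverse (f x)) (at x) v)" for v
  proof (rule C_on_cong[OF assms(1)])
    have i: "C_on k S (\<lambda>x. inverse (f x))" using Suc C_on_SucD by blast
    show "C_on k S (\<lambda>x. - (inverse (f x) * frechet_derivative f (at x) v * inverse (f x)))"
      using Suc.prems i
      by (intro C_on_bounded_linear[OF bounded_linear_minus[OF bounded_linear_ident] assms(1)]
          C_on_bounded_bilinear[OF bounded_bilinear_mult assms(1)]) auto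
  qed (simp add: frechet_derivative_eq[OF d])
  with d show ?case by (auto simp: differentiable_def)
qed

lemma linear_sum_Basis:
  fixes L :: "'a::euclidean_space \<Rightarrow> 'b::real_vector"
  assumes "linear L"
  shows "L v = (\<Sum>b\<in>Basis. (v \<bullet> b) *\<^sub>R L b)"
proof -
  have "L v = L (\<Sum>b\<in>Basis. (v \<bullet> b) *\<^sub>R b)" by (simp add: euclidean_representation)
  also have "\<dots> = (\<Sum>b\<in>Basis. (v \<bullet> b) *\<^sub>R L b)"
    using assms by (simp add: linear_sum linear_cmul)
  finally show ?thesis .
qed

text \<open>\<open>C_on\<close> speaks of derivatives in fixed directions, but the chain rule
  applies the derivative of \<open>g\<close> to a direction that moves with \<open>x\<close>.
  Expanding that direction in \<open>Basis\<close> gives finitely many products with fixed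
  directions, which is why the middle space is Euclidean.\<close>

lemma C_on_compose:
  fixes f :: "'a::real_normed_vector \<Rightarrow> 'b::euclidean_space"
  assumes "open S" "open T" "f ` S \<subseteq> T" "C_on k S f" "C_on k T g"
  shows "C_on k S (\<lambda>x. g (f x))"
  using assms(4,5)
proof (induction k arbitrary: g)
  case 0
  then show ?case using continuous_on_compose2[of T g S f] assms(3) by simp
next
  case (Suc k)
  have d: "((\<lambda>x. g (f x)) has_derivative
      (\<lambda>v. frechet_derivative g (at (f x)) (frechet_derivative f (at x) v))) (at x)"
    and l: "linear (frechet_derivative g (at (f x)))"
    if "x \<in> S" for x
  proof -
    have "g differentiable (at (f x))" using Suc.prems assms(3) that by auto
    moreover have "f differentiable (at x)" using Suc.prems that by simp
    ultimately show "((\<lambda>x. g (f x)) has_derivative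
      (\<lambda>v. frechet_derivative g (at (f x)) (frechet_derivative f (at x) v))) (at x)"
      "linear (frechet_derivative g (at (f x)))"
      using diff_chain_at[of f _ x g] linear_frechet_derivative
      by (auto simp: frechet_derivative_works o_def)
  qed
  have "C_on k S (\<lambda>x. frechet_derivative (\<lambda>x. g (f x)) (at x) v)" for v
  proof (rule C_on_cong[OF assms(1)])
    show "C_on k S (\<lambda>x. \<Sum>b\<in>Basis. (frechet_derivative f (at x) v \<bullet> b) *\<^sub>R
        frechet_derivative g (at (f x)) b)"
    proof (intro C_on_sum[OF assms(1)] C_on_bounded_bilinear[OF bounded_bilinear_scaleR assms(1)])
      fix b :: 'b
      show "C_on k S (\<lambda>x. frechet_derivative f (at x) v \<bullet> b)"
        using Suc.prems by (intro C_on_bounded_linear[OF bounded_linear_inner_left assms(1)]) auto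
      show "C_on k S (\<lambda>x. frechet_derivative g (at (f x)) b)"
        using Suc.prems C_on_SucD by (intro Suc.IH) auto
    qed simp
    fix x assume "x \<in> S"
    show "(\<Sum>b\<in>Basis. (frechet_derivative f (at x) v \<bullet> b) *\<^sub>R
        frechet_derivative g (at (f x)) b) = frechet_derivative (\<lambda>x. g (f x)) (at x) v"
      unfolding frechet_derivative_eq[OF d[OF \<open>x \<in> S\<close>]]
      using linear_sum_Basis[OF l[OF \<open>x \<in> S\<close>]] by metis
  qed
  with d show ?case by (auto simp: differentiable_def)
qed

lemma smooth_on_cong:
  "open S \<Longrightarrow> (\<And>y. y \<in> S \<Longrightarrow> f y = g y) \<Longrightarrow> smooth_on S f \<Longrightarrow> smooth_on S g"
  unfolding smooth_on_def using C_on_cong by blast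

lemma smooth_on_subset: "smooth_on S f \<Longrightarrow> T \<subseteq> S \<Longrightarrow> smooth_on T f"
  unfolding smooth_on_def using C_on_subset by blast

lemma smooth_on_const: "smooth_on S (\<lambda>x. c)"
  unfolding smooth_on_def using C_on_const by blast

lemma smooth_on_add:
  "open S \<Longrightarrow> smooth_on S f \<Longrightarrow> smooth_on S g \<Longrightarrow> smooth_on S (\<lambda>x. f x + g x)"
  unfolding smooth_on_def using C_on_add by blast

lemma smooth_on_bounded_linear:
  "bounded_linear h \<Longrightarrow> open S \<Longrightarrow> smooth_on S f \<Longrightarrow> smooth_on S (\<lambda>x. h (f x))"
  unfolding smooth_on_def using C_on_bounded_linear by blast

lemma smooth_on_scaleR:
  "open S \<Longrightarrow> smooth_on S f \<Longrightarrow> smooth_on S g \<Longrightarrow> smooth_on S (\<lambda>x. f x *\<^sub>R g x)"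
  unfolding smooth_on_def using C_on_bounded_bilinear[OF bounded_bilinear_scaleR] by blast

lemma smooth_on_mult:
  fixes f g :: "'a::real_normed_vector \<Rightarrow> real"
  shows "open S \<Longrightarrow> smooth_on S f \<Longrightarrow> smooth_on S g \<Longrightarrow> smooth_on S (\<lambda>x. f x * g x)"
  using smooth_on_scaleR[of S f g] by simp

lemma smooth_on_inverse:
  fixes f :: "'a::real_normed_vector \<Rightarrow> real"
  shows "open S \<Longrightarrow> smooth_on S f \<Longrightarrow> (\<And>x. x \<in> S \<Longrightarrow> f x \<noteq> 0) \<Longrightarrow> smooth_on S (\<lambda>x. inverse (f x))"
  unfolding smooth_on_def using C_on_inverse by blast

lemma smooth_on_sum:
  "open S \<Longrightarrow> finite B \<Longrightarrow> (\<And>i. i \<in> B \<Longrightarrow> smooth_on S (f i)) \<Longrightarrow> smooth_on S (\<lambda>x. \<Sum>i\<in>B. f i x)"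
  unfolding smooth_on_def using C_on_sum by blast

lemma smooth_on_compose:
  fixes f :: "'a::real_normed_vector \<Rightarrow> 'b::euclidean_space"
  shows "open S \<Longrightarrow> open T \<Longrightarrow> f ` S \<subseteq> T \<Longrightarrow> smooth_on S f \<Longrightarrow> smooth_on T g \<Longrightarrow>
    smooth_on S (\<lambda>x. g (f x))"
  unfolding smooth_on_def using C_on_compose by blast

lemma smooth_on_imp_differentiable: "smooth_on S f \<Longrightarrow> x \<in> S \<Longrightarrow> f differentiable (at x)"
  unfolding smooth_on_def by (metis C_on.simps(2))

lemma smooth_on_frechet_derivative:
  "smooth_on S f \<Longrightarrow> smooth_on S (\<lambda>x. frechet_derivative f (at x) v)"
  unfolding smooth_on_def by (metis C_on.simps(2))

lemma smooth_on_imp_continuous_on: "smooth_on S f \<Longrightarrow> continuous_on S f"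
  unfolding smooth_on_def by (metis C_on.simps(1))

lemma smooth_on_has_derivative:
  "smooth_on S f \<Longrightarrow> x \<in> S \<Longrightarrow> (f has_derivative frechet_derivative f (at x)) (at x)"
  using smooth_on_imp_differentiable frechet_derivative_works by blast

lemma smooth_on_linear_frechet_derivative:
  "smooth_on S f \<Longrightarrow> x \<in> S \<Longrightarrow> linear (frechet_derivative f (at x))"
  using smooth_on_imp_differentiable linear_frechet_derivative by blast

section \<open>Symmetry of second derivatives\<close>

text \<open>The mean value theorem is applied twice: along \<open>v\<close> to the increment of
  \<open>f\<close> by \<open>s w\<close>, then along \<open>w\<close> to the resulting
  \<open>v\<close>-derivative. The left side is symmetric in \<open>v\<close> and \<open>w\<close>,
  so both mixed derivatives can be compared with it.\<close>

lemma second_difference_mean_value: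
  fixes f :: "'a::real_normed_vector \<Rightarrow> real"
  assumes sm: "smooth_on S f" and s: "s > 0"
    and seg: "\<And>r t. 0 \<le> r \<Longrightarrow> r \<le> s \<Longrightarrow> 0 \<le> t \<Longrightarrow> t \<le> s \<Longrightarrow> x + r *\<^sub>R v + t *\<^sub>R w \<in> S"
  obtains r t where "0 < r" "r < s" "0 < t" "t < s"
    "f (x + s *\<^sub>R v + s *\<^sub>R w) - f (x + s *\<^sub>R v) - f (x + s *\<^sub>R w) + f x =
       s * s * frechet_derivative (\<lambda>y. frechet_derivative f (at y) v) (at (x + r *\<^sub>R v + t *\<^sub>R w)) w"
proof -
  have line: "((\<lambda>r. g (y + r *\<^sub>R u)) has_real_derivative frechet_derivative g (at (y + r *\<^sub>R u)) u) (at r)"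
    if g: "smooth_on S g" and "y + r *\<^sub>R u \<in> S" for g :: "'a \<Rightarrow> real" and y u r
  proof -
    have "((\<lambda>r. y + r *\<^sub>R u) has_derivative (\<lambda>h. h *\<^sub>R u)) (at r)"
      by (auto intro!: derivative_eq_intros)
    then have "((\<lambda>r. g (y + r *\<^sub>R u)) has_derivative
        (\<lambda>h. frechet_derivative g (at (y + r *\<^sub>R u)) (h *\<^sub>R u))) (at r)"
      using diff_chain_at[of "\<lambda>r. y + r *\<^sub>R u" _ r g, OF _ smooth_on_has_derivative[OF that]] by (simp add: o_def)
    then show ?thesis
      by (simp add: has_field_derivative_def linear_cmul[OF smooth_on_linear_frechet_derivative[OF that]]
          mult.commute[of _ "frechet_derivative g _ _"])
  qed
  have "\<exists>r. 0 < r \<and> r < s \<and>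
      (f (x + s *\<^sub>R w + s *\<^sub>R v) - f (x + s *\<^sub>R v)) - (f (x + s *\<^sub>R w + 0 *\<^sub>R v) - f (x + 0 *\<^sub>R v)) =
      (s - 0) * (frechet_derivative f (at (x + s *\<^sub>R w + r *\<^sub>R v)) v - frechet_derivative f (at (x + r *\<^sub>R v)) v)"
    using seg[of _ 0] seg[of _ s] s
    by (intro MVT2[where f="\<lambda>r. f (x + s *\<^sub>R w + r *\<^sub>R v) - f (x + r *\<^sub>R v)"] DERIV_diff line sm)
      (auto simp: add.assoc add.commute[of "s *\<^sub>R w"])
  then obtain r where r: "0 < r" "r < s" and
    1: "f (x + s *\<^sub>R v + s *\<^sub>R w) - f (x + s *\<^sub>R v) - f (x + s *\<^sub>R w) + f x =
      s * (frechet_derivative f (at (x + r *\<^sub>R v + s *\<^sub>R w)) v - frechet_derivative f (at (x + r *\<^sub>R v)) v)"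
    by (auto simp: add.assoc add.commute[of "s *\<^sub>R w"])
  have "\<exists>t. 0 < t \<and> t < s \<and>
      frechet_derivative f (at (x + r *\<^sub>R v + s *\<^sub>R w)) v - frechet_derivative f (at (x + r *\<^sub>R v + 0 *\<^sub>R w)) v
      = (s - 0) * frechet_derivative (\<lambda>y. frechet_derivative f (at y) v) (at (x + r *\<^sub>R v + t *\<^sub>R w)) w"
    using seg s r
    by (intro MVT2[where f="\<lambda>t. frechet_derivative f (at (x + r *\<^sub>R v + t *\<^sub>R w)) v"]
        line smooth_on_frechet_derivative sm) auto
  then show ?thesis using r 1 that by auto
qed

lemma frechet_derivative_second_symmetric_real:
  fixes f :: "'a::real_normed_vector \<Rightarrow> real"
  assumes "open S" "smooth_on S f" "x \<in> S"
  shows "frechet_derivative (\<lambda>y. frechet_derivative f (at y) v) (at x) w =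
    frechet_derivative (\<lambda>y. frechet_derivative f (at y) w) (at x) v" (is "?F x = ?G x")
proof (rule ccontr)
  assume ne: "?F x \<noteq> ?G x"
  \<comment> \<open>Half of the supposed gap, so that two errors below \<open>e\<close> cannot
    bridge it.\<close>
  define e where "e = \<bar>?F x - ?G x\<bar> / 2"
  have e: "e > 0" using ne by (simp add: e_def)
  have "continuous_on S ?F" "continuous_on S ?G"
    using assms(2) by (auto intro!: smooth_on_imp_continuous_on smooth_on_frechet_derivative)
  then have "isCont ?F x" "isCont ?G x"
    using assms(1,3) continuous_on_eq_continuous_at by blast+
  then have near_x: "\<exists>d>0. \<forall>y. dist y x < d \<longrightarrow> \<bar>?F y - ?F x\<bar> < e" "\<exists>d>0. \<forall>y. dist y x < d \<longrightarrow> \<bar>?G y - ?G x\<bar> < e"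
    using e unfolding continuous_at_eps_delta dist_real_def by blast+
  obtain d1 where d1: "d1 > 0" "\<And>y. dist y x < d1 \<Longrightarrow> \<bar>?F y - ?F x\<bar> < e"
    using near_x(1) by blast
  obtain d2 where d2: "d2 > 0" "\<And>y. dist y x < d2 \<Longrightarrow> \<bar>?G y - ?G x\<bar> < e"
    using near_x(2) by blast
  obtain d3 where d3: "d3 > 0" "ball x d3 \<subseteq> S" using assms(1,3) openE by blast
  define d where "d = Min {d1, d2, d3}"
  have d: "d > 0" "d \<le> d1" "d \<le> d2" "d \<le> d3" using d1 d2 d3 by (auto simp: d_def)
  \<comment> \<open>The summand 1 keeps \<open>N\<close> positive when \<open>v\<close> and
    \<open>w\<close> vanish; side length \<open>s = d / N\<close> then keeps the whole parallelogram
    within distance \<open>d\<close> of \<open>x\<close>.\<close>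
  define N where "N = norm v + norm w + 1"
  have N: "N > 0" unfolding N_def by (intro add_nonneg_pos add_nonneg_nonneg) auto
  define s where "s = d / N"
  have s: "s > 0" using d(1) N by (simp add: s_def)
  have near: "dist (x + r *\<^sub>R v + t *\<^sub>R w) x < d"
    if "0 \<le> r" "r \<le> s" "0 \<le> t" "t \<le> s" for r t
  proof -
    have "dist (x + r *\<^sub>R v + t *\<^sub>R w) x \<le> r * norm v + t * norm w"
      using norm_triangle_ineq[of "r *\<^sub>R v" "t *\<^sub>R w"] that by (simp add: dist_norm add.assoc)
    also have "\<dots> \<le> s * norm v + s * norm w"
      using that by (intro add_mono mult_right_mono) auto
    also have "\<dots> < s * N" using s by (simp add: N_def algebra_simps)
    also have "\<dots> = d"
      using N by (simp add: s_def)
    finally show ?thesis .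
  qed
  have inS: "x + r *\<^sub>R v + t *\<^sub>R w \<in> S" if "0 \<le> r" "r \<le> s" "0 \<le> t" "t \<le> s" for r t
    using near[OF that] d3 d by (auto simp: dist_commute)
  have inS': "x + r *\<^sub>R w + t *\<^sub>R v \<in> S" if "0 \<le> r" "r \<le> s" "0 \<le> t" "t \<le> s" for r t
    using inS[of t r] that by (simp add: ac_simps)
  obtain r t where rt: "0 < r" "r < s" "0 < t" "t < s" and
    1: "f (x + s *\<^sub>R v + s *\<^sub>R w) - f (x + s *\<^sub>R v) - f (x + s *\<^sub>R w) + f x =
       s * s * ?F (x + r *\<^sub>R v + t *\<^sub>R w)"
    by (rule second_difference_mean_value[OF assms(2) s inS])
  obtain r' t' where rt': "0 < r'" "r' < s" "0 < t'" "t' < s" and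
    2: "f (x + s *\<^sub>R w + s *\<^sub>R v) - f (x + s *\<^sub>R w) - f (x + s *\<^sub>R v) + f x =
       s * s * ?G (x + r' *\<^sub>R w + t' *\<^sub>R v)"
    by (rule second_difference_mean_value[OF assms(2) s inS'])
  have "s * s * ?F (x + r *\<^sub>R v + t *\<^sub>R w) = s * s * ?G (x + t' *\<^sub>R v + r' *\<^sub>R w)"
  proof -
    have "x + s *\<^sub>R w + s *\<^sub>R v = x + s *\<^sub>R v + s *\<^sub>R w"
      "x + r' *\<^sub>R w + t' *\<^sub>R v = x + t' *\<^sub>R v + r' *\<^sub>R w" by (simp_all add: ac_simps)
    with 2 have "f (x + s *\<^sub>R v + s *\<^sub>R w) - f (x + s *\<^sub>R w) - f (x + s *\<^sub>R v) + f x =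
       s * s * ?G (x + t' *\<^sub>R v + r' *\<^sub>R w)" by metis
    then show ?thesis using 1 by linarith
  qed
  then have "?F (x + r *\<^sub>R v + t *\<^sub>R w) = ?G (x + t' *\<^sub>R v + r' *\<^sub>R w)" using s by simp
  moreover have "\<bar>?F (x + r *\<^sub>R v + t *\<^sub>R w) - ?F x\<bar> < e"
    using near[of r t] rt d by (intro d1) auto
  moreover have "\<bar>?G (x + t' *\<^sub>R v + r' *\<^sub>R w) - ?G x\<bar> < e"
    using near[of t' r'] rt' d by (intro d2) auto
  ultimately show False unfolding e_def by (simp add: abs_if split: if_splits)
qed

lemma frechet_derivative_inner_left:
  fixes f :: "'a::real_normed_vector \<Rightarrow> 'b::real_inner"
  assumes "f differentiable (at x)"
  shows "frechet_derivative (\<lambda>y. f y \<bullet> b) (at x) v = frechet_derivative f (at x) v \<bullet> b"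
  using bounded_linear.has_derivative[OF bounded_linear_inner_left] assms
  by (subst frechet_derivative_eq[of _ "\<lambda>v. frechet_derivative f (at x) v \<bullet> b"])
    (auto simp: frechet_derivative_works)

lemma frechet_derivative_second_symmetric:
  fixes f :: "'a::real_normed_vector \<Rightarrow> 'b::euclidean_space"
  assumes "open S" "smooth_on S f" "x \<in> S"
  shows "frechet_derivative (\<lambda>y. frechet_derivative f (at y) v) (at x) w =
    frechet_derivative (\<lambda>y. frechet_derivative f (at y) w) (at x) v"
proof (rule euclidean_eqI)
  fix b :: 'b assume "b \<in> Basis"
  have *: "frechet_derivative (\<lambda>y. frechet_derivative f (at y) v) (at x) w \<bullet> b =
    frechet_derivative (\<lambda>y. frechet_derivative (\<lambda>z. f z \<bullet> b) (at y) v) (at x) w" for v w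
  proof -
    have "frechet_derivative (\<lambda>y. frechet_derivative f (at y) v) (at x) w \<bullet> b =
      frechet_derivative (\<lambda>y. frechet_derivative f (at y) v \<bullet> b) (at x) w"
      by (rule frechet_derivative_inner_left[symmetric])
        (rule smooth_on_imp_differentiable[OF smooth_on_frechet_derivative[OF assms(2)] assms(3)])
    also have "\<dots> = frechet_derivative (\<lambda>y. frechet_derivative (\<lambda>z. f z \<bullet> b) (at y) v) (at x) w"
      by (intro fun_cong[OF frechet_derivative_cong_on[OF assms(1,3)]]
          frechet_derivative_inner_left[symmetric] smooth_on_imp_differentiable[OF assms(2)])
    finally show ?thesis .
  qed
  have "smooth_on S (\<lambda>z. f z \<bullet> b)"
    by (rule smooth_on_bounded_linear[OF bounded_linear_inner_left assms(1,2)])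
  from frechet_derivative_second_symmetric_real[OF assms(1) this assms(3)]
  show "frechet_derivative (\<lambda>y. frechet_derivative f (at y) v) (at x) w \<bullet> b =
    frechet_derivative (\<lambda>y. frechet_derivative f (at y) w) (at x) v \<bullet> b"
    unfolding * .
qed

section \<open>Charts\<close>

lemma smooth_atlasD:
  assumes "smooth_atlas A" "c \<in> A"
  shows "is_chart c" "d \<in> A \<Longrightarrow> smooth_on (snd c ` (fst c \<inter> fst d)) (snd d \<circ> chart_inv c)"
  using assms by (auto simp: smooth_atlas_def)

lemma chart_inv_left: "is_chart c \<Longrightarrow> p \<in> fst c \<Longrightarrow> chart_inv c (snd c p) = p"
  unfolding is_chart_def homeomorphism_def by auto

lemma chart_inv_mem:
  "is_chart c \<Longrightarrow> x \<in> snd c ` (U \<inter> fst c) \<Longrightarrow> chart_inv c x \<in> U \<inter> fst c"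
  using chart_inv_left by fastforce

lemma chart_inv_right: "is_chart c \<Longrightarrow> x \<in> snd c ` (U \<inter> fst c) \<Longrightarrow> snd c (chart_inv c x) = x"
  using chart_inv_left by fastforce

lemma open_chart_image:
  assumes "is_chart c" "open U"
  shows "open (snd c ` (U \<inter> fst c))"
proof -
  have h: "homeomorphism (fst c) (snd c ` fst c) (snd c) (chart_inv c)"
    and o: "open (fst c)" "open (snd c ` fst c)"
    using assms by (auto simp: is_chart_def)
  have "openin (top_of_set (snd c ` fst c)) (snd c ` (U \<inter> fst c))"
    using homeomorphism_imp_open_map[OF h] assms(2)
    by (metis inf.commute openin_open_Int)
  then show ?thesis using o(2) openin_open_eq by blast
qed

lemma chart_at:
  assumes "smooth_atlas A"
  shows "chart_at A p \<in> A" "p \<in> fst (chart_at A p)"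
proof -
  have "\<exists>c. c \<in> A \<and> p \<in> fst c" using assms unfolding smooth_atlas_def by blast
  then have "chart_at A p \<in> A \<and> p \<in> fst (chart_at A p)"
    unfolding chart_at_def by (rule someI_ex)
  then show "chart_at A p \<in> A" "p \<in> fst (chart_at A p)" by auto
qed

lemma chart_change_self:
  assumes "is_chart c" "p \<in> fst c"
  shows "chart_change c c p v = v"
proof -
  have "frechet_derivative (snd c \<circ> chart_inv c) (at (snd c p)) = frechet_derivative (\<lambda>x. x) (at (snd c p))"
    using assms chart_inv_right[OF assms(1), of _ UNIV] open_chart_image[OF assms(1), of UNIV]
    by (intro frechet_derivative_cong_on[where S="snd c ` (UNIV \<inter> fst c)"]) auto
  then show ?thesis by (simp add: chart_change_def)
qed

lemma transition_smooth:
  assumes "smooth_atlas A" "c \<in> A" "d \<in> A"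
  shows "smooth_on (snd c ` (fst c \<inter> fst d)) (snd d \<circ> chart_inv c)"
    "open (snd c ` (fst c \<inter> fst d))"
proof -
  show "smooth_on (snd c ` (fst c \<inter> fst d)) (snd d \<circ> chart_inv c)"
    using assms smooth_atlasD by blast
  have "open (fst d)" using smooth_atlasD(1)[OF assms(1,3)] by (simp add: is_chart_def)
  then show "open (snd c ` (fst c \<inter> fst d))"
    using open_chart_image[OF smooth_atlasD(1)[OF assms(1,2)]] by (simp add: Int_commute[of "fst c" "fst d"])
qed

lemma transition_has_derivative:
  assumes "smooth_atlas A" "c \<in> A" "d \<in> A" "p \<in> fst c" "p \<in> fst d"
  shows "((snd d \<circ> chart_inv c) has_derivative chart_change c d p) (at (snd c p))"
  unfolding chart_change_def
  using smooth_on_has_derivative[OF transition_smooth(1)[OF assms(1-3)]] assms by blast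

lemma linear_chart_change:
  assumes "smooth_atlas A" "c \<in> A" "d \<in> A" "p \<in> fst c" "p \<in> fst d"
  shows "linear (chart_change c d p)"
  using has_derivative_linear[OF transition_has_derivative[OF assms]] .

lemma chart_change_chart_change:
  assumes A: "smooth_atlas A" and c: "c \<in> A" "p \<in> fst c" and d: "d \<in> A" "p \<in> fst d"
    and e: "e \<in> A" "p \<in> fst e"
  shows "chart_change d e p (chart_change c d p v) = chart_change c e p v"
proof -
  have cc: "is_chart c" "is_chart d" using A c d smooth_atlasD(1) by blast+
  have "((\<lambda>x. (snd e \<circ> chart_inv d) ((snd d \<circ> chart_inv c) x)) has_derivative
      (\<lambda>v. chart_change d e p (chart_change c d p v))) (at (snd c p))"
    using diff_chain_at[OF transition_has_derivative[OF A c(1) d(1) c(2) d(2)], of "snd e \<circ> chart_inv d"]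
      transition_has_derivative[OF A d(1) e(1) d(2) e(2)] chart_inv_left[OF cc(1) c(2)]
    by (simp add: o_def)
  then have "((snd e \<circ> chart_inv c) has_derivative
      (\<lambda>v. chart_change d e p (chart_change c d p v))) (at (snd c p))"
  proof (rule has_derivative_transform_on)
    show "open (snd c ` (fst c \<inter> fst d))" using transition_smooth A c d by blast
    show "snd c p \<in> snd c ` (fst c \<inter> fst d)" using c d by blast
    fix x assume "x \<in> snd c ` (fst c \<inter> fst d)"
    then show "(snd e \<circ> chart_inv d) ((snd d \<circ> chart_inv c) x) = (snd e \<circ> chart_inv c) x"
      using cc by (auto simp: chart_inv_left)
  qed
  then show ?thesis unfolding chart_change_def[of c e] using frechet_derivative_eq by metis
qed

lemma chart_change_inverse:
  assumes "smooth_atlas A" "c \<in> A" "p \<in> fst c" "d \<in> A" "p \<in> fst d"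
  shows "chart_change d c p (chart_change c d p v) = v"
  using chart_change_chart_change[OF assms assms(2,3)] chart_change_self smooth_atlasD(1) assms
  by metis

lemma vf_rep_eq:
  "is_chart c \<Longrightarrow> p \<in> fst c \<Longrightarrow> vf_rep A c X (snd c p) = chart_change (chart_at A p) c p (X p)"
  by (simp add: vf_rep_def chart_inv_left)

lemma form_rep_eq:
  "is_chart c \<Longrightarrow> p \<in> fst c \<Longrightarrow>
    form_rep A c \<alpha> (snd c p) w = \<alpha> p (chart_change c (chart_at A p) p w)"
  by (simp add: form_rep_def chart_inv_left)

lemma form_rep_chart_change:
  assumes "smooth_atlas A" "c \<in> A" "p \<in> fst c" "d \<in> A" "p \<in> fst d"
  shows "form_rep A c \<alpha> (snd c p) w = form_rep A d \<alpha> (snd d p) (chart_change c d p w)"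
  using assms chart_at[OF assms(1), of p] smooth_atlasD(1)[OF assms(1)]
  by (simp add: form_rep_eq chart_change_chart_change)

lemma form_rep_chart_at:
  assumes "smooth_atlas A"
  shows "form_rep A (chart_at A p) \<alpha> (snd (chart_at A p) p) w = \<alpha> p w"
    "vf_rep A (chart_at A p) X (snd (chart_at A p) p) = X p"
  using chart_at[OF assms, of p] smooth_atlasD(1)[OF assms]
  by (simp_all add: form_rep_eq vf_rep_eq chart_change_self)

lemma form_rep_vf_rep:
  assumes "smooth_atlas A" "c \<in> A" "p \<in> fst c"
  shows "form_rep A c \<alpha> (snd c p) (vf_rep A c X (snd c p)) = \<alpha> p (X p)"
  using assms chart_at[OF assms(1), of p] smooth_atlasD(1)[OF assms(1)]
  by (simp add: form_rep_eq vf_rep_eq chart_change_inverse)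

section \<open>Smooth functions, vector fields and forms\<close>

lemma smooth_vf_cong:
  assumes "smooth_atlas A" "open U" "\<And>p. p \<in> U \<Longrightarrow> X p = Y p" "smooth_vf A U X"
  shows "smooth_vf A U Y"
  unfolding smooth_vf_def
proof
  fix c assume c: "c \<in> A"
  note ic = smooth_atlasD(1)[OF assms(1) c]
  show "smooth_on (snd c ` (U \<inter> fst c)) (vf_rep A c Y)"
  proof (rule smooth_on_cong[OF open_chart_image[OF ic assms(2)]])
    show "smooth_on (snd c ` (U \<inter> fst c)) (vf_rep A c X)"
      using assms(4) c by (simp add: smooth_vf_def)
    fix x assume "x \<in> snd c ` (U \<inter> fst c)"
    then have "chart_inv c x \<in> U" using chart_inv_mem[OF ic] by blast
    then show "vf_rep A c X x = vf_rep A c Y x" using assms(3) by (simp add: vf_rep_def Let_def)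
  qed
qed

lemma chart_image_mono: "V \<subseteq> U \<Longrightarrow> snd c ` (V \<inter> fst c) \<subseteq> snd c ` (U \<inter> fst c)"
  by blast

lemma smooth_fun_subset: "smooth_fun A U f \<Longrightarrow> V \<subseteq> U \<Longrightarrow> smooth_fun A V f"
  unfolding smooth_fun_def by (metis (no_types, lifting) smooth_on_subset[OF _ chart_image_mono] subsetD)

lemma smooth_vf_subset: "smooth_vf A U f \<Longrightarrow> V \<subseteq> U \<Longrightarrow> smooth_vf A V f"
  unfolding smooth_vf_def by (metis (no_types, lifting) smooth_on_subset[OF _ chart_image_mono] subsetD)

lemma smooth_form_subset: "smooth_form A U f \<Longrightarrow> V \<subseteq> U \<Longrightarrow> smooth_form A V f"
  unfolding smooth_form_def by (metis (no_types, lifting) smooth_on_subset[OF _ chart_image_mono] subsetD)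

lemma smooth_fun_const: "smooth_fun A U (\<lambda>p. r)"
  by (simp add: smooth_fun_def o_def smooth_on_const)

lemma smooth_fun_add:
  "smooth_atlas A \<Longrightarrow> open U \<Longrightarrow> smooth_fun A U f \<Longrightarrow> smooth_fun A U g \<Longrightarrow>
    smooth_fun A U (\<lambda>p. f p + g p)"
  unfolding smooth_fun_def o_def
  by (intro ballI smooth_on_add open_chart_image smooth_atlasD(1)) auto

lemma smooth_fun_mult:
  "smooth_atlas A \<Longrightarrow> open U \<Longrightarrow> smooth_fun A U f \<Longrightarrow> smooth_fun A U g \<Longrightarrow>
    smooth_fun A U (\<lambda>p. f p * g p)"
  unfolding smooth_fun_def o_def
  by (intro ballI smooth_on_mult open_chart_image smooth_atlasD(1)) auto

lemma smooth_fun_uminus: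
  "smooth_atlas A \<Longrightarrow> open U \<Longrightarrow> smooth_fun A U f \<Longrightarrow> smooth_fun A U (\<lambda>p. - f p)"
  using smooth_fun_mult[of A U "\<lambda>p. -1" f] smooth_fun_const[of A U "-1"] by simp

lemma smooth_fun_diff:
  "smooth_atlas A \<Longrightarrow> open U \<Longrightarrow> smooth_fun A U f \<Longrightarrow> smooth_fun A U g \<Longrightarrow>
    smooth_fun A U (\<lambda>p. f p - g p)"
  using smooth_fun_add[of A U f "\<lambda>p. - g p"] smooth_fun_uminus[of A U g] by simp

lemma smooth_fun_inverse:
  assumes "smooth_atlas A" "open U" "smooth_fun A U f" "\<And>p. p \<in> U \<Longrightarrow> f p \<noteq> 0"
  shows "smooth_fun A U (\<lambda>p. inverse (f p))"
  unfolding smooth_fun_def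
proof
  fix c assume c: "c \<in> A"
  note ic = smooth_atlasD(1)[OF assms(1) c]
  show "smooth_on (snd c ` (U \<inter> fst c)) ((\<lambda>p. inverse (f p)) \<circ> chart_inv c)"
    using smooth_on_inverse[OF open_chart_image[OF ic assms(2)], of "f \<circ> chart_inv c"]
      assms(3,4) c chart_inv_mem[OF ic]
    by (auto simp: smooth_fun_def o_def)
qed

lemma smooth_fun_divide:
  assumes "smooth_atlas A" "open U" "smooth_fun A U f" "smooth_fun A U g" "\<And>p. p \<in> U \<Longrightarrow> g p \<noteq> 0"
  shows "smooth_fun A U (\<lambda>p. f p / g p)"
  unfolding divide_inverse using assms by (intro smooth_fun_mult smooth_fun_inverse)

lemma smooth_fun_sum:
  assumes "smooth_atlas A" "open U" "finite B" "\<And>i. i \<in> B \<Longrightarrow> smooth_fun A U (f i)"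
  shows "smooth_fun A U (\<lambda>p. \<Sum>i\<in>B. f i p)"
  using assms(3,4)
  by (induction B rule: finite_induct) (auto intro!: smooth_fun_const smooth_fun_add[OF assms(1,2)])

lemma smooth_fun_imp_differentiable:
  assumes "smooth_atlas A" "c \<in> A" "p \<in> fst c" "p \<in> U" "smooth_fun A U f"
  shows "(f \<circ> chart_inv c) differentiable (at (snd c p))"
  using assms smooth_on_imp_differentiable unfolding smooth_fun_def by blast

lemma smooth_fun_imp_continuous_on:
  assumes "smooth_atlas A" "c \<in> A" "smooth_fun A U f"
  shows "continuous_on (U \<inter> fst c) f"
proof -
  note ic = smooth_atlasD(1)[OF assms(1,2)]
  have "continuous_on (snd c ` (U \<inter> fst c)) (f \<circ> chart_inv c)"
    using assms smooth_on_imp_continuous_on unfolding smooth_fun_def by blast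
  moreover have "continuous_on (U \<inter> fst c) (snd c)"
    using ic unfolding is_chart_def homeomorphism_def by (meson continuous_on_subset inf_le2)
  ultimately have "continuous_on (U \<inter> fst c) ((f \<circ> chart_inv c) \<circ> snd c)"
    using continuous_on_compose by blast
  then show ?thesis
    by (rule continuous_on_eq) (simp add: chart_inv_left[OF ic])
qed

lemma linear_frame_change:
  assumes "smooth_atlas A" "c \<in> A" "p \<in> fst c"
  shows "linear (chart_change (chart_at A p) c p)"
  using assms chart_at[OF assms(1), of p] linear_chart_change by blast

lemma smooth_vf_add:
  assumes "smooth_atlas A" "open U" "smooth_vf A U X" "smooth_vf A U Y"
  shows "smooth_vf A U (\<lambda>p. X p + Y p)"
  unfolding smooth_vf_def
proof
  fix c assume c: "c \<in> A"
  note ic = smooth_atlasD(1)[OF assms(1) c]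
  show "smooth_on (snd c ` (U \<inter> fst c)) (vf_rep A c (\<lambda>p. X p + Y p))"
  proof (rule smooth_on_cong[OF open_chart_image[OF ic assms(2)]])
    show "smooth_on (snd c ` (U \<inter> fst c)) (\<lambda>x. vf_rep A c X x + vf_rep A c Y x)"
      using assms c by (intro smooth_on_add open_chart_image ic) (auto simp: smooth_vf_def)
    fix x assume "x \<in> snd c ` (U \<inter> fst c)"
    then show "vf_rep A c X x + vf_rep A c Y x = vf_rep A c (\<lambda>p. X p + Y p) x"
      using linear_frame_change[OF assms(1) c] ic by (auto simp: vf_rep_eq linear_add)
  qed
qed

lemma smooth_vf_scaleR:
  assumes "smooth_atlas A" "open U" "smooth_fun A U f" "smooth_vf A U X"
  shows "smooth_vf A U (\<lambda>p. f p *\<^sub>R X p)"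
  unfolding smooth_vf_def
proof
  fix c assume c: "c \<in> A"
  note ic = smooth_atlasD(1)[OF assms(1) c]
  show "smooth_on (snd c ` (U \<inter> fst c)) (vf_rep A c (\<lambda>p. f p *\<^sub>R X p))"
  proof (rule smooth_on_cong[OF open_chart_image[OF ic assms(2)]])
    show "smooth_on (snd c ` (U \<inter> fst c)) (\<lambda>x. (f \<circ> chart_inv c) x *\<^sub>R vf_rep A c X x)"
      using assms c by (intro smooth_on_scaleR open_chart_image ic) (auto simp: smooth_vf_def smooth_fun_def o_def)
    fix x assume "x \<in> snd c ` (U \<inter> fst c)"
    then show "(f \<circ> chart_inv c) x *\<^sub>R vf_rep A c X x = vf_rep A c (\<lambda>p. f p *\<^sub>R X p) x"
      using linear_frame_change[OF assms(1) c] ic by (auto simp: vf_rep_eq linear_cmul chart_inv_left)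
  qed
qed

lemma smooth_vf_zero:
  assumes "smooth_atlas A" "open U"
  shows "smooth_vf A U (\<lambda>p. 0)"
  unfolding smooth_vf_def
proof
  fix c assume c: "c \<in> A"
  note ic = smooth_atlasD(1)[OF assms(1) c]
  show "smooth_on (snd c ` (U \<inter> fst c)) (vf_rep A c (\<lambda>p. 0))"
    using linear_0[OF linear_frame_change[OF assms(1) c]] ic
    by (intro smooth_on_cong[OF open_chart_image[OF ic assms(2)] _ smooth_on_const[of _ 0]])
      (auto simp: vf_rep_eq)
qed

lemma smooth_vf_cmult:
  "smooth_atlas A \<Longrightarrow> open U \<Longrightarrow> smooth_vf A U X \<Longrightarrow> smooth_vf A U (\<lambda>p. r *\<^sub>R X p)"
  by (rule smooth_vf_scaleR[OF _ _ smooth_fun_const])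

lemma smooth_vf_uminus:
  "smooth_atlas A \<Longrightarrow> open U \<Longrightarrow> smooth_vf A U X \<Longrightarrow> smooth_vf A U (\<lambda>p. - X p)"
  using smooth_vf_cmult[of A U X "-1"] by simp

lemma smooth_vf_diff:
  "smooth_atlas A \<Longrightarrow> open U \<Longrightarrow> smooth_vf A U X \<Longrightarrow> smooth_vf A U Y \<Longrightarrow>
    smooth_vf A U (\<lambda>p. X p - Y p)"
  using smooth_vf_add[of A U X "\<lambda>p. - Y p"] smooth_vf_uminus[of A U Y] by simp

lemma smooth_vf_sum:
  assumes "smooth_atlas A" "open U" "finite B" "\<And>i. i \<in> B \<Longrightarrow> smooth_vf A U (X i)"
  shows "smooth_vf A U (\<lambda>p. \<Sum>i\<in>B. X i p)"
  using assms(3,4)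
  by (induction B rule: finite_induct)
    (auto intro!: smooth_vf_zero smooth_vf_add[OF assms(1,2)] assms(1,2))

text \<open>The field with constant components \<open>e\<close> in the chart \<open>c\<close>. It
  has to be rewritten at every point because tangent vectors are stored in the preferred chart,
  which may jump from point to point.\<close>

definition const_vf ::
  "('m, 'e::euclidean_space) chart set \<Rightarrow> ('m, 'e) chart \<Rightarrow> 'e \<Rightarrow> 'm \<Rightarrow> 'e" where
  "const_vf A c e p = chart_change c (chart_at A p) p e"

text \<open>Seen in another chart \<open>d\<close>, the field is the derivative of the transition
  map in the fixed direction \<open>e\<close>, composed with the inverse transition; the preferred
  charts drop out by the cocycle rule.\<close>

lemma smooth_vf_const_vf:
  assumes A: "smooth_atlas A" and c: "c \<in> A"
  shows "smooth_vf A (fst c) (const_vf A c e)"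
  unfolding smooth_vf_def
proof
  fix d assume d: "d \<in> A"
  have ch: "is_chart c" "is_chart d" using A c d smooth_atlasD(1) by blast+
  let ?S = "snd d ` (fst c \<inter> fst d)" and ?T = "snd c ` (fst c \<inter> fst d)"
  have op: "open ?S" "open ?T"
    using transition_smooth(2)[OF A c d] transition_smooth(2)[OF A d c] by (auto simp: Int_commute)
  show "smooth_on ?S (vf_rep A d (const_vf A c e))"
  proof (rule smooth_on_cong[OF op(1)])
    show "smooth_on ?S (\<lambda>x. frechet_derivative (snd d \<circ> chart_inv c) (at ((snd c \<circ> chart_inv d) x)) e)"
    proof (rule smooth_on_compose[OF op, where f="snd c \<circ> chart_inv d"
          and g="\<lambda>y. frechet_derivative (snd d \<circ> chart_inv c) (at y) e"])
      show "(snd c \<circ> chart_inv d) ` ?S \<subseteq> ?T" using ch by (auto simp: chart_inv_left)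
      show "smooth_on ?S (snd c \<circ> chart_inv d)"
        using transition_smooth(1)[OF A d c] by (simp add: Int_commute)
      show "smooth_on ?T (\<lambda>x. frechet_derivative (snd d \<circ> chart_inv c) (at x) e)"
        using transition_smooth(1)[OF A c d] by (rule smooth_on_frechet_derivative)
    qed
    fix x assume "x \<in> ?S"
    then obtain p where p: "x = snd d p" "p \<in> fst c" "p \<in> fst d" by auto
    then have "vf_rep A d (const_vf A c e) x = chart_change c d p e"
      using chart_at[OF A, of p] A c d ch
      by (simp add: vf_rep_eq const_vf_def chart_change_chart_change)
    then show "frechet_derivative (snd d \<circ> chart_inv c) (at ((snd c \<circ> chart_inv d) x)) e =
        vf_rep A d (const_vf A c e) x"
      using p ch by (simp add: chart_change_def chart_inv_left)
  qed
qed

lemma smooth_formD: "smooth_form A U \<alpha> \<Longrightarrow> p \<in> U \<Longrightarrow> linear (\<alpha> p)"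
  by (simp add: smooth_form_def)

lemma linear_form_rep:
  assumes "smooth_atlas A" "c \<in> A" "p \<in> fst c" "linear (\<alpha> p)"
  shows "linear (form_rep A c \<alpha> (snd c p))"
proof -
  have "form_rep A c \<alpha> (snd c p) = \<alpha> p \<circ> chart_change c (chart_at A p) p"
    using assms(3) smooth_atlasD(1)[OF assms(1,2)] by (auto simp: form_rep_eq)
  then show ?thesis
    using assms chart_at[OF assms(1), of p] linear_compose linear_chart_change by metis
qed

lemma smooth_fun_form_vf:
  assumes A: "smooth_atlas A" and U: "open U" and a: "smooth_form A U \<alpha>" and X: "smooth_vf A U X"
  shows "smooth_fun A U (\<lambda>p. \<alpha> p (X p))"
  unfolding smooth_fun_def
proof
  fix c assume c: "c \<in> A"
  note ic = smooth_atlasD(1)[OF A c]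
  show "smooth_on (snd c ` (U \<inter> fst c)) ((\<lambda>p. \<alpha> p (X p)) \<circ> chart_inv c)"
  proof (rule smooth_on_cong[OF open_chart_image[OF ic U]])
    show "smooth_on (snd c ` (U \<inter> fst c))
      (\<lambda>x. \<Sum>b\<in>Basis. (vf_rep A c X x \<bullet> b) *\<^sub>R form_rep A c \<alpha> x b)"
      using a X c
      by (intro smooth_on_sum smooth_on_scaleR open_chart_image ic U
          smooth_on_bounded_linear[OF bounded_linear_inner_left])
        (auto simp: smooth_form_def smooth_vf_def)
    fix x assume "x \<in> snd c ` (U \<inter> fst c)"
    then obtain p where p: "x = snd c p" "p \<in> U" "p \<in> fst c" by auto
    show "(\<Sum>b\<in>Basis. (vf_rep A c X x \<bullet> b) *\<^sub>R form_rep A c \<alpha> x b) = ((\<lambda>p. \<alpha> p (X p)) \<circ> chart_inv c) x"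
      unfolding p(1)
      using linear_sum_Basis[OF linear_form_rep[of A c p \<alpha>], of "vf_rep A c X (snd c p)"]
        smooth_formD[OF a p(2)] A c p form_rep_vf_rep[OF A c p(3), of \<alpha> X]
      by (simp add: chart_inv_left[OF ic])
  qed
qed

section \<open>Exterior derivatives\<close>

context
  fixes A :: "('m::topological_space, 'e::euclidean_space) chart set" and U \<alpha>
  assumes A: "smooth_atlas A" and U: "open U" and \<alpha>: "smooth_form A U \<alpha>"
begin

lemma form_rep_has_derivative:
  assumes c: "c \<in> A" and x: "x \<in> snd c ` (U \<inter> fst c)"
  shows "((\<lambda>y. form_rep A c \<alpha> y b) has_derivative frechet_derivative (\<lambda>y. form_rep A c \<alpha> y b) (at x)) (at x)"
  using \<alpha> c x smooth_on_has_derivative unfolding smooth_form_def by blast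

lemma form_rep_sum_Basis:
  assumes c: "c \<in> A" and x: "x \<in> snd c ` (U \<inter> fst c)"
  shows "form_rep A c \<alpha> x w = (\<Sum>b\<in>Basis. (w \<bullet> b) * form_rep A c \<alpha> x b)"
proof -
  obtain p where p: "p \<in> U" "p \<in> fst c" "x = snd c p" using x by blast
  show ?thesis
    using linear_sum_Basis[OF linear_form_rep[of A c p \<alpha>, OF A c p(2) smooth_formD[OF \<alpha> p(1)]], of w] p(3)
    by simp
qed

text \<open>One product rule with three uses: a constant \<open>Y\<close>; a transition map as
  \<open>\<phi>\<close> with its derivative as \<open>Y\<close>; a vector field annihilated by the
  form. The sum over \<open>Basis\<close> separates the coefficients of the form from its argument,
  and agrees with \<open>form_rep\<close> only over \<open>U\<close>, where \<open>\<alpha>\<close>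
  is linear.\<close>

lemma form_rep_apply_has_derivative:
  assumes c: "c \<in> A" and x: "\<phi> x \<in> snd c ` (U \<inter> fst c)"
    and \<phi>: "(\<phi> has_derivative \<phi>') (at x)" and Y: "(Y has_derivative Y') (at x)"
  shows "((\<lambda>y. \<Sum>b\<in>Basis. (Y y \<bullet> b) * form_rep A c \<alpha> (\<phi> y) b) has_derivative
    (\<lambda>v. form_rep A c \<alpha> (\<phi> x) (Y' v) +
       (\<Sum>b\<in>Basis. (Y x \<bullet> b) * frechet_derivative (\<lambda>y. form_rep A c \<alpha> y b) (at (\<phi> x)) (\<phi>' v)))) (at x)"
proof -
  have "((\<lambda>y. \<Sum>b\<in>Basis. (Y y \<bullet> b) * form_rep A c \<alpha> (\<phi> y) b) has_derivative
    (\<lambda>v. \<Sum>b\<in>Basis. (Y x \<bullet> b) * frechet_derivative (\<lambda>y. form_rep A c \<alpha> y b) (at (\<phi> x)) (\<phi>' v)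
       + (Y' v \<bullet> b) * form_rep A c \<alpha> (\<phi> x) b)) (at x)"
    using diff_chain_at[OF \<phi> form_rep_has_derivative[OF c x]]
    by (intro has_derivative_sum has_derivative_mult has_derivative_inner_left Y) (simp add: o_def)
  then show ?thesis
    unfolding sum.distrib form_rep_sum_Basis[OF c x, of "Y' _"] by (simp add: add.commute)
qed

lemma frechet_derivative_form_rep:
  assumes c: "c \<in> A" and x: "x \<in> snd c ` (U \<inter> fst c)"
  shows "frechet_derivative (\<lambda>y. form_rep A c \<alpha> y w) (at x) v =
    (\<Sum>b\<in>Basis. (w \<bullet> b) * frechet_derivative (\<lambda>y. form_rep A c \<alpha> y b) (at x) v)"
proof -
  have "form_rep A c \<alpha> x 0 = 0" using form_rep_sum_Basis[OF c x, of 0] by simp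
  then have "((\<lambda>y. \<Sum>b\<in>Basis. (w \<bullet> b) * form_rep A c \<alpha> y b) has_derivative
    (\<lambda>v. \<Sum>b\<in>Basis. (w \<bullet> b) * frechet_derivative (\<lambda>y. form_rep A c \<alpha> y b) (at x) v)) (at x)"
    using form_rep_apply_has_derivative[OF c, of "\<lambda>y. y" x "\<lambda>v. v" "\<lambda>y. w" "\<lambda>v. 0"] x by simp
  then have "((\<lambda>y. form_rep A c \<alpha> y w) has_derivative
    (\<lambda>v. \<Sum>b\<in>Basis. (w \<bullet> b) * frechet_derivative (\<lambda>y. form_rep A c \<alpha> y b) (at x) v)) (at x)"
    by (rule has_derivative_transform_on[OF _ open_chart_image[OF smooth_atlasD(1)[OF A c] U] x])
      (rule form_rep_sum_Basis[OF c, symmetric])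
  then show ?thesis by (simp add: frechet_derivative_eq)
qed

text \<open>Chart independence: the second derivatives of the transition map cancel by symmetry.\<close>
lemma ext_deriv_chart:
  assumes c: "c \<in> A" and p: "p \<in> U" "p \<in> fst c"
  shows "ext_deriv A \<alpha> p v w =
    frechet_derivative (\<lambda>y. form_rep A c \<alpha> y (chart_change (chart_at A p) c p w)) (at (snd c p))
      (chart_change (chart_at A p) c p v)
    - frechet_derivative (\<lambda>y. form_rep A c \<alpha> y (chart_change (chart_at A p) c p v)) (at (snd c p))
      (chart_change (chart_at A p) c p w)"
proof -
  define c0 where "c0 = chart_at A p"
  have c0: "c0 \<in> A" "p \<in> fst c0" using chart_at[OF A] by (auto simp: c0_def)
  have ch: "is_chart c" "is_chart c0" using A c c0 smooth_atlasD(1) by blast+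
  define \<phi> where "\<phi> = snd c \<circ> chart_inv c0"
  define S where "S = snd c0 ` (fst c0 \<inter> fst c)"
  \<comment> \<open>Smaller than \<open>S\<close>: outside \<open>U\<close> the values of
    \<open>\<alpha>\<close> are arbitrary.\<close>
  define S' where "S' = snd c0 ` ((U \<inter> fst c) \<inter> fst c0)"
  have S: "open S" "smooth_on S \<phi>" "snd c0 p \<in> S"
    using transition_smooth[OF A c0(1) c] c0 p unfolding S_def \<phi>_def by auto
  have S': "open S'" "S' \<subseteq> S" "snd c0 p \<in> S'"
    using open_chart_image[OF ch(2), of "U \<inter> fst c"] U ch(1) c0 p
    unfolding S'_def S_def is_chart_def by (auto simp: open_Int)
  have \<phi>p: "\<phi> (snd c0 p) = snd c p" using ch c0 by (simp add: \<phi>_def chart_inv_left)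
  then have \<phi>pU: "\<phi> (snd c0 p) \<in> snd c ` (U \<inter> fst c)" using p by auto
  let ?D = "\<lambda>u. frechet_derivative \<phi> (at (snd c0 p)) u"
  have main: "frechet_derivative (\<lambda>y. form_rep A c0 \<alpha> y w) (at (snd c0 p)) v =
      form_rep A c \<alpha> (snd c p) (frechet_derivative (\<lambda>y. frechet_derivative \<phi> (at y) w) (at (snd c0 p)) v)
      + frechet_derivative (\<lambda>y. form_rep A c \<alpha> y (?D w)) (at (snd c p)) (?D v)" for v w
  proof -
    have "((\<lambda>y. \<Sum>b\<in>Basis. (frechet_derivative \<phi> (at y) w \<bullet> b) * form_rep A c \<alpha> (\<phi> y) b) has_derivative
      (\<lambda>v. form_rep A c \<alpha> (\<phi> (snd c0 p)) (frechet_derivative (\<lambda>y. frechet_derivative \<phi> (at y) w) (at (snd c0 p)) v) +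
       (\<Sum>b\<in>Basis. (?D w \<bullet> b) * frechet_derivative (\<lambda>y. form_rep A c \<alpha> y b) (at (\<phi> (snd c0 p))) (?D v)))) (at (snd c0 p))"
      using form_rep_apply_has_derivative[where Y="\<lambda>y. frechet_derivative \<phi> (at y) w",
          OF c \<phi>pU smooth_on_has_derivative[OF S(2,3)]
            smooth_on_has_derivative[OF smooth_on_frechet_derivative[OF S(2)] S(3)]] .
    then have "((\<lambda>y. form_rep A c0 \<alpha> y w) has_derivative
      (\<lambda>v. form_rep A c \<alpha> (\<phi> (snd c0 p)) (frechet_derivative (\<lambda>y. frechet_derivative \<phi> (at y) w) (at (snd c0 p)) v) +
       (\<Sum>b\<in>Basis. (?D w \<bullet> b) * frechet_derivative (\<lambda>y. form_rep A c \<alpha> y b) (at (\<phi> (snd c0 p))) (?D v)))) (at (snd c0 p))"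
    proof (rule has_derivative_transform_on[OF _ S'(1,3)])
      fix y assume "y \<in> S'"
      then obtain q where q: "y = snd c0 q" "q \<in> U" "q \<in> fst c" "q \<in> fst c0" by (auto simp: S'_def)
      have \<phi>q: "\<phi> y = snd c q" using q ch by (simp add: \<phi>_def chart_inv_left)
      have "form_rep A c0 \<alpha> y w = form_rep A c \<alpha> (\<phi> y) (frechet_derivative \<phi> (at y) w)"
        using form_rep_chart_change[OF A c0(1) q(4) c q(3), of \<alpha> w] \<phi>q
        by (simp add: q(1) chart_change_def \<phi>_def)
      moreover have "\<phi> y \<in> snd c ` (U \<inter> fst c)" using \<phi>q q by auto
      ultimately show "(\<Sum>b\<in>Basis. (frechet_derivative \<phi> (at y) w \<bullet> b) * form_rep A c \<alpha> (\<phi> y) b)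
          = form_rep A c0 \<alpha> y w"
        by (simp add: form_rep_sum_Basis[OF c, of "\<phi> y" "frechet_derivative \<phi> (at y) w"])
    qed
    from frechet_derivative_eq[OF this] show ?thesis
      unfolding frechet_derivative_form_rep[OF c \<phi>pU, of "?D w" "?D v", unfolded \<phi>p] by (simp add: \<phi>p)
  qed
  have cc: "chart_change (chart_at A p) c p = frechet_derivative \<phi> (at (snd c0 p))"
    by (simp add: chart_change_def \<phi>_def c0_def)
  show ?thesis
    unfolding cc unfolding ext_deriv_def Let_def c0_def[symmetric] main
    using frechet_derivative_second_symmetric[OF S, of v w] by simp
qed

lemma ext_deriv_Basis:
  assumes c: "c \<in> A" and p: "p \<in> U" "p \<in> fst c"
    and v': "v' = chart_change (chart_at A p) c p v" and w': "w' = chart_change (chart_at A p) c p w"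
  shows "ext_deriv A \<alpha> p v w =
    (\<Sum>b\<in>Basis. (w' \<bullet> b) * frechet_derivative (\<lambda>y. form_rep A c \<alpha> y b) (at (snd c p)) v')
    - (\<Sum>b\<in>Basis. (v' \<bullet> b) * frechet_derivative (\<lambda>y. form_rep A c \<alpha> y b) (at (snd c p)) w')"
proof -
  have "snd c p \<in> snd c ` (U \<inter> fst c)" using p by blast
  note d = frechet_derivative_form_rep[OF c this]
  show ?thesis
    unfolding ext_deriv_chart[OF c p] v'[symmetric] w'[symmetric] d[of w' v'] d[of v' w'] ..
qed

lemma linear_ext_deriv:
  assumes "p \<in> U"
  shows "linear (ext_deriv A \<alpha> p v)"
proof -
  note c = chart_at[OF A, of p]
  have p: "snd (chart_at A p) p \<in> snd (chart_at A p) ` (U \<inter> fst (chart_at A p))"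
    using assms c by blast
  have l: "linear (frechet_derivative (\<lambda>y. form_rep A (chart_at A p) \<alpha> y b) (at (snd (chart_at A p) p)))" for b
    using has_derivative_linear[OF form_rep_has_derivative[OF c(1) p]] .
  have *: "ext_deriv A \<alpha> p v w =
    (\<Sum>b\<in>Basis. (w \<bullet> b) * frechet_derivative (\<lambda>y. form_rep A (chart_at A p) \<alpha> y b) (at (snd (chart_at A p) p)) v)
    - (\<Sum>b\<in>Basis. (v \<bullet> b) * frechet_derivative (\<lambda>y. form_rep A (chart_at A p) \<alpha> y b) (at (snd (chart_at A p) p)) w)"
    for w
    by (rule ext_deriv_Basis[OF c(1) assms c(2)])
      (simp_all add: chart_change_self smooth_atlasD(1)[OF A c(1)] c(2))
  show ?thesis
    unfolding * using l
    by (intro linearI)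
      (simp_all add: linear_add linear_cmul algebra_simps sum.distrib sum_distrib_left)
qed

lemma ext_deriv_swap: "ext_deriv A \<alpha> p v w = - ext_deriv A \<alpha> p w v"
  by (simp add: ext_deriv_def Let_def)

text \<open>The definition of \<open>ext_deriv\<close> changes its chart with the point. Chart
  independence allows a single fixed chart, where the value is a polynomial in smooth component
  functions.\<close>

lemma smooth_fun_ext_deriv:
  assumes X: "smooth_vf A U X" and Y: "smooth_vf A U Y"
  shows "smooth_fun A U (\<lambda>p. ext_deriv A \<alpha> p (X p) (Y p))"
  unfolding smooth_fun_def
proof
  fix c assume c: "c \<in> A"
  note ic = smooth_atlasD(1)[OF A c]
  let ?S = "snd c ` (U \<inter> fst c)"
  let ?D = "\<lambda>X Y x. \<Sum>b\<in>Basis. (vf_rep A c Y x \<bullet> b) *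
    (\<Sum>b'\<in>Basis. (vf_rep A c X x \<bullet> b') * frechet_derivative (\<lambda>y. form_rep A c \<alpha> y b) (at x) b')"
  have sm: "smooth_on ?S (?D X Y)" if "smooth_vf A U X" "smooth_vf A U Y" for X Y
    using that \<alpha> c unfolding smooth_vf_def smooth_form_def
    by (intro smooth_on_sum smooth_on_mult open_chart_image ic U smooth_on_frechet_derivative
        smooth_on_bounded_linear[OF bounded_linear_inner_left]) auto
  show "smooth_on ?S ((\<lambda>p. ext_deriv A \<alpha> p (X p) (Y p)) \<circ> chart_inv c)"
  proof (rule smooth_on_cong[OF open_chart_image[OF ic U]])
    show "smooth_on ?S (\<lambda>x. ?D X Y x + (-1) * ?D Y X x)"
      by (intro smooth_on_add smooth_on_mult smooth_on_const sm X Y open_chart_image ic U)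
    fix x assume x: "x \<in> ?S"
    then obtain p where p: "x = snd c p" "p \<in> U" "p \<in> fst c" by auto
    have *: "frechet_derivative (\<lambda>y. form_rep A c \<alpha> y b) (at x) v =
        (\<Sum>b'\<in>Basis. (v \<bullet> b') * frechet_derivative (\<lambda>y. form_rep A c \<alpha> y b) (at x) b')" for b v
      unfolding real_scaleR_def[symmetric]
      by (rule linear_sum_Basis[OF has_derivative_linear[OF form_rep_has_derivative[OF c x]]])
    have D: "?D X Y x = (\<Sum>b\<in>Basis. (vf_rep A c Y x \<bullet> b) *
        frechet_derivative (\<lambda>y. form_rep A c \<alpha> y b) (at x) (vf_rep A c X x))" for X Y
      by (simp only: *[symmetric])
    show "?D X Y x + (-1) * ?D Y X x = ((\<lambda>p. ext_deriv A \<alpha> p (X p) (Y p)) \<circ> chart_inv c) x"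
      unfolding D using ext_deriv_Basis[OF c p(2,3) vf_rep_eq[OF ic p(3), of A X] vf_rep_eq[OF ic p(3), of A Y]]
      by (simp add: p chart_inv_left[OF ic])
  qed
qed

text \<open>Cartan's formula without its two derivative terms. Differentiating
  \<open>\<alpha>(Y) = 0\<close> moves the derivative from \<open>Y\<close> to the coefficients of
  \<open>\<alpha>\<close>; the difference for the two orders is the bracket on one side and
  \<open>d\<alpha>\<close> on the other.\<close>

lemma form_lie_bracket:
  assumes X: "smooth_vf A U X" and Y: "smooth_vf A U Y"
    and 0: "\<And>q. q \<in> U \<Longrightarrow> \<alpha> q (X q) = 0" "\<And>q. q \<in> U \<Longrightarrow> \<alpha> q (Y q) = 0" and p: "p \<in> U"
  shows "\<alpha> p (lie_bracket A X Y p) = - ext_deriv A \<alpha> p (X p) (Y p)"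
proof -
  define c where "c = chart_at A p"
  have c: "c \<in> A" "p \<in> fst c" using chart_at[OF A] by (auto simp: c_def)
  note ic = smooth_atlasD(1)[OF A c(1)]
  let ?S = "snd c ` (U \<inter> fst c)" and ?x = "snd c p"
  have x: "?x \<in> ?S" and xx: "(\<lambda>y. y) ?x \<in> ?S" using p c by auto
  have lin: "linear (form_rep A c \<alpha> ?x)" using linear_form_rep[of A c p \<alpha>, OF A c] smooth_formD[OF \<alpha> p] by blast
  have at_p: "form_rep A c \<alpha> ?x v = \<alpha> p v" "vf_rep A c X ?x = X p" for v X
    using form_rep_chart_at[OF A] by (auto simp: c_def)
  have *: "form_rep A c \<alpha> ?x (frechet_derivative (vf_rep A c Y) (at ?x) v) =
     - (\<Sum>b\<in>Basis. (Y p \<bullet> b) * frechet_derivative (\<lambda>y. form_rep A c \<alpha> y b) (at ?x) v)"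
    if Y: "smooth_vf A U Y" and 0: "\<And>q. q \<in> U \<Longrightarrow> \<alpha> q (Y q) = 0" for Y v
  proof -
    have dY: "(vf_rep A c Y has_derivative frechet_derivative (vf_rep A c Y) (at ?x)) (at ?x)"
      using Y c x smooth_on_has_derivative unfolding smooth_vf_def by blast
    have "((\<lambda>y. 0) has_derivative
      (\<lambda>v. form_rep A c \<alpha> ?x (frechet_derivative (vf_rep A c Y) (at ?x) v) +
       (\<Sum>b\<in>Basis. (vf_rep A c Y ?x \<bullet> b) * frechet_derivative (\<lambda>y. form_rep A c \<alpha> y b) (at ?x) v))) (at ?x)"
    proof (rule has_derivative_transform_on[OF form_rep_apply_has_derivative[OF c(1) xx has_derivative_ident dY]
          open_chart_image[OF ic U] x])
      fix y assume y: "y \<in> ?S"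
      then obtain q where q: "y = snd c q" "q \<in> U" "q \<in> fst c" by auto
      then show "(\<Sum>b\<in>Basis. (vf_rep A c Y y \<bullet> b) * form_rep A c \<alpha> y b) = 0"
        using form_rep_vf_rep[OF A c(1) q(3), of \<alpha> Y] 0[of q] form_rep_sum_Basis[OF c(1) y, of "vf_rep A c Y y"]
        by simp
    qed
    from has_derivative_unique[OF this has_derivative_const] show ?thesis
      unfolding at_p by (auto dest!: fun_cong[of _ _ v])
  qed
  have "\<alpha> p (lie_bracket A X Y p) =
     form_rep A c \<alpha> ?x (frechet_derivative (vf_rep A c Y) (at ?x) (X p))
     - form_rep A c \<alpha> ?x (frechet_derivative (vf_rep A c X) (at ?x) (Y p))"
    using at_p(2) unfolding at_p(1)[symmetric] lie_bracket_def Let_def c_def[symmetric]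
    by (simp add: linear_diff[OF lin])
  also have "\<dots> = - ext_deriv A \<alpha> p (X p) (Y p)"
    using *[OF X 0(1), of "Y p"] *[OF Y 0(2), of "X p"] ext_deriv_Basis[OF c(1) p c(2) refl refl]
    by (simp add: c_def[symmetric] chart_change_self[OF ic c(2)])
  finally show ?thesis .
qed

end

definition dir_deriv ::
  "('m, 'e::euclidean_space) chart set \<Rightarrow> ('m \<Rightarrow> real) \<Rightarrow> 'm \<Rightarrow> 'e \<Rightarrow> real" where
  "dir_deriv A f p v = frechet_derivative (f \<circ> chart_inv (chart_at A p)) (at (snd (chart_at A p) p)) v"

lemma smooth_fun_has_derivative:
  assumes "smooth_atlas A" "smooth_fun A U f" "p \<in> U"
  shows "((f \<circ> chart_inv (chart_at A p)) has_derivative dir_deriv A f p) (at (snd (chart_at A p) p))"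
  using smooth_fun_imp_differentiable[OF assms(1) chart_at[OF assms(1)] assms(3,2)]
  by (simp add: dir_deriv_def[abs_def] frechet_derivative_works[symmetric])

text \<open>The Leibniz rule d(B \<eta>) = B d\<eta> + dB wedge \<eta>, summed over
  \<open>i\<close>. It is later applied to the forms of one local frame written in terms of those of
  another.\<close>

lemma ext_deriv_mult_sum:
  fixes \<eta> :: "'i::finite \<Rightarrow> 'm::topological_space \<Rightarrow> 'e::euclidean_space \<Rightarrow> real"
  assumes A: "smooth_atlas A" and U: "open U" and \<eta>: "\<And>i. smooth_form A U (\<eta> i)"
    and B: "\<And>i. smooth_fun A U (B i)" and eq: "\<And>q v. q \<in> U \<Longrightarrow> \<alpha> q v = (\<Sum>i\<in>UNIV. B i q * \<eta> i q v)"
    and p: "p \<in> U"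
  shows "ext_deriv A \<alpha> p v w =
    (\<Sum>i\<in>UNIV. B i p * ext_deriv A (\<eta> i) p v w + dir_deriv A (B i) p v * \<eta> i p w
       - dir_deriv A (B i) p w * \<eta> i p v)"
proof -
  define c where "c = chart_at A p"
  have c: "c \<in> A" "p \<in> fst c" using chart_at[OF A] by (auto simp: c_def)
  note ic = smooth_atlasD(1)[OF A c(1)]
  have x: "snd c p \<in> snd c ` (U \<inter> fst c)" using p c by auto
  have "frechet_derivative (\<lambda>y. form_rep A c \<alpha> y w) (at (snd c p)) v =
    (\<Sum>i\<in>UNIV. B i p * frechet_derivative (\<lambda>y. form_rep A c (\<eta> i) y w) (at (snd c p)) v
       + dir_deriv A (B i) p v * \<eta> i p w)" for v w
  proof -
    have "((\<lambda>y. \<Sum>i\<in>UNIV. (B i \<circ> chart_inv c) y * form_rep A c (\<eta> i) y w) has_derivative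
      (\<lambda>v. \<Sum>i\<in>UNIV. (B i \<circ> chart_inv c) (snd c p) *
           frechet_derivative (\<lambda>y. form_rep A c (\<eta> i) y w) (at (snd c p)) v
         + dir_deriv A (B i) p v * form_rep A c (\<eta> i) (snd c p) w)) (at (snd c p))"
      using smooth_fun_has_derivative[OF A B p]
      by (intro has_derivative_sum has_derivative_mult form_rep_has_derivative[OF A U \<eta> c(1) x])
        (simp add: c_def o_def)
    moreover have "(\<Sum>i\<in>UNIV. (B i \<circ> chart_inv c) y * form_rep A c (\<eta> i) y w) = form_rep A c \<alpha> y w"
      if "y \<in> snd c ` (U \<inter> fst c)" for y
      using chart_inv_mem[OF ic that] by (simp add: form_rep_def Let_def eq)
    ultimately have "((\<lambda>y. form_rep A c \<alpha> y w) has_derivative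
      (\<lambda>v. \<Sum>i\<in>UNIV. (B i \<circ> chart_inv c) (snd c p) *
           frechet_derivative (\<lambda>y. form_rep A c (\<eta> i) y w) (at (snd c p)) v
         + dir_deriv A (B i) p v * form_rep A c (\<eta> i) (snd c p) w)) (at (snd c p))"
      by (rule has_derivative_transform_on[OF _ open_chart_image[OF ic U] x])
    from frechet_derivative_eq[OF this] show ?thesis
      using form_rep_chart_at(1)[OF A, of p, folded c_def] by (simp add: chart_inv_left[OF ic c(2)])
  qed
  then show ?thesis
    unfolding ext_deriv_def Let_def c_def[symmetric]
    by (simp add: sum_subtractf[symmetric] sum.distrib[symmetric] algebra_simps)
qed

section \<open>Linear algebra of quaternionic frames\<close>

lemma three_arith [simp]:
  "(1::3) + 1 = 2" "(1::3) + 2 = 3" "(2::3) + 1 = 3" "(2::3) + 2 = 1" "(3::3) + 1 = 1" "(3::3) + 2 = 2"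
  "(4::3) = 1" "(5::3) = 2" "(6::3) = 3"
  "(1::3) \<noteq> 2" "(1::3) \<noteq> 3" "(2::3) \<noteq> 1" "(2::3) \<noteq> 3" "(3::3) \<noteq> 1" "(3::3) \<noteq> 2"
  by simp_all

lemma linear_onD:
  assumes "linear_on V f" "x \<in> V" "y \<in> V"
  shows "f (x + y) = f x + f y" "f (r *\<^sub>R x) = r *\<^sub>R f x"
  using assms by (auto simp: linear_on_def)

locale quaternionic_space =
  fixes Q :: "'e::real_vector set" and I :: "3 \<Rightarrow> 'e \<Rightarrow> 'e"
  assumes subspace_Q: "subspace Q"
    and complex: "linear_complex_structure Q (I a)"
    and I_1_2: "x \<in> Q \<Longrightarrow> I 1 (I 2 x) = I 3 x"
    and I_2_1': "x \<in> Q \<Longrightarrow> - I 2 (I 1 x) = I 3 x"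
begin

lemma Q_0 [simp]: "0 \<in> Q" and Q_add [simp]: "x \<in> Q \<Longrightarrow> y \<in> Q \<Longrightarrow> x + y \<in> Q"
  and Q_scale [simp]: "x \<in> Q \<Longrightarrow> r *\<^sub>R x \<in> Q" and Q_minus [simp]: "x \<in> Q \<Longrightarrow> - x \<in> Q"
  and Q_diff [simp]: "x \<in> Q \<Longrightarrow> y \<in> Q \<Longrightarrow> x - y \<in> Q"
  and Q_sum: "(\<And>i. i \<in> B \<Longrightarrow> f i \<in> Q) \<Longrightarrow> sum f B \<in> Q"
  using subspace_Q
  by (auto intro: subspace_0 subspace_add subspace_mul subspace_neg subspace_diff subspace_sum)

lemma I_in [simp]: "x \<in> Q \<Longrightarrow> I a x \<in> Q" and I_I [simp]: "x \<in> Q \<Longrightarrow> I a (I a x) = - x"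
  and I_add: "x \<in> Q \<Longrightarrow> y \<in> Q \<Longrightarrow> I a (x + y) = I a x + I a y"
  and I_scale: "x \<in> Q \<Longrightarrow> I a (r *\<^sub>R x) = r *\<^sub>R I a x"
  using complex[of a] by (auto simp: linear_complex_structure_def linear_on_def)

lemma I_minus: "x \<in> Q \<Longrightarrow> I a (- x) = - I a x"
  using I_scale[of x a "-1"] by simp

lemma I_diff: "x \<in> Q \<Longrightarrow> y \<in> Q \<Longrightarrow> I a (x - y) = I a x - I a y"
  using I_add[of x "- y" a] I_minus[of y a] by simp

lemma I_0 [simp]: "I a 0 = 0"
  using I_scale[of 0 a 0] by simp

lemmas I_linear = I_add I_scale I_minus I_diff

lemma I_mult [simp]:
  assumes x: "x \<in> Q"
  shows "I 1 (I 2 x) = I 3 x" "I 2 (I 1 x) = - I 3 x" "I 2 (I 3 x) = I 1 x" "I 3 (I 2 x) = - I 1 x"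
    "I 3 (I 1 x) = I 2 x" "I 1 (I 3 x) = - I 2 x"
proof -
  show 12: "I 1 (I 2 x) = I 3 x" by (rule I_1_2[OF x])
  show 21: "I 2 (I 1 x) = - I 3 x" using I_2_1'[OF x] by (metis minus_minus)
  show "I 2 (I 3 x) = I 1 x" unfolding I_2_1'[OF x, symmetric] by (simp add: x I_minus)
  show "I 3 (I 2 x) = - I 1 x" using I_1_2[of "I 2 x"] by (simp add: x I_minus)
  show "I 3 (I 1 x) = I 2 x" using I_2_1'[of "I 1 x"] by (simp add: x I_minus)
  show "I 1 (I 3 x) = - I 2 x" unfolding I_1_2[OF x, symmetric] by (simp add: x)
qed

lemma I_cyclic:
  assumes "x \<in> Q"
  shows "I a (I (a + 1) x) = I (a + 2) x" "I (a + 1) (I a x) = - I (a + 2) x"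
  using exhaust_3[of a] assms by auto

text \<open>Applying the conjugate quaternion to the relation leaves its squared norm times
  \<open>x\<close>.\<close>

lemma I_independent:
  assumes x: "x \<in> Q" "x \<noteq> 0" and 0: "r *\<^sub>R x + (\<Sum>a\<in>UNIV. t a *\<^sub>R I a x) = 0"
  shows "r = 0" "t a = 0"
proof -
  let ?y = "r *\<^sub>R x + (\<Sum>a\<in>UNIV. t a *\<^sub>R I a x)"
  have "r *\<^sub>R ?y - (\<Sum>a\<in>UNIV. t a *\<^sub>R I a ?y) = (r\<^sup>2 + (t 1)\<^sup>2 + (t 2)\<^sup>2 + (t 3)\<^sup>2) *\<^sub>R x"
    using x by (simp add: sum_3 I_linear algebra_simps power2_eq_square)
  then have "r\<^sup>2 + (t 1)\<^sup>2 + (t 2)\<^sup>2 + (t 3)\<^sup>2 = 0"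
    unfolding 0 using x by simp
  then have "r = 0 \<and> t 1 = 0 \<and> t 2 = 0 \<and> t 3 = 0"
    by (smt (verit, best) zero_le_power2 power2_less_eq_zero_iff)
  then show "r = 0" "t a = 0" using exhaust_3[of a] by auto
qed

end

section \<open>Extending the complex structures across a transverse frame, at one point\<close>

locale quaternionic_frame = quaternionic_space Q I
  for Q :: "'e::real_vector set" and I +
  fixes \<eta> :: "3 \<Rightarrow> 'e \<Rightarrow> real" and T :: "3 \<Rightarrow> 'e"
  assumes linear_\<eta>: "linear (\<eta> a)"
    and Q_eq: "Q = {x. \<forall>a. \<eta> a x = 0}"
    and dual: "\<eta> a (T b) = (if a = b then 1 else 0)"
begin

lemmas \<eta>_linear = linear_add[OF linear_\<eta>] linear_diff[OF linear_\<eta>] linear_neg[OF linear_\<eta>]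
  linear_cmul[OF linear_\<eta>] linear_sum[OF linear_\<eta>] linear_0[OF linear_\<eta>]

lemma \<eta>_Q [simp]: "q \<in> Q \<Longrightarrow> \<eta> a q = 0"
  using Q_eq by blast

lemma in_Q_iff: "x \<in> Q \<longleftrightarrow> \<eta> 1 x = 0 \<and> \<eta> 2 x = 0 \<and> \<eta> 3 x = 0"
  by (subst Q_eq) (simp add: forall_3)

definition proj :: "'e \<Rightarrow> 'e" where
  "proj x = x - (\<Sum>b\<in>UNIV. \<eta> b x *\<^sub>R T b)"

text \<open>On \<open>Q\<close> this is \<open>I a\<close>; on the span of the \<open>T b\<close> it
  is the cross product with the \<open>a\<close>-th unit vector. It is linear on the whole tangent
  space and kills \<open>T a\<close>, so it is the extension required by an admissible triple; only
  its restriction to the kernel of \<open>\<eta> a\<close> squares to minus the identity.\<close>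

definition ext :: "3 \<Rightarrow> 'e \<Rightarrow> 'e" where
  "ext a x = I a (proj x) + \<eta> (a + 1) x *\<^sub>R T (a + 2) - \<eta> (a + 2) x *\<^sub>R T (a + 1)"

lemma proj_in [simp]: "proj x \<in> Q"
  by (simp del: \<eta>_Q add: in_Q_iff proj_def \<eta>_linear sum_3 dual)

lemma linear_proj: "linear proj"
  by (intro linearI) (simp_all add: proj_def \<eta>_linear sum_3 algebra_simps)

lemma proj_Q [simp]: "q \<in> Q \<Longrightarrow> proj q = q"
  by (simp add: proj_def)

lemma proj_T [simp]: "proj (T a) = 0"
  using exhaust_3[of a] by (auto simp: proj_def dual sum_3)

lemma decompose: "x = proj x + \<eta> 1 x *\<^sub>R T 1 + \<eta> 2 x *\<^sub>R T 2 + \<eta> 3 x *\<^sub>R T 3"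
  by (simp add: proj_def sum_3)

lemma decomposeE:
  obtains q r where "q \<in> Q" "x = q + r 1 *\<^sub>R T 1 + r 2 *\<^sub>R T 2 + r 3 *\<^sub>R T 3" "\<And>a. \<eta> a x = r a"
  using decompose[of x] proj_in[of x] by (intro that[of "proj x" "\<lambda>a. \<eta> a x"]) auto

lemma linear_ext: "linear (ext a)"
  by (intro linearI)
    (simp_all add: ext_def \<eta>_linear linear_add[OF linear_proj] linear_cmul[OF linear_proj]
      I_linear algebra_simps)

lemmas ext_linear = linear_add[OF linear_ext] linear_diff[OF linear_ext] linear_neg[OF linear_ext]
  linear_cmul[OF linear_ext] linear_sum[OF linear_ext] linear_0[OF linear_ext]

lemma ext_Q [simp]: "q \<in> Q \<Longrightarrow> ext a q = I a q"
  by (simp add: ext_def)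

lemma ext_T:
  "ext a (T a) = 0" "ext a (T (a + 1)) = T (a + 2)" "ext a (T (a + 2)) = - T (a + 1)"
  using exhaust_3[of a] by (auto simp: ext_def dual)

lemma ext_T' [simp]:
  "ext 1 (T 1) = 0" "ext 1 (T 2) = T 3" "ext 1 (T 3) = - T 2"
  "ext 2 (T 1) = - T 3" "ext 2 (T 2) = 0" "ext 2 (T 3) = T 1"
  "ext 3 (T 1) = T 2" "ext 3 (T 2) = - T 1" "ext 3 (T 3) = 0"
  by (simp_all add: ext_def dual)

lemma \<eta>_ext:
  "\<eta> a (ext a x) = 0" "\<eta> (a + 1) (ext a x) = - \<eta> (a + 2) x" "\<eta> (a + 2) (ext a x) = \<eta> (a + 1) x"
  using exhaust_3[of a] by (auto simp: ext_def dual \<eta>_linear)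

lemmas \<eta>_ext' [simp] = \<eta>_ext[of 1, simplified] \<eta>_ext[of 2, simplified] \<eta>_ext[of 3, simplified]

lemma ext_ext: "\<eta> a x = 0 \<Longrightarrow> ext a (ext a x) = - x"
proof -
  assume 0: "\<eta> a x = 0"
  obtain q r where x: "q \<in> Q" "x = q + r 1 *\<^sub>R T 1 + r 2 *\<^sub>R T 2 + r 3 *\<^sub>R T 3" "\<And>a. \<eta> a x = r a"
    using decomposeE[of x] by blast
  have "r a = 0" using 0 x(3) by simp
  then show "ext a (ext a x) = - x"
    unfolding x(2) using x(1) exhaust_3[of a] by (auto simp: ext_linear)
qed

lemma image_ext_1: "ext 1 ` ({x. \<eta> 1 x = 0} \<inter> {x. \<eta> 2 x = 0}) = {x. \<eta> 1 x = 0 \<and> \<eta> 3 x = 0}"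
proof (intro equalityI subsetI)
  fix x assume "x \<in> {x. \<eta> 1 x = 0 \<and> \<eta> 3 x = 0}"
  then show "x \<in> ext 1 ` ({x. \<eta> 1 x = 0} \<inter> {x. \<eta> 2 x = 0})"
    by (intro image_eqI[of _ _ "- ext 1 x"]) (auto simp: ext_linear ext_ext \<eta>_linear)
qed auto

lemma image_ext_2: "ext 2 ` ({x. \<eta> 1 x = 0} \<inter> {x. \<eta> 2 x = 0}) = {x. \<eta> 2 x = 0 \<and> \<eta> 3 x = 0}"
proof (intro equalityI subsetI)
  fix x assume "x \<in> {x. \<eta> 2 x = 0 \<and> \<eta> 3 x = 0}"
  then show "x \<in> ext 2 ` ({x. \<eta> 1 x = 0} \<inter> {x. \<eta> 2 x = 0})"
    by (intro image_eqI[of _ _ "- ext 2 x"]) (auto simp: ext_linear ext_ext \<eta>_linear)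
qed auto

text \<open>The two images are \<open>Q\<close> plus the line of \<open>T 2\<close> and
  \<open>Q\<close> plus the line of \<open>T 1\<close>; together they fill the kernel of
  \<open>\<eta> 3\<close>.\<close>

lemma third_space_ext: "third_space {x. \<eta> 1 x = 0} (ext 1) {x. \<eta> 2 x = 0} (ext 2) = {x. \<eta> 3 x = 0}"
proof (intro equalityI subsetI)
  fix z assume "z \<in> {x. \<eta> 3 x = 0}"
  then show "z \<in> third_space {x. \<eta> 1 x = 0} (ext 1) {x. \<eta> 2 x = 0} (ext 2)"
    unfolding third_space_def image_ext_1 image_ext_2 mem_Collect_eq
    by (intro exI[of _ "proj z + \<eta> 2 z *\<^sub>R T 2"] exI[of _ "\<eta> 1 z *\<^sub>R T 1"])
      (use decompose[of z] in \<open>auto simp: \<eta>_linear dual algebra_simps\<close>)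
qed (auto simp: third_space_def image_ext_1 image_ext_2 \<eta>_linear)

text \<open>A splitting of \<open>z\<close> is unique only up to \<open>Q\<close>. This does no
  harm, since on either image the prescribed product of \<open>ext 1\<close> and
  \<open>ext 2\<close> is already \<open>ext 3\<close>, and the definite description has exactly one
  solution.\<close>

lemma third_map_ext:
  assumes "\<eta> 3 z = 0"
  shows "third_map {x. \<eta> 1 x = 0} (ext 1) {x. \<eta> 2 x = 0} (ext 2) z = ext 3 z"
proof -
  have 1: "- ext 2 (ext 1 x) = ext 3 x" if "\<eta> 1 x = 0" "\<eta> 3 x = 0" for x
  proof -
    obtain q r where x: "q \<in> Q" "x = q + r 1 *\<^sub>R T 1 + r 2 *\<^sub>R T 2 + r 3 *\<^sub>R T 3" "\<And>a. \<eta> a x = r a"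
      using decomposeE[of x] by blast
    then show ?thesis using that unfolding x(3) unfolding x(2) by (simp add: ext_linear)
  qed
  have 2: "ext 1 (ext 2 x) = ext 3 x" if "\<eta> 2 x = 0" "\<eta> 3 x = 0" for x
  proof -
    obtain q r where x: "q \<in> Q" "x = q + r 1 *\<^sub>R T 1 + r 2 *\<^sub>R T 2 + r 3 *\<^sub>R T 3" "\<And>a. \<eta> a x = r a"
      using decomposeE[of x] by blast
    then show ?thesis using that unfolding x(3) unfolding x(2) by (simp add: ext_linear)
  qed
  have "z \<in> third_space {x. \<eta> 1 x = 0} (ext 1) {x. \<eta> 2 x = 0} (ext 2)"
    using assms third_space_ext by blast
  then show ?thesis
    unfolding third_map_def third_space_def image_ext_1 image_ext_2
    using 1 2 by (intro the_equality) (auto simp: ext_linear)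
qed

text \<open>Any other admissible triple at the point is a multiple of \<open>T\<close> shifted by \<open>Q\<close>-components
  \<open>X\<^sub>a\<close> for which \<open>I\<^sub>a X\<^sub>a\<close> does not depend on \<open>a\<close>.\<close>
lemma admissible_frame:
  assumes mem: "\<And>a. \<eta> (a + 1) (T' a) = 0" "\<And>a. \<eta> (a + 2) (T' a) = 0"
    and I: "\<And>a. ext a (T' (a + 1)) = T' (a + 2)" and span: "span (Q \<union> range T') = UNIV"
  obtains t where "t \<noteq> 0" "\<And>a b. \<eta> a (T' b) = (if a = b then t else 0)"
    "\<And>a. ext a (T' a) = ext 1 (T' 1)"
proof
  define t where "t = \<eta> 1 (T' 1)"
  have m: "\<eta> 2 (T' 1) = 0" "\<eta> 3 (T' 1) = 0" "\<eta> 3 (T' 2) = 0" "\<eta> 1 (T' 2) = 0"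
    "\<eta> 1 (T' 3) = 0" "\<eta> 2 (T' 3) = 0"
    using mem(1)[of 1] mem(2)[of 1] mem(1)[of 2] mem(2)[of 2] mem(1)[of 3] mem(2)[of 3] by auto
  have e: "ext 1 (T' 2) = T' 3" "ext 2 (T' 3) = T' 1" "ext 3 (T' 1) = T' 2"
    using I[of 1] I[of 2] I[of 3] by auto
  \<comment> \<open>\<open>ext 1\<close> carries the \<open>T 2\<close> coefficient to
    \<open>T 3\<close>, and \<open>ext 3\<close> carries the \<open>T 1\<close> coefficient to
    \<open>T 2\<close>, so the three diagonal coefficients agree.\<close>
  have t: "\<eta> 3 (T' 3) = t" "\<eta> 2 (T' 2) = t"
    using \<eta>_ext(3)[of 1 "T' 2"] \<eta>_ext(2)[of 3 "T' 1"] \<eta>_ext(3)[of 3 "T' 1"] by (auto simp: e t_def)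
  show *: "\<eta> a (T' b) = (if a = b then t else 0)" for a b
    using exhaust_3[of a] exhaust_3[of b] m t t_def by auto
  show "t \<noteq> 0"
  proof
    assume "t = 0"
    then have "Q \<union> range T' \<subseteq> Q" by (auto simp del: \<eta>_Q simp: in_Q_iff *)
    then have "span (Q \<union> range T') \<subseteq> Q" by (rule span_minimal[OF _ subspace_Q])
    then have "T 1 \<in> Q" using span by auto
    then show False by (simp del: \<eta>_Q add: in_Q_iff dual)
  qed
  have T': "T' a = proj (T' a) + t *\<^sub>R T a" for a
    using decompose[of "T' a"] exhaust_3[of a] by (auto simp: *)
  define X where "X a = proj (T' a)" for a
  have XQ: "X a \<in> Q" for a by (simp add: X_def)
  have X: "T' a = X a + t *\<^sub>R T a" for a using T' by (simp add: X_def)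
  have "ext 2 (X 3 + t *\<^sub>R T 3) = X 1 + t *\<^sub>R T 1" "ext 3 (X 1 + t *\<^sub>R T 1) = X 2 + t *\<^sub>R T 2"
    using e(2,3) unfolding X .
  then have "I 2 (X 3) = X 1" "I 3 (X 1) = X 2" using XQ by (simp_all add: ext_linear)
  then have "X 2 = I 3 (X 1)" "X 3 = - I 2 (X 1)"
    using I_I[OF XQ[of 3], of 2] by auto
  then have "I a (X a) = I 1 (X 1)" for a
    using exhaust_3[of a] XQ by (auto simp: I_minus)
  then show "ext a (T' a) = ext 1 (T' 1)" for a
    unfolding X using XQ by (simp add: ext_linear ext_T)
qed

end

text \<open>With \<open>\<omega> a = d\<eta>\<^sub>a\<close>: the symmetric part of \<open>d\<eta>\<^sub>a(T\<^sub>b, x)\<close>. The antisymmetric part depends on the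
  choice of the local frame.\<close>
definition mix :: "(3 \<Rightarrow> 'e \<Rightarrow> 'e \<Rightarrow> real) \<Rightarrow> (3 \<Rightarrow> 'e) \<Rightarrow> 3 \<Rightarrow> 3 \<Rightarrow> 'e \<Rightarrow> real" where
  "mix \<omega> T a b x = \<omega> a (T b) x + \<omega> b (T a) x"

text \<open>A contraction of \<open>mix\<close> with the quaternions. Adding a linear functional
  \<open>e\<close> times the identity matrix to \<open>mix\<close> adds
  \<open>e (I b (I b x)) = - e x\<close> for every \<open>b\<close>, which drops out when defects
  for different \<open>b\<close> are compared.\<close>

definition defect ::
  "(3 \<Rightarrow> 'e \<Rightarrow> 'e) \<Rightarrow> (3 \<Rightarrow> 'e \<Rightarrow> 'e \<Rightarrow> real) \<Rightarrow> (3 \<Rightarrow> 'e) \<Rightarrow> 3 \<Rightarrow> 'e \<Rightarrow> real" where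
  "defect I \<omega> T b x = (\<Sum>a\<in>UNIV. mix \<omega> T a b (I a (I b x)))"

text \<open>This replaces the Reeb conditions, which cannot be imposed on a general structure in dimension 7.\<close>
definition normalised ::
  "'e set \<Rightarrow> (3 \<Rightarrow> 'e \<Rightarrow> 'e) \<Rightarrow> (3 \<Rightarrow> 'e \<Rightarrow> 'e \<Rightarrow> real) \<Rightarrow> (3 \<Rightarrow> 'e) \<Rightarrow> bool" where
  "normalised Q I \<omega> T \<longleftrightarrow> (\<forall>b. \<forall>x\<in>Q. defect I \<omega> T b x = defect I \<omega> T 1 x)"

section \<open>Effect of shifting the transverse frame on the normalisation\<close>

locale quaternionic_contact_space = quaternionic_space Q I
  for Q :: "'e::real_vector set" and I +
  fixes \<gamma> :: "'e \<Rightarrow> 'e \<Rightarrow> real" and \<omega> :: "3 \<Rightarrow> 'e \<Rightarrow> 'e \<Rightarrow> real"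
  assumes \<gamma>_linear: "x \<in> Q \<Longrightarrow> linear_on Q (\<gamma> x)"
    and \<gamma>_sym: "x \<in> Q \<Longrightarrow> y \<in> Q \<Longrightarrow> \<gamma> x y = \<gamma> y x"
    and \<gamma>_pos: "x \<in> Q \<Longrightarrow> x \<noteq> 0 \<Longrightarrow> \<gamma> x x > 0"
    and \<gamma>_I: "x \<in> Q \<Longrightarrow> y \<in> Q \<Longrightarrow> \<gamma> (I a x) (I a y) = \<gamma> x y"
    and \<omega>_linear_left: "linear (\<lambda>v. \<omega> a v w)"
    and \<omega>_linear_right: "linear (\<omega> a v)"
    and \<omega>_\<gamma>: "x \<in> Q \<Longrightarrow> y \<in> Q \<Longrightarrow> \<omega> a x y = \<gamma> (I a x) y"
begin

lemma \<gamma>_right: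
  assumes "x \<in> Q" "y \<in> Q" "z \<in> Q"
  shows "\<gamma> x (y + z) = \<gamma> x y + \<gamma> x z" "\<gamma> x (r *\<^sub>R y) = r * \<gamma> x y" "\<gamma> x (- y) = - \<gamma> x y"
    "\<gamma> x (y - z) = \<gamma> x y - \<gamma> x z"
proof -
  have *: "\<gamma> x (y + z) = \<gamma> x y + \<gamma> x z" "\<gamma> x (r *\<^sub>R y) = r * \<gamma> x y" if "y \<in> Q" "z \<in> Q" for y z r
    using linear_onD[OF \<gamma>_linear] assms(1) that by auto
  show "\<gamma> x (y + z) = \<gamma> x y + \<gamma> x z" "\<gamma> x (r *\<^sub>R y) = r * \<gamma> x y" using * assms by auto
  show m: "\<gamma> x (- y) = - \<gamma> x y" using *(2)[of y y "-1"] assms by simp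
  show "\<gamma> x (y - z) = \<gamma> x y - \<gamma> x z"
    using *(1)[of y "- z"] *(2)[of z z "-1"] assms by simp
qed

lemma \<gamma>_minus: "x \<in> Q \<Longrightarrow> y \<in> Q \<Longrightarrow> \<gamma> x (- y) = - \<gamma> x y"
  using \<gamma>_right(3)[of x y y] .

lemma \<gamma>_left_diff: "x \<in> Q \<Longrightarrow> y \<in> Q \<Longrightarrow> z \<in> Q \<Longrightarrow> \<gamma> (y - z) x = \<gamma> y x - \<gamma> z x"
  using \<gamma>_sym[of "y - z" x] \<gamma>_sym[of y x] \<gamma>_sym[of z x] \<gamma>_right(4)[of x y z] by simp

lemma \<gamma>_I_left: "x \<in> Q \<Longrightarrow> y \<in> Q \<Longrightarrow> \<gamma> (I a x) y = - \<gamma> x (I a y)"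
  using \<gamma>_I[of x "I a y" a] by (simp add: \<gamma>_minus)

lemma \<gamma>_eqI: "x \<in> Q \<Longrightarrow> y \<in> Q \<Longrightarrow> (\<And>z. z \<in> Q \<Longrightarrow> \<gamma> x z = \<gamma> y z) \<Longrightarrow> x = y"
  using \<gamma>_pos[of "x - y"] \<gamma>_left_diff[of "x - y" x y] by fastforce

lemma mix_linear: "linear (mix \<omega> T a b)"
  unfolding mix_def by (intro linear_compose_add \<omega>_linear_right)

lemma defect_linear_on: "linear_on Q (defect I \<omega> T b)"
  unfolding linear_on_def defect_def
  by (simp add: I_linear linear_add[OF mix_linear] linear_cmul[OF mix_linear] sum.distrib sum_distrib_left)

lemma defect_minus: "x \<in> Q \<Longrightarrow> defect I \<omega> T b (- x) = - defect I \<omega> T b x"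
  using linear_onD(2)[OF defect_linear_on, of x x T b "-1"] by simp

text \<open>On \<open>Q\<close> the form \<open>\<omega> a\<close> is
  \<open>\<gamma> (I a _) _\<close>. The first new term loses its common factor \<open>I a\<close>
  by invariance; in the second, \<open>I b\<close> must first be moved past \<open>I a\<close>, and
  anticommutation produces the sign for \<open>a \<noteq> b\<close>.\<close>

lemma mix_shift:
  assumes X: "\<And>a. X a \<in> Q" and x: "x \<in> Q"
  shows "mix \<omega> (\<lambda>b. T b + X b) a b (I a (I b x)) = mix \<omega> T a b (I a (I b x)) + \<gamma> (X b) (I b x)
    + (if a = b then \<gamma> (X a) (I a x) else - \<gamma> (X a) (I a x))"
proof -
  have 1: "\<omega> a (X b) (I a (I b x)) = \<gamma> (X b) (I b x)"
    using X x by (simp add: \<omega>_\<gamma> \<gamma>_I)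
  have anti: "I a (I b x) = (if a = b then I b (I a x) else - I b (I a x))"
    using exhaust_3[of a] exhaust_3[of b] x by auto
  have 2: "\<omega> b (X a) (I a (I b x)) = (if a = b then \<gamma> (X a) (I a x) else - \<gamma> (X a) (I a x))"
  proof (cases "a = b")
    case True
    then show ?thesis using X x by (simp add: \<omega>_\<gamma> \<gamma>_minus \<gamma>_I_left)
  next
    case False
    then show ?thesis unfolding anti using X x by (simp add: \<omega>_\<gamma> \<gamma>_minus \<gamma>_I)
  qed
  show ?thesis
    unfolding mix_def using 1 2 by (simp add: linear_add[OF \<omega>_linear_left])
qed

text \<open>With \<open>g a = \<gamma> (X a) (I a x)\<close>, summing over \<open>a\<close> gives
  three times \<open>g b\<close>, plus \<open>g b\<close> from \<open>a = b\<close>, minus the other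
  two: 3 g_b + g_b - (sum - g_b) = 5 g_b - sum.\<close>

lemma defect_shift:
  assumes X: "\<And>a. X a \<in> Q" and x: "x \<in> Q"
  shows "defect I \<omega> (\<lambda>b. T b + X b) b x =
    defect I \<omega> T b x + 5 * \<gamma> (X b) (I b x) - (\<Sum>a\<in>UNIV. \<gamma> (X a) (I a x))"
  using exhaust_3[of b] unfolding defect_def mix_shift[OF assms] by (auto simp: sum_3)

text \<open>The subtracted sum is the same for all \<open>b\<close>, so comparing \<open>b\<close>
  with 1 leaves 5 times the difference of the terms \<open>\<gamma> (X b) (I b x)\<close>;
  positivity of \<open>\<gamma>\<close> turns equality of functionals into equality of
  vectors.\<close>

lemma normalised_unique:
  assumes X: "\<And>a. X a \<in> Q" and "normalised Q I \<omega> T" "normalised Q I \<omega> (\<lambda>b. T b + X b)"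
  shows "I b (X b) = I 1 (X 1)"
proof (rule \<gamma>_eqI)
  fix x assume x: "x \<in> Q"
  have "\<gamma> (X b) (I b x) = \<gamma> (X 1) (I 1 x)"
  proof -
    have "defect I \<omega> T b x = defect I \<omega> T 1 x"
      "defect I \<omega> (\<lambda>b. T b + X b) b x = defect I \<omega> (\<lambda>b. T b + X b) 1 x"
      using assms(2,3) x unfolding normalised_def by blast+
    then show ?thesis unfolding defect_shift[OF X x] by simp
  qed
  then show "\<gamma> (I b (X b)) x = \<gamma> (I 1 (X 1)) x" using X x by (simp add: \<gamma>_I_left)
qed (use X in auto)

text \<open>This shift cancels the part of the defect that depends on \<open>b\<close>. The
  condition is put in the form \<open>\<gamma> (X b) x = ...\<close>, with \<open>I b\<close> moved
  to the right side, so that Riesz representation yields \<open>X b\<close> directly.\<close>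

lemma normalised_shift:
  assumes X: "\<And>a. X a \<in> Q" and eq: "\<And>b x. x \<in> Q \<Longrightarrow> 5 * \<gamma> (X b) x = defect I \<omega> T b (I b x)"
  shows "normalised Q I \<omega> (\<lambda>b. T b + X b)"
  unfolding normalised_def
proof (intro allI ballI)
  fix b x assume x: "x \<in> Q"
  have "5 * \<gamma> (X b) (I b x) = - defect I \<omega> T b x" for b
    using eq[of "I b x" b] x by (simp add: defect_minus)
  then show "defect I \<omega> (\<lambda>b. T b + X b) b x = defect I \<omega> (\<lambda>b. T b + X b) 1 x"
    unfolding defect_shift[OF X x] by simp
qed

end

text \<open>Differentiating \<open>B B\<^sup>T = f\<^sup>2\<close> for \<open>B = f S\<close> shows that the derivatives of the frame change
  contribute to \<open>mix\<close> only a multiple of the identity matrix, which does not affect normalisation.\<close>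
lemma normalised_frame_change:
  fixes S :: "3 \<Rightarrow> 3 \<Rightarrow> real"
  assumes "quaternionic_contact_space Q I \<gamma> \<omega>" "quaternionic_frame Q I \<eta> T" "quaternionic_space Q I'"
    and I': "\<And>a x. x \<in> Q \<Longrightarrow> I' a x = (\<Sum>b\<in>UNIV. S a b *\<^sub>R I b x)"
    and S: "\<And>b c. (\<Sum>a\<in>UNIV. S a b * S a c) = (if b = c then 1 else 0)"
    and f: "f \<noteq> 0"
    and \<omega>': "\<And>a v w. \<omega>' a v w = (\<Sum>c\<in>UNIV. f * S a c * \<omega> c v w + D a c v * \<eta> c w - D a c w * \<eta> c v)"
    and D: "\<And>a b x. (\<Sum>c\<in>UNIV. D a c x * (f * S b c) + f * S a c * D b c x) = (if a = b then e x else 0)"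
    and e: "\<And>x. e (- x) = - e x"
    and norm: "normalised Q I \<omega> T"
  shows "normalised Q I' \<omega>' (\<lambda>b. inverse f *\<^sub>R (\<Sum>c\<in>UNIV. S b c *\<^sub>R T c))"
proof -
  interpret quaternionic_contact_space Q I \<gamma> \<omega> by fact
  interpret F: quaternionic_frame Q I \<eta> T by fact
  interpret Q': quaternionic_space Q I' by fact
  let ?T = "\<lambda>b. inverse f *\<^sub>R (\<Sum>c\<in>UNIV. S b c *\<^sub>R T c)"
  \<comment> \<open>Since \<open>x\<close> lies in \<open>Q\<close>, only one of the two derivative
    terms survives, and there \<open>\<eta> c\<close> reads off the coefficient
    \<open>inverse f * S b c\<close> of the transported frame.\<close>
  have \<omega>T: "\<omega>' a (?T b) x = (\<Sum>c\<in>UNIV. \<Sum>d\<in>UNIV. S a c * S b d * \<omega> c (T d) x)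
      - inverse f * (\<Sum>c\<in>UNIV. D a c x * S b c)" if "x \<in> Q" for a b x
  proof -
    have "\<eta> c (?T b) = inverse f * S b c" for c
      using exhaust_3[of c] by (auto simp: F.\<eta>_linear F.dual sum_3)
    moreover have "f * S a c * \<omega> c (?T b) x = (\<Sum>d\<in>UNIV. S a c * S b d * \<omega> c (T d) x)" for c
    proof -
      have "f * S a c * \<omega> c (?T b) x = (f * inverse f) * S a c * (\<Sum>d\<in>UNIV. S b d * \<omega> c (T d) x)"
        by (simp add: linear_cmul[OF \<omega>_linear_left] linear_sum[OF \<omega>_linear_left])
      then show ?thesis using f by (simp add: sum_distrib_left mult.assoc)
    qed
    ultimately show ?thesis
      unfolding \<omega>' using that
      by (simp add: sum_subtractf sum_distrib_left mult_ac)
  qed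
  have mix': "mix \<omega>' ?T a b x = (\<Sum>c\<in>UNIV. \<Sum>d\<in>UNIV. S a c * S b d * mix \<omega> T c d x)
      - (if a = b then inverse f * inverse f * e x else 0)" if x: "x \<in> Q" for a b x
  proof -
    have 1: "(\<Sum>c\<in>UNIV. \<Sum>d\<in>UNIV. S b c * S a d * \<omega> c (T d) x) =
        (\<Sum>c\<in>UNIV. \<Sum>d\<in>UNIV. S a c * S b d * \<omega> d (T c) x)"
      by (subst sum.swap) (simp add: mult_ac)
    have "(if a = b then inverse f * inverse f * e x else 0) = inverse f * inverse f *
        (\<Sum>c\<in>UNIV. D a c x * (f * S b c) + f * S a c * D b c x)" using D[of a x b] by simp
    also have "\<dots> = inverse f * (\<Sum>c\<in>UNIV. D a c x * S b c) + inverse f * (\<Sum>c\<in>UNIV. D b c x * S a c)"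
      using f by (simp add: sum_3 field_simps)
    finally show ?thesis
      unfolding mix_def \<omega>T[OF x] 1 by (simp add: sum.distrib distrib_left)
  qed
  \<comment> \<open>The columns of \<open>S\<close> are orthonormal, so the transposed matrix
    recovers the old complex structures from the new ones.\<close>
  have inv: "(\<Sum>a\<in>UNIV. S a c *\<^sub>R I' a w) = I c w" if "w \<in> Q" for c w
  proof -
    have "(\<Sum>a\<in>UNIV. S a c *\<^sub>R I' a w) = (\<Sum>a\<in>UNIV. \<Sum>b\<in>UNIV. (S a b * S a c) *\<^sub>R I b w)"
      by (simp add: I'[OF that] scaleR_sum_right mult.commute)
    also have "\<dots> = (\<Sum>b\<in>UNIV. (\<Sum>a\<in>UNIV. S a b * S a c) *\<^sub>R I b w)"
      by (subst sum.swap) (simp add: scaleR_sum_left)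
    also have "\<dots> = I c w" unfolding S using exhaust_3[of c] by (auto simp: sum_3)
    finally show ?thesis .
  qed
  \<comment> \<open>Summing over \<open>a\<close> first turns the \<open>I' a\<close> back into
    \<open>I c\<close> and leaves an \<open>S b d\<close>-combination of minus the old defects at
    \<open>I d w\<close>. By \<open>norm\<close> these are values of one linear functional, so the
    combination collapses to its value at \<open>I' b w = - x\<close>; the two signs cancel.\<close>
  have "defect I' \<omega>' ?T b x = defect I \<omega> T 1 x + inverse f * inverse f * e x" if x: "x \<in> Q" for b x
  proof -
    define w where "w = I' b x"
    have w: "w \<in> Q" using x by (simp add: w_def)
    have "(\<Sum>a\<in>UNIV. \<Sum>c\<in>UNIV. \<Sum>d\<in>UNIV. S a c * S b d * mix \<omega> T c d (I' a w)) =
        (\<Sum>c\<in>UNIV. \<Sum>d\<in>UNIV. \<Sum>a\<in>UNIV. S a c * S b d * mix \<omega> T c d (I' a w))"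
      by (subst sum.swap, rule sum.cong[OF refl], rule sum.swap)
    also have "\<dots> = (\<Sum>c\<in>UNIV. \<Sum>d\<in>UNIV. S b d * mix \<omega> T c d (\<Sum>a\<in>UNIV. S a c *\<^sub>R I' a w))"
      by (simp add: linear_sum[OF mix_linear] linear_cmul[OF mix_linear] sum_distrib_left mult_ac)
    also have "\<dots> = (\<Sum>d\<in>UNIV. S b d * (\<Sum>c\<in>UNIV. mix \<omega> T c d (I c w)))"
      unfolding inv[OF w] by (subst sum.swap) (simp add: sum_distrib_left)
    also have "\<dots> = (\<Sum>d\<in>UNIV. S b d * (- defect I \<omega> T d (I d w)))"
      using w by (simp add: defect_def I_minus linear_neg[OF mix_linear] sum_negf)
    also have "\<dots> = (\<Sum>d\<in>UNIV. S b d * (- defect I \<omega> T 1 (I d w)))"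
    proof -
      have "defect I \<omega> T d (I d w) = defect I \<omega> T 1 (I d w)" for d
        using norm I_in[OF w] unfolding normalised_def by blast
      then show ?thesis by simp
    qed
    also have "\<dots> = - defect I \<omega> T 1 (\<Sum>d\<in>UNIV. S b d *\<^sub>R I d w)"
      using w linear_onD[OF defect_linear_on[of T 1]] by (simp add: sum_3)
    also have "\<dots> = defect I \<omega> T 1 x"
      using x by (simp add: I'[symmetric] w defect_minus) (simp add: w_def x defect_minus)
    finally have 1: "(\<Sum>a\<in>UNIV. \<Sum>c\<in>UNIV. \<Sum>d\<in>UNIV. S a c * S b d * mix \<omega> T c d (I' a w)) =
      defect I \<omega> T 1 x" .
    have "(\<Sum>a\<in>UNIV. if a = b then inverse f * inverse f * e (I' a w) else 0) = - (inverse f * inverse f * e x)"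
      using x e by (simp add: w_def)
    then show ?thesis
      unfolding defect_def[of I'] w_def[symmetric] using w 1 by (simp add: mix' sum_subtractf)
  qed
  then show ?thesis by (simp add: normalised_def)
qed

text \<open>The rows of \<open>S\<close> multiply like a cross product, so the combination
  \<open>E a\<close> of the old extensions acts on the transported frame as the new extension
  should. After the shift it differs from the new extension only in sending \<open>T' a\<close> to
  \<open>Y\<close> instead of 0. The error \<open>\<eta>' a x\<close> times \<open>Y\<close> cancels
  in the sum weighted by \<open>v\<close>, by the last hypothesis.\<close>

lemma ext_frame_change:
  fixes S :: "3 \<Rightarrow> 3 \<Rightarrow> real"
  assumes "quaternionic_frame Q I \<eta> T" "quaternionic_frame Q I' \<eta>' T'"
    and I': "\<And>a x. x \<in> Q \<Longrightarrow> I' a x = (\<Sum>b\<in>UNIV. S a b *\<^sub>R I b x)"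
    and cross: "\<And>a. S (a + 2) 1 = S a 2 * S (a + 1) 3 - S a 3 * S (a + 1) 2"
      "\<And>a. S (a + 2) 2 = S a 3 * S (a + 1) 1 - S a 1 * S (a + 1) 3"
      "\<And>a. S (a + 2) 3 = S a 1 * S (a + 1) 2 - S a 2 * S (a + 1) 1"
    and T': "\<And>b. T' b = inverse f *\<^sub>R (\<Sum>c\<in>UNIV. S b c *\<^sub>R T c) + X b"
    and X: "\<And>b. X b \<in> Q" "\<And>b. I' b (X b) = I' 1 (X 1)"
    and 0: "(\<Sum>a\<in>UNIV. v a * \<eta>' a x) = 0"
  shows "(\<Sum>a\<in>UNIV. v a *\<^sub>R quaternionic_frame.ext I' \<eta>' T' a x) =
    (\<Sum>b\<in>UNIV. (\<Sum>a\<in>UNIV. v a * S a b) *\<^sub>R quaternionic_frame.ext I \<eta> T b x)"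
proof -
  interpret F: quaternionic_frame Q I \<eta> T by fact
  interpret F': quaternionic_frame Q I' \<eta>' T' by fact
  define Y where "Y = I' 1 (X 1)"
  have Y: "Y \<in> Q" using X by (simp add: Y_def)
  have XY: "X b = - I' b Y" for b
    using X(2)[of b] F'.I_I[OF X(1), of b b] by (simp add: Y_def)
  define T0 where "T0 b = inverse f *\<^sub>R (\<Sum>c\<in>UNIV. S b c *\<^sub>R T c)" for b
  define E where "E a x = (\<Sum>b\<in>UNIV. S a b *\<^sub>R F.ext b x)" for a x
  have E_linear: "E a (x + y) = E a x + E a y" "E a (r *\<^sub>R x) = r *\<^sub>R E a x" for a x y r
    by (simp_all add: E_def sum_3 F.ext_linear algebra_simps)
  have E_Q: "E a q = I' a q" if "q \<in> Q" for a q
    using that by (simp add: E_def I')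
  have E_T0: "E a (T0 c) = inverse f *\<^sub>R ((S a 2 * S c 3 - S a 3 * S c 2) *\<^sub>R T 1
     + (S a 3 * S c 1 - S a 1 * S c 3) *\<^sub>R T 2 + (S a 1 * S c 2 - S a 2 * S c 1) *\<^sub>R T 3)" for a c
    by (simp add: E_def T0_def sum_3 F.ext_linear algebra_simps)
  have T0: "T0 a = inverse f *\<^sub>R (S a 1 *\<^sub>R T 1 + S a 2 *\<^sub>R T 2 + S a 3 *\<^sub>R T 3)" for a
    by (simp add: T0_def sum_3)
  have E1: "E a (T0 a) = 0" for a
    unfolding E_T0 by (simp add: mult.commute)
  have E2: "E a (T0 (a + 1)) = T0 (a + 2)" for a
    unfolding E_T0 T0[of "a + 2"] cross ..
  have E3: "E a (T0 (a + 2)) = - T0 (a + 1)" for a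
  proof -
    have *: "a + 2 + 1 = a" "a + 2 + 2 = a + 1" using exhaust_3[of a] by auto
    show ?thesis
      unfolding E_T0 T0[of "a + 1"] cross[of "a + 2", unfolded *] by (simp add: algebra_simps)
  qed
  have T'_eq: "T' b = T0 b - I' b Y" for b
    using T' XY by (simp add: T0_def)
  have ET: "E a (T' c) = E a (T0 c) - I' a (I' c Y)" for a c
    unfolding T'_eq using E_linear(1)[of a "T0 c" "- I' c Y"] Y
    by (simp add: E_Q F'.I_minus)
  have "E a x = F'.ext a x + \<eta>' a x *\<^sub>R Y" for a
  proof -
    obtain q r where x: "q \<in> Q" "x = q + r 1 *\<^sub>R T' 1 + r 2 *\<^sub>R T' 2 + r 3 *\<^sub>R T' 3" "\<And>a. \<eta>' a x = r a"
      using F'.decomposeE[of x] by blast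
    \<comment> \<open>The special shape of the shift, minus \<open>I' b Y\<close>, enters here: the
      quaternion relations carry the shift of \<open>T' (a + 1)\<close> exactly to that of
      \<open>T' (a + 2)\<close>.\<close>
    have "E a (T' a) = Y" "E a (T' (a + 1)) = T' (a + 2)" "E a (T' (a + 2)) = - T' (a + 1)"
      using exhaust_3[of a] Y unfolding ET E1 E2 E3 by (auto simp: T'_eq)
    then show ?thesis
      unfolding x(3) unfolding x(2) using exhaust_3[of a] x(1)
      by (auto simp: E_linear E_Q F'.ext_linear)
  qed
  then have "(\<Sum>a\<in>UNIV. v a *\<^sub>R E a x) = (\<Sum>a\<in>UNIV. v a *\<^sub>R F'.ext a x) + (\<Sum>a\<in>UNIV. v a * \<eta>' a x) *\<^sub>R Y"
    by (simp add: scaleR_add_right sum.distrib scaleR_sum_left)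
  moreover have "(\<Sum>a\<in>UNIV. v a *\<^sub>R E a x) = (\<Sum>b\<in>UNIV. (\<Sum>a\<in>UNIV. v a * S a b) *\<^sub>R F.ext b x)"
    unfolding E_def scaleR_sum_right scaleR_sum_left by (subst sum.swap) simp
  ultimately show ?thesis using 0 by simp
qed

section \<open>Orthogonal frames\<close>

lemma linear_on_sum:
  assumes "linear_on V f" "subspace V" "finite B" "\<And>i. i \<in> B \<Longrightarrow> x i \<in> V"
  shows "f (\<Sum>i\<in>B. r i *\<^sub>R x i) = (\<Sum>i\<in>B. r i *\<^sub>R f (x i))"
  using assms(3,4)
proof (induction B rule: finite_induct)
  case empty
  show ?case using linear_onD(2)[OF assms(1), of 0 0 0] subspace_0[OF assms(2)] by simp
next
  case (insert i B)
  have "(\<Sum>i\<in>B. r i *\<^sub>R x i) \<in> V" "r i *\<^sub>R x i \<in> V"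
    using insert assms(2) by (auto intro: subspace_sum subspace_mul)
  then show ?case using insert linear_onD[OF assms(1)] by simp
qed

lemma bundle_metricD:
  assumes "bundle_metric A Q \<gamma>" "x \<in> Q p"
  shows "linear_on (Q p) (\<gamma> p x)" "y \<in> Q p \<Longrightarrow> \<gamma> p x y = \<gamma> p y x" "x \<noteq> 0 \<Longrightarrow> \<gamma> p x x > 0"
  using assms by (auto simp: bundle_metric_def)

lemma smooth_fun_metric:
  "bundle_metric A Q \<gamma> \<Longrightarrow> open V \<Longrightarrow> section_of A V Q X \<Longrightarrow> section_of A V Q Y \<Longrightarrow>
    smooth_fun A V (\<lambda>p. \<gamma> p (X p) (Y p))"
  by (simp add: bundle_metric_def)

lemma section_of_subset: "section_of A U Q X \<Longrightarrow> V \<subseteq> U \<Longrightarrow> section_of A V Q X"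
  unfolding section_of_def using smooth_vf_subset by blast

lemma section_of_sum:
  assumes A: "smooth_atlas A" and V: "open V" and Q: "\<And>p. p \<in> V \<Longrightarrow> subspace (Q p)"
    and "finite B" "\<And>i. i \<in> B \<Longrightarrow> smooth_fun A V (f i)" "\<And>i. i \<in> B \<Longrightarrow> section_of A V Q (X i)"
  shows "section_of A V Q (\<lambda>p. \<Sum>i\<in>B. f i p *\<^sub>R X i p)"
  using assms unfolding section_of_def
  by (auto intro!: smooth_vf_sum smooth_vf_scaleR subspace_sum subspace_mul)

lemma section_of_diff:
  "smooth_atlas A \<Longrightarrow> open V \<Longrightarrow> (\<And>p. p \<in> V \<Longrightarrow> subspace (Q p)) \<Longrightarrow> section_of A V Q X \<Longrightarrow>
    section_of A V Q Y \<Longrightarrow> section_of A V Q (\<lambda>p. X p - Y p)"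
  unfolding section_of_def by (auto intro: smooth_vf_diff subspace_diff)

text \<open>Lengths are not normalised: only quotients by the positive functions
  \<open>\<gamma> (Y i) (Y i)\<close> occur, so no smooth square roots are needed.\<close>

lemma gram_schmidt_sections:
  fixes k :: nat
  assumes A: "smooth_atlas A" and V: "open V" and Q: "\<And>p. p \<in> V \<Longrightarrow> subspace (Q p)"
    and \<gamma>: "bundle_metric A Q \<gamma>" and X: "\<And>i. i < k \<Longrightarrow> section_of A V Q (X i)"
    and indep: "\<And>p j. p \<in> V \<Longrightarrow> j < k \<Longrightarrow> X j p \<notin> span ((\<lambda>i. X i p) ` {..<j})"
  shows "\<exists>Y. (\<forall>i<k. section_of A V Q (Y i)) \<and>
    (\<forall>p\<in>V. (\<forall>i<k. Y i p \<noteq> 0) \<and> (\<forall>i<k. \<forall>j<k. i \<noteq> j \<longrightarrow> \<gamma> p (Y i p) (Y j p) = 0) \<and>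
      span ((\<lambda>i. Y i p) ` {..<k}) = span ((\<lambda>i. X i p) ` {..<k}))"
  using X indep
proof (induction k)
  case 0
  show ?case by simp
next
  case (Suc k)
  have "\<exists>Y. (\<forall>i<k. section_of A V Q (Y i)) \<and>
    (\<forall>p\<in>V. (\<forall>i<k. Y i p \<noteq> 0) \<and> (\<forall>i<k. \<forall>j<k. i \<noteq> j \<longrightarrow> \<gamma> p (Y i p) (Y j p) = 0) \<and>
      span ((\<lambda>i. Y i p) ` {..<k}) = span ((\<lambda>i. X i p) ` {..<k}))"
    using Suc.prems by (intro Suc.IH) simp_all
  then obtain Y where Y0: "(\<forall>i<k. section_of A V Q (Y i)) \<and>
    (\<forall>p\<in>V. (\<forall>i<k. Y i p \<noteq> 0) \<and> (\<forall>i<k. \<forall>j<k. i \<noteq> j \<longrightarrow> \<gamma> p (Y i p) (Y j p) = 0) \<and>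
      span ((\<lambda>i. Y i p) ` {..<k}) = span ((\<lambda>i. X i p) ` {..<k}))" ..
  note Y' = conjunct1[OF Y0] conjunct2[OF Y0]
  have Y: "section_of A V Q (Y i)" if "i < k" for i using Y'(1) that by blast
  have nz: "Y i p \<noteq> 0" if "p \<in> V" "i < k" for p i using Y'(2) that by blast
  have orth: "\<gamma> p (Y i p) (Y j p) = 0" if "p \<in> V" "i < k" "j < k" "i \<noteq> j" for p i j
    using Y'(2) that by blast
  have span: "span ((\<lambda>i. Y i p) ` {..<k}) = span ((\<lambda>i. X i p) ` {..<k})" if "p \<in> V" for p
    using Y'(2) that by blast
  define c where "c i p = \<gamma> p (X k p) (Y i p) / \<gamma> p (Y i p) (Y i p)" for i p
  define W where "W p = (\<Sum>i<k. c i p *\<^sub>R Y i p)" for p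
  define Z where "Z p = X k p - W p" for p
  have inQ: "Y i p \<in> Q p" "X k p \<in> Q p" if "p \<in> V" "i < k" for i p
    using Y[OF that(2)] Suc.prems(1)[of k] that(1) by (auto simp: section_of_def)
  have XQ: "X k p \<in> Q p" if "p \<in> V" for p
    using Suc.prems(1)[of k] that by (auto simp: section_of_def)
  have pos: "\<gamma> p (Y i p) (Y i p) > 0" if "p \<in> V" "i < k" for i p
    using bundle_metricD(3)[OF \<gamma> inQ(1)] nz that by blast
  have smc: "smooth_fun A V (c i)" if "i < k" for i
    unfolding c_def using pos that less_imp_neq
    by (intro smooth_fun_divide[OF A V] smooth_fun_metric[OF \<gamma> V] Y Suc.prems(1)) (force+)
  have W: "section_of A V Q W"
    unfolding W_def using smc Y by (intro section_of_sum[OF A V Q]) auto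
  have Z: "section_of A V Q Z"
    unfolding Z_def using Suc.prems(1) W by (intro section_of_diff[OF A V Q]) auto
  have ZQ: "Z p \<in> Q p" "W p \<in> Q p" if "p \<in> V" for p
    using Z W that by (auto simp: section_of_def)
  have Wspan: "W p \<in> span ((\<lambda>i. Y i p) ` {..<k})" for p
    unfolding W_def by (intro span_sum span_scale span_base) auto
  have Znz: "Z p \<noteq> 0" if "p \<in> V" for p
  proof
    assume "Z p = 0"
    then have "X k p \<in> span ((\<lambda>i. X i p) ` {..<k})"
      using Wspan[of p] span[OF that] by (simp add: Z_def)
    then show False using Suc.prems(2)[OF that] by blast
  qed
  have Zorth: "\<gamma> p (Y j p) (Z p) = 0" if p: "p \<in> V" and j: "j < k" for p j
  proof -
    note lin = bundle_metricD(1)[OF \<gamma> inQ(1)[OF p j]]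
    have "\<gamma> p (Y j p) (W p) = (\<Sum>i<k. c i p * \<gamma> p (Y j p) (Y i p))"
      unfolding W_def using linear_on_sum[OF lin Q[OF p], of "{..<k}" "\<lambda>i. Y i p"] inQ(1)[OF p] by simp
    also have "\<dots> = (\<Sum>i<k. if i = j then c j p * \<gamma> p (Y j p) (Y j p) else 0)"
      using orth[OF p j] by (intro sum.cong) auto
    also have "\<dots> = \<gamma> p (Y j p) (X k p)"
      using j pos[OF p j] bundle_metricD(2)[OF \<gamma> inQ(1)[OF p j] XQ[OF p]] by (simp add: c_def)
    finally have "\<gamma> p (Y j p) (W p) = \<gamma> p (Y j p) (X k p)" .
    moreover have "\<gamma> p (Y j p) (X k p) = \<gamma> p (Y j p) (Z p) + \<gamma> p (Y j p) (W p)"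
      using linear_onD(1)[OF lin ZQ(1)[OF p] ZQ(2)[OF p]] by (simp add: Z_def)
    ultimately show ?thesis by simp
  qed
  have spanZ: "span ((\<lambda>i. (Y(k := Z)) i p) ` {..<Suc k}) = span ((\<lambda>i. X i p) ` {..<Suc k})"
    if p: "p \<in> V" for p
  proof -
    have "span (insert (Z p) ((\<lambda>i. Y i p) ` {..<k})) = span (insert (X k p) ((\<lambda>i. Y i p) ` {..<k}))"
      using eq_span_insert_eq[of "Z p" "X k p" "(\<lambda>i. Y i p) ` {..<k}"] span_neg[OF Wspan[of p]]
      by (simp add: Z_def)
    also have "\<dots> = span (insert (X k p) ((\<lambda>i. X i p) ` {..<k}))"
      using span[OF p] by (simp add: span_insert)
    finally show ?thesis by (simp add: lessThan_Suc)
  qed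
  show ?case
  proof (intro exI[of _ "Y(k := Z)"] conjI ballI allI impI)
    fix i assume "i < Suc k"
    then show "section_of A V Q ((Y(k := Z)) i)" using Y Z by (auto simp: less_Suc_eq)
  next
    fix p i assume "p \<in> V" "i < Suc k"
    then show "(Y(k := Z)) i p \<noteq> 0" using nz Znz by (auto simp: less_Suc_eq)
  next
    fix p i j assume *: "p \<in> V" "i < Suc k" "j < Suc k" "i \<noteq> j"
    then show "\<gamma> p ((Y(k := Z)) i p) ((Y(k := Z)) j p) = 0"
      using orth Zorth bundle_metricD(2)[OF \<gamma> ZQ(1)[OF *(1)] inQ(1)[OF *(1)]] by (auto simp: less_Suc_eq)
  qed (rule spanZ)
qed

text \<open>A vector dependent on its predecessors could be dropped, leaving \<open>k - 1\<close>
  vectors to span dimension \<open>k\<close>. Independence from predecessors is the form consumed by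
  Gram-Schmidt.\<close>

lemma spanning_family_independent:
  fixes X :: "nat \<Rightarrow> 'a::euclidean_space"
  assumes "dim (span (X ` {..<k})) = k" "j < k"
  shows "X j \<notin> span (X ` {..<j})"
proof
  assume "X j \<in> span (X ` {..<j})"
  moreover have "X ` {..<j} \<subseteq> X ` ({..<k} - {j})" using assms(2) by auto
  ultimately have "X j \<in> span (X ` ({..<k} - {j}))" using span_mono by blast
  then have "X ` {..<k} \<subseteq> span (X ` ({..<k} - {j}))" by (auto intro: span_base)
  then have "dim (X ` {..<k}) \<le> card (X ` ({..<k} - {j}))" by (rule dim_le_card) simp
  also have "\<dots> \<le> k - 1" using card_image_le[of "{..<k} - {j}" X] assms(2) by simp
  finally show False using assms by simp
qed

lemma corank_subbundleD:
  fixes A :: "('m::topological_space, 'e::euclidean_space) chart set"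
  assumes "corank_subbundle A U r Q" "p \<in> U"
  shows "subspace (Q p)" "dim (Q p) + r = DIM('e)"
  using assms by (auto simp: corank_subbundle_def subbundle_def)

lemma subbundle_frame:
  assumes "subbundle A U k E" "p \<in> U"
  obtains V X where "open V" "p \<in> V" "V \<subseteq> U" "\<And>i. i < k \<Longrightarrow> smooth_vf A V (X i)"
    "\<And>q. q \<in> V \<Longrightarrow> E q = span ((\<lambda>i. X i q) ` {..<k})"
proof -
  have "\<exists>V X. open V \<and> p \<in> V \<and> V \<subseteq> U \<and> (\<forall>i<k. smooth_vf A V (X i)) \<and>
        (\<forall>q\<in>V. E q = span ((\<lambda>i. X i q) ` {..<k}))"
    using assms unfolding subbundle_def by simp
  then obtain V where "\<exists>X. open V \<and> p \<in> V \<and> V \<subseteq> U \<and> (\<forall>i<k. smooth_vf A V (X i)) \<and>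
        (\<forall>q\<in>V. E q = span ((\<lambda>i. X i q) ` {..<k}))" ..
  then obtain X where "open V \<and> p \<in> V \<and> V \<subseteq> U \<and> (\<forall>i<k. smooth_vf A V (X i)) \<and>
        (\<forall>q\<in>V. E q = span ((\<lambda>i. X i q) ` {..<k}))" ..
  then show thesis by (intro that[of V X]) simp_all
qed

text \<open>Smooth Riesz representation: in an orthogonal frame the representing section has
  coefficients \<open>\<mu> (Y i) / \<gamma> (Y i) (Y i)\<close>. The neighbourhood \<open>V\<close>
  is fixed before \<open>\<mu>\<close> and \<open>W\<close>, so that it serves several functionals
  at once and can be shrunk freely.\<close>

lemma riesz_sections:
  assumes A: "smooth_atlas A" and Q: "subbundle A U k Q" and \<gamma>: "bundle_metric A Q \<gamma>" and p0: "p0 \<in> U"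
  shows "\<exists>V. open V \<and> p0 \<in> V \<and> V \<subseteq> U \<and> (\<forall>\<mu> W. open W \<and> W \<subseteq> V \<and> (\<forall>p\<in>W. linear_on (Q p) (\<mu> p)) \<and>
     (\<forall>X. section_of A W Q X \<longrightarrow> smooth_fun A W (\<lambda>p. \<mu> p (X p))) \<longrightarrow>
     (\<exists>C. section_of A W Q C \<and> (\<forall>p\<in>W. \<forall>x\<in>Q p. \<gamma> p (C p) x = \<mu> p x)))"
proof -
  have sub: "subspace (Q p)" and dim: "dim (Q p) = k" if "p \<in> U" for p
    using Q that by (auto simp: subbundle_def)
  obtain V X where V: "open V" "p0 \<in> V" "V \<subseteq> U" and X: "\<And>i. i < k \<Longrightarrow> smooth_vf A V (X i)"
    and span: "\<And>q. q \<in> V \<Longrightarrow> Q q = span ((\<lambda>i. X i q) ` {..<k})"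
    by (rule subbundle_frame[OF Q p0]) blast
  have subV: "subspace (Q p)" if "p \<in> V" for p using sub V that by blast
  have XQ: "section_of A V Q (X i)" if "i < k" for i
    using X[OF that] span that by (auto simp: section_of_def intro!: span_base)
  have "X j p \<notin> span ((\<lambda>i. X i p) ` {..<j})" if "p \<in> V" "j < k" for p j
    using spanning_family_independent[of "\<lambda>i. X i p" k j] span[OF that(1)] dim[of p] V that by auto
  from gram_schmidt_sections[OF A V(1) subV \<gamma> XQ this] obtain Y where Y0: "(\<forall>i<k. section_of A V Q (Y i)) \<and>
    (\<forall>p\<in>V. (\<forall>i<k. Y i p \<noteq> 0) \<and> (\<forall>i<k. \<forall>j<k. i \<noteq> j \<longrightarrow> \<gamma> p (Y i p) (Y j p) = 0) \<and>
      span ((\<lambda>i. Y i p) ` {..<k}) = span ((\<lambda>i. X i p) ` {..<k}))" ..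
  note Y' = conjunct1[OF Y0] conjunct2[OF Y0]
  have Y: "section_of A V Q (Y i)" if "i < k" for i using Y'(1) that by blast
  have nz: "Y i p \<noteq> 0" if "p \<in> V" "i < k" for p i using Y'(2) that by blast
  have orth: "\<gamma> p (Y i p) (Y j p) = 0" if "p \<in> V" "i < k" "j < k" "i \<noteq> j" for p i j
    using Y'(2) that by blast
  have spanY: "span ((\<lambda>i. Y i p) ` {..<k}) = Q p" if "p \<in> V" for p
    using Y'(2) that span[OF that] by blast
  have inQ: "Y i p \<in> Q p" if "p \<in> V" "i < k" for i p
    using Y[OF that(2)] that(1) by (auto simp: section_of_def)
  have pos: "\<gamma> p (Y i p) (Y i p) > 0" if "p \<in> V" "i < k" for i p
    using bundle_metricD(3)[OF \<gamma> inQ] nz that by blast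
  have "\<exists>C. section_of A W Q C \<and> (\<forall>p\<in>W. \<forall>x\<in>Q p. \<gamma> p (C p) x = \<mu> p x)"
    if W: "open W" "W \<subseteq> V" and lin: "\<And>p. p \<in> W \<Longrightarrow> linear_on (Q p) (\<mu> p)"
      and sm: "\<And>X. section_of A W Q X \<Longrightarrow> smooth_fun A W (\<lambda>p. \<mu> p (X p))" for \<mu> W
  proof -
    define c where "c i p = \<mu> p (Y i p) / \<gamma> p (Y i p) (Y i p)" for i p
    define C where "C p = (\<Sum>i<k. c i p *\<^sub>R Y i p)" for p
    have YW: "section_of A W Q (Y i)" if "i < k" for i
      using section_of_subset[OF Y[OF that] W(2)] .
    have ne: "\<gamma> p (Y i p) (Y i p) \<noteq> 0" if "p \<in> W" "i < k" for p i
      using pos[of p i] that W by auto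
    have "smooth_fun A W (c i)" if "i < k" for i
      unfolding c_def using ne that
      by (intro smooth_fun_divide[OF A W(1)] smooth_fun_metric[OF \<gamma> W(1)] YW sm) auto
    then have sec: "section_of A W Q C"
      unfolding C_def using YW W subV by (intro section_of_sum[OF A W(1)]) auto
    moreover have "\<gamma> p (C p) x = \<mu> p x" if p: "p \<in> W" and x: "x \<in> Q p" for p x
    proof -
      have pV: "p \<in> V" using p W by auto
      have CQ: "C p \<in> Q p" using sec p by (auto simp: section_of_def)
      note linC = bundle_metricD(1)[OF \<gamma> CQ]
      have YC: "\<gamma> p (C p) (Y j p) = \<mu> p (Y j p)" if j: "j < k" for j
      proof -
        have "\<gamma> p (C p) (Y j p) = \<gamma> p (Y j p) (C p)"
          using bundle_metricD(2)[OF \<gamma> CQ inQ[OF pV j]] .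
        also have "\<dots> = (\<Sum>i<k. c i p * \<gamma> p (Y j p) (Y i p))"
          unfolding C_def
          using linear_on_sum[OF bundle_metricD(1)[OF \<gamma> inQ[OF pV j]] subV[OF pV], of "{..<k}" "\<lambda>i. Y i p"]
            inQ[OF pV] by simp
        also have "\<dots> = (\<Sum>i<k. if i = j then c j p * \<gamma> p (Y j p) (Y j p) else 0)"
          using orth[OF pV j] by (intro sum.cong) auto
        also have "\<dots> = \<mu> p (Y j p)" using j ne[OF p j] by (simp add: c_def)
        finally show ?thesis .
      qed
      have "subspace {x \<in> Q p. \<gamma> p (C p) x = \<mu> p x}"
        using linear_onD[OF linC] linear_onD[OF lin[OF p]] subV[OF pV]
          linear_onD(2)[OF linC, of 0 0 0] linear_onD(2)[OF lin[OF p], of 0 0 0]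
        by (auto simp: subspace_def)
      moreover have "(\<lambda>i. Y i p) ` {..<k} \<subseteq> {x \<in> Q p. \<gamma> p (C p) x = \<mu> p x}"
        using YC inQ[OF pV] by auto
      ultimately have "Q p \<subseteq> {x \<in> Q p. \<gamma> p (C p) x = \<mu> p x}"
        unfolding spanY[OF pV, symmetric] by (rule span_minimal[rotated])
      then show ?thesis using x by blast
    qed
    ultimately show ?thesis by blast
  qed
  then have "\<forall>\<mu> W. open W \<and> W \<subseteq> V \<and> (\<forall>p\<in>W. linear_on (Q p) (\<mu> p)) \<and>
     (\<forall>X. section_of A W Q X \<longrightarrow> smooth_fun A W (\<lambda>p. \<mu> p (X p))) \<longrightarrow>
     (\<exists>C. section_of A W Q C \<and> (\<forall>p\<in>W. \<forall>x\<in>Q p. \<gamma> p (C p) x = \<mu> p x))" by simp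
  then show ?thesis using V by (intro exI[of _ V]) simp
qed

section \<open>Normalised transverse frames\<close>

locale qc_frame =
  fixes A :: "('m::topological_space, 'e::euclidean_space) chart set" and Q :: "'m \<Rightarrow> 'e set"
    and \<gamma> :: "'m \<Rightarrow> 'e \<Rightarrow> 'e \<Rightarrow> real" and U :: "'m set"
    and I :: "3 \<Rightarrow> 'm \<Rightarrow> 'e \<Rightarrow> 'e" and \<eta> :: "3 \<Rightarrow> 'm \<Rightarrow> 'e \<Rightarrow> real"
  assumes atlas: "smooth_atlas A" and openU: "open U"
    and corank: "corank_subbundle A UNIV 3 Q"
    and metric: "bundle_metric A Q \<gamma>"
    and complex_I: "complex_structure A U Q (I a)"
    and form: "smooth_form A U (\<eta> a)"
    and I12: "p \<in> U \<Longrightarrow> x \<in> Q p \<Longrightarrow> I 1 p (I 2 p x) = I 3 p x"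
    and I21: "p \<in> U \<Longrightarrow> x \<in> Q p \<Longrightarrow> - I 2 p (I 1 p x) = I 3 p x"
    and ker: "p \<in> U \<Longrightarrow> Q p = {x. \<forall>a. \<eta> a p x = 0}"
    and inv: "p \<in> U \<Longrightarrow> x \<in> Q p \<Longrightarrow> y \<in> Q p \<Longrightarrow> \<gamma> p (I a p x) (I a p y) = \<gamma> p x y"
    and d\<eta>: "p \<in> U \<Longrightarrow> x \<in> Q p \<Longrightarrow> y \<in> Q p \<Longrightarrow> \<gamma> p (I a p x) y = ext_deriv A (\<eta> a) p x y"
begin

lemma subspace: "subspace (Q p)" and dim_Q: "dim (Q p) + 3 = DIM('e)"
  using corank_subbundleD[OF corank] by auto

lemma contact_space:
  assumes "p \<in> U"
  shows "quaternionic_contact_space (Q p) (\<lambda>a. I a p) (\<gamma> p) (\<lambda>a. ext_deriv A (\<eta> a) p)"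
proof (intro quaternionic_contact_space.intro quaternionic_space.intro quaternionic_contact_space_axioms.intro)
  have "(\<lambda>v. ext_deriv A (\<eta> a) p v w) = (\<lambda>v. - ext_deriv A (\<eta> a) p w v)" for a w
    by (rule HOL.ext) (rule ext_deriv_swap[OF atlas openU form])
  then show "linear (\<lambda>v. ext_deriv A (\<eta> a) p v w)" for a w
    using linear_compose_neg[OF linear_ext_deriv[OF atlas openU form assms]] by simp
qed (use assms complex_I subspace bundle_metricD[OF metric] linear_ext_deriv[OF atlas openU form] I12 I21 inv d\<eta>
    in \<open>auto simp: complex_structure_def\<close>)

lemma restrict_frame: "open V \<Longrightarrow> V \<subseteq> U \<Longrightarrow> qc_frame A Q \<gamma> V I \<eta>"
  using atlas corank metric complex_I form smooth_form_subset[of A U _ V] I12 I21 ker inv d\<eta>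
  by unfold_locales (auto simp: complex_structure_def subset_iff)

lemma section_I:
  assumes "open V" "V \<subseteq> U" "section_of A V Q X"
  shows "section_of A V Q (\<lambda>p. I a p (X p))"
  using assms complex_I[of a]
  unfolding section_of_def complex_structure_def linear_complex_structure_def by blast

text \<open>The three forms are independent because their common kernel has corank exactly 3: on the
  orthogonal complement of \<open>Q p\<close>, of dimension 3, the combined map to
  \<open>real^3\<close> is injective and hence onto.\<close>

lemma \<eta>_surj:
  assumes p: "p \<in> U"
  shows "\<exists>e. \<forall>a. \<eta> a p e = (if a = b then 1 else 0)"
proof -
  define L where "L x = (\<chi> a. \<eta> a p x)" for x
  have lin\<eta>: "linear (\<eta> a p)" for a using smooth_formD[OF form p] .
  then have L: "linear L"
    by (intro linearI) (simp_all add: L_def vec_eq_iff linear_add linear_cmul)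
  define K where "K = {y \<in> UNIV. \<forall>x\<in>Q p. orthogonal x y}"
  have "dim K + dim (Q p) = dim (UNIV :: 'e set)"
    unfolding K_def by (rule dim_subspace_orthogonal_to_vectors[OF subspace]) auto
  then have "dim K = 3" using dim_Q[of p] by simp
  have K: "subspace K"
    by (auto simp: K_def subspace_def orthogonal_clauses)
  have "inj_on L (span K)"
  proof (rule inj_onI)
    fix x y assume "x \<in> span K" "y \<in> span K" "L x = L y"
    then have "x - y \<in> K" using K by (metis span_eq_iff subspace_diff)
    moreover have "x - y \<in> Q p"
      using \<open>L x = L y\<close> lin\<eta> by (simp add: ker[OF p] L_def vec_eq_iff linear_diff)
    ultimately have "orthogonal (x - y) (x - y)" by (simp add: K_def)
    then show "x = y" by (simp add: orthogonal_self)
  qed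
  then have "dim (L ` K) = dim (UNIV :: (real^3) set)"
    using dim_image_eq[OF L] \<open>dim K = 3\<close> by simp
  then have "span (L ` K) = UNIV" using dim_eq_full[of "L ` K"] by simp
  moreover have "subspace (L ` K)" using linear_subspace_image[OF L K] .
  ultimately have "L ` K = UNIV" by (metis span_eq_iff)
  then obtain e where "L e = axis b 1" by (metis UNIV_I image_iff)
  then have "\<eta> a p e = (if a = b then 1 else 0)" for a
    by (auto simp: L_def vec_eq_iff axis_def)
  then show ?thesis by blast
qed

text \<open>A dual basis at \<open>p0\<close> is extended with constant chart components. Near
  \<open>p0\<close> the pairing matrix \<open>M\<close> stays invertible, and multiplying by its
  inverse restores duality; Cramer's rule makes the inverse visibly smooth.\<close>

lemma local_dual_fields:
  assumes p0: "p0 \<in> U"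
  shows "\<exists>V T. open V \<and> p0 \<in> V \<and> V \<subseteq> U \<and> (\<forall>a. smooth_vf A V (T a)) \<and>
    (\<forall>p\<in>V. \<forall>a b. \<eta> a p (T b p) = (if a = b then 1 else 0))"
proof -
  define c where "c = chart_at A p0"
  have c: "c \<in> A" "p0 \<in> fst c" using chart_at[OF atlas] by (auto simp: c_def)
  note ic = smooth_atlasD(1)[OF atlas c(1)]
  have "\<forall>b. \<exists>e. \<forall>a. \<eta> a p0 e = (if a = b then 1 else 0)" using \<eta>_surj[OF p0] by blast
  from choice[OF this] obtain e where e: "\<And>a b. \<eta> a p0 (e b) = (if a = b then 1 else 0)" by blast
  let ?W = "U \<inter> fst c"
  have W: "open ?W" using openU ic by (auto simp: is_chart_def)
  define E where "E b = const_vf A c (e b)" for b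
  have E: "smooth_vf A ?W (E b)" for b
    using smooth_vf_const_vf[OF atlas c(1)] smooth_vf_subset unfolding E_def by blast
  define M where "M a b p = \<eta> a p (E b p)" for a b p
  have M: "smooth_fun A ?W (M a b)" for a b
    unfolding M_def using E form by (intro smooth_fun_form_vf[OF atlas W]) (auto intro: smooth_form_subset)
  have M0: "M a b p0 = (if a = b then 1 else 0)" for a b
    using e c by (simp add: M_def E_def const_vf_def c_def[symmetric] chart_change_self[OF ic])
  \<comment> \<open>Entries of the adjugate matrix. Cyclic indices absorb the usual checkerboard
    signs.\<close>
  define cof where "cof i b p = M (b + 1) (i + 1) p * M (b + 2) (i + 2) p - M (b + 1) (i + 2) p * M (b + 2) (i + 1) p" for i b p
  define D where "D p = (\<Sum>i\<in>UNIV. M 1 i p * cof i 1 p)" for p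
  have cof: "smooth_fun A ?W (cof i b)" for i b
    unfolding cof_def by (intro smooth_fun_diff smooth_fun_mult atlas W M)
  have D: "smooth_fun A ?W D"
    unfolding D_def by (intro smooth_fun_sum smooth_fun_mult atlas W M cof) simp
  have cramer: "(\<Sum>i\<in>UNIV. M a i p * cof i b p) = (if a = b then D p else 0)" for a b p
    using exhaust_3[of a] exhaust_3[of b] by (auto simp: D_def cof_def sum_3 algebra_simps)
  define V where "V = ?W \<inter> D -` (- {0})"
  have V: "open V"
    using continuous_open_preimage[OF smooth_fun_imp_continuous_on[OF atlas c(1) D], of "- {0}"] W open_Compl[of "{0::real}"]
    by (simp add: V_def inf.assoc)
  have p0V: "p0 \<in> V" using p0 c by (simp add: V_def D_def cof_def M0 sum_3)
  define T where "T b p = (\<Sum>i\<in>UNIV. (cof i b p / D p) *\<^sub>R E i p)" for b p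
  have "smooth_vf A V (T b)" for b
    unfolding T_def
    by (intro smooth_vf_sum smooth_vf_scaleR smooth_fun_divide atlas V smooth_fun_subset[OF cof]
        smooth_fun_subset[OF D] smooth_vf_subset[OF E]) (auto simp: V_def)
  moreover have "\<eta> a p (T b p) = (if a = b then 1 else 0)" if "p \<in> V" for a b p
  proof -
    have l: "linear (\<eta> a p)" using smooth_formD[OF form, of p a] that by (auto simp: V_def)
    have "\<eta> a p (T b p) = (\<Sum>i\<in>UNIV. M a i p * cof i b p) / D p"
      unfolding T_def by (simp add: linear_sum[OF l] linear_cmul[OF l] M_def sum_divide_distrib mult.commute)
    then show ?thesis using that unfolding cramer by (auto simp: V_def)
  qed
  ultimately show ?thesis using V p0V by (intro exI[of _ V] exI[of _ T]) (auto simp: V_def)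
qed

end

locale normalised_qc_frame = qc_frame A Q \<gamma> U I \<eta>
  for A :: "('m::topological_space, 'e::euclidean_space) chart set" and Q \<gamma> U I \<eta> +
  fixes T :: "3 \<Rightarrow> 'm \<Rightarrow> 'e"
  assumes smooth_T: "smooth_vf A U (T a)"
    and dual_T: "p \<in> U \<Longrightarrow> \<eta> a p (T b p) = (if a = b then 1 else 0)"
    and normalised_T: "p \<in> U \<Longrightarrow> normalised (Q p) (\<lambda>a. I a p) (\<lambda>a. ext_deriv A (\<eta> a) p) (\<lambda>a. T a p)"

text \<open>Starting from any dual frame, the functional demanded by \<open>normalised_shift\<close>
  is one fifth of the defect at \<open>I b x\<close>; it is smooth on sections of \<open>Q\<close>,
  so Riesz representation turns it into a smooth shift. A shift inside \<open>Q\<close> does not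
  disturb duality.\<close>

lemma (in qc_frame) local_normalised_frame:
  assumes p0: "p0 \<in> U"
  shows "\<exists>V T. p0 \<in> V \<and> V \<subseteq> U \<and> normalised_qc_frame A Q \<gamma> V I \<eta> T"
proof -
  obtain V1 T where V1: "open V1" "p0 \<in> V1" "V1 \<subseteq> U" and T: "\<And>a. smooth_vf A V1 (T a)"
    and dual: "\<And>p a b. p \<in> V1 \<Longrightarrow> \<eta> a p (T b p) = (if a = b then 1 else 0)"
    using local_dual_fields[OF p0] by blast
  obtain k where "subbundle A UNIV k Q" using corank by (auto simp: corank_subbundle_def)
  from riesz_sections[OF atlas this metric UNIV_I, of p0] obtain V2 where
    "open V2 \<and> p0 \<in> V2 \<and> V2 \<subseteq> UNIV \<and> (\<forall>\<mu> W. open W \<and> W \<subseteq> V2 \<and> (\<forall>p\<in>W. linear_on (Q p) (\<mu> p)) \<and>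
     (\<forall>X. section_of A W Q X \<longrightarrow> smooth_fun A W (\<lambda>p. \<mu> p (X p))) \<longrightarrow>
     (\<exists>C. section_of A W Q C \<and> (\<forall>p\<in>W. \<forall>x\<in>Q p. \<gamma> p (C p) x = \<mu> p x)))" ..
  then have V2: "open V2" "p0 \<in> V2" and
    riesz: "\<And>\<mu> W. open W \<Longrightarrow> W \<subseteq> V2 \<Longrightarrow> (\<And>p. p \<in> W \<Longrightarrow> linear_on (Q p) (\<mu> p)) \<Longrightarrow>
      (\<And>X. section_of A W Q X \<Longrightarrow> smooth_fun A W (\<lambda>p. \<mu> p (X p))) \<Longrightarrow>
      \<exists>C. section_of A W Q C \<and> (\<forall>p\<in>W. \<forall>x\<in>Q p. \<gamma> p (C p) x = \<mu> p x)"
    by simp_all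
  define V where "V = V1 \<inter> V2"
  have V: "open V" "p0 \<in> V" "V \<subseteq> V2" "V \<subseteq> V1" "V \<subseteq> U" using V1 V2 by (auto simp: V_def)
  have TV: "smooth_vf A V (T a)" for a using smooth_vf_subset[OF T V(4)] .
  interpret V: qc_frame A Q \<gamma> V I \<eta> using restrict_frame[OF V(1,5)] .
  define \<mu> where "\<mu> b p x = inverse 5 * defect (\<lambda>a. I a p) (\<lambda>a. ext_deriv A (\<eta> a) p) (\<lambda>a. T a p) b (I b p x)"
    for b p x
  have "\<exists>C. section_of A V Q C \<and> (\<forall>p\<in>V. \<forall>x\<in>Q p. \<gamma> p (C p) x = \<mu> b p x)" for b
  proof (rule riesz[OF V(1,3)])
    fix p assume p: "p \<in> V"
    interpret C: quaternionic_contact_space "Q p" "\<lambda>a. I a p" "\<gamma> p" "\<lambda>a. ext_deriv A (\<eta> a) p"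
      using V.contact_space[OF p] .
    show "linear_on (Q p) (\<mu> b p)"
      using linear_onD[OF C.defect_linear_on]
      by (simp add: linear_on_def \<mu>_def C.I_linear algebra_simps)
  next
    fix X assume X: "section_of A V Q X"
    have "section_of A V Q (\<lambda>p. I a p (I b p (I b p (X p))))" for a
      using X by (intro V.section_I[OF V(1) order_refl])
    then show "smooth_fun A V (\<lambda>p. \<mu> b p (X p))"
      unfolding \<mu>_def defect_def mix_def
      by (intro smooth_fun_mult smooth_fun_const smooth_fun_sum smooth_fun_add atlas V(1) finite_UNIV
          smooth_fun_ext_deriv V.form TV) (auto simp: section_of_def)
  qed
  then obtain X where X: "\<And>b. section_of A V Q (X b)"
    and \<gamma>X: "\<And>b p x. p \<in> V \<Longrightarrow> x \<in> Q p \<Longrightarrow> \<gamma> p (X b p) x = \<mu> b p x"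
    by metis
  have XQ: "X b p \<in> Q p" if "p \<in> V" for b p using X[of b] that by (simp add: section_of_def)
  have "normalised_qc_frame A Q \<gamma> V I \<eta> (\<lambda>b p. T b p + X b p)"
  proof
    show "smooth_vf A V (\<lambda>p. T a p + X a p)" for a
      using X[of a] by (intro smooth_vf_add atlas V(1) TV) (simp add: section_of_def)
    fix p assume p: "p \<in> V"
    show "\<eta> a p (T b p + X b p) = (if a = b then 1 else 0)" for a b
      using linear_add[OF smooth_formD[OF V.form p]] dual[of p a b] XQ[OF p, of b] V.ker[OF p] V(4) p
      by auto
    interpret C: quaternionic_contact_space "Q p" "\<lambda>a. I a p" "\<gamma> p" "\<lambda>a. ext_deriv A (\<eta> a) p"
      using V.contact_space[OF p] .
    show "normalised (Q p) (\<lambda>a. I a p) (\<lambda>a. ext_deriv A (\<eta> a) p) (\<lambda>a. T a p + X a p)"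
      by (rule C.normalised_shift) (simp_all add: XQ[OF p] \<gamma>X[OF p] \<mu>_def)
  qed
  then show ?thesis using V by blast
qed

section \<open>The hyper CR structure of a transverse frame\<close>

context normalised_qc_frame
begin

lemma frame:
  assumes "p \<in> U"
  shows "quaternionic_frame (Q p) (\<lambda>a. I a p) (\<lambda>a. \<eta> a p) (\<lambda>a. T a p)"
proof (intro quaternionic_frame.intro quaternionic_frame_axioms.intro)
  show "quaternionic_space (Q p) (\<lambda>a. I a p)"
    using contact_space[OF assms] by (rule quaternionic_contact_space.axioms)
qed (use assms ker dual_T smooth_formD[OF form] in auto)

definition K :: "3 \<Rightarrow> 'm \<Rightarrow> 'e set" where
  "K a p = {x. \<eta> a p x = 0}"

definition J :: "3 \<Rightarrow> 'm \<Rightarrow> 'e \<Rightarrow> 'e" where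
  "J a p = quaternionic_frame.ext (\<lambda>a. I a p) (\<lambda>a. \<eta> a p) (\<lambda>a. T a p) a"

definition H :: "('m, 'e) almost_hyper_CR" where
  "H = ((K 1, J 1), (K 2, J 2))"

lemma hQ_H: "p \<in> U \<Longrightarrow> hQ H a p = K a p"
  using exhaust_3[of a] quaternionic_frame.third_space_ext[OF frame] by (auto simp: H_def K_def J_def)

lemma hcore_H:
  assumes "p \<in> U"
  shows "hcore H p = Q p"
  unfolding hcore_def hQ_H[OF assms] ker[OF assms] by (auto simp: K_def)

lemma hI_H: "p \<in> U \<Longrightarrow> x \<in> K a p \<Longrightarrow> hI H a p x = J a p x"
  using exhaust_3[of a] quaternionic_frame.third_map_ext[OF frame] by (auto simp: H_def K_def J_def)

lemma Q_subset_K: "p \<in> U \<Longrightarrow> Q p \<subseteq> K a p"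
  using ker by (auto simp: K_def)

lemma hI_H_Q: "p \<in> U \<Longrightarrow> x \<in> Q p \<Longrightarrow> hI H a p x = I a p x"
  using hI_H[of p x a] Q_subset_K[of p a] quaternionic_frame.ext_Q[OF frame, of p x a]
  by (auto simp: J_def)

text \<open>A local frame of \<open>Q\<close> together with \<open>T (a + 1)\<close> and
  \<open>T (a + 2)\<close> frames the kernel of \<open>\<eta> a\<close>.\<close>

lemma corank_subbundle_K: "corank_subbundle A U 1 (K a)"
proof -
  obtain m where m: "subbundle A UNIV m Q" "m + 3 = DIM('e)"
    using corank by (auto simp: corank_subbundle_def)
  have dimK: "subspace (K a p)" "dim (K a p) = m + 2" if p: "p \<in> U" for p
  proof -
    have l: "linear (\<eta> a p)" using smooth_formD[OF form p] .
    then show "subspace (K a p)" unfolding K_def by (rule linear_subspace_kernel)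
    \<comment> \<open>The vector representing \<open>\<eta> a p\<close> in the Euclidean inner
      product, making \<open>K a p\<close> a hyperplane of known dimension.\<close>
    define w where "w = (\<Sum>b\<in>Basis. \<eta> a p b *\<^sub>R b)"
    have w: "\<eta> a p x = w \<bullet> x" for x
      using linear_sum_Basis[OF l, of x] by (simp add: w_def inner_sum_left inner_commute[of x] mult.commute)
    moreover have "w \<noteq> 0" using w[of "T a p"] dual_T[OF p, of a a] by auto
    ultimately show "dim (K a p) = m + 2"
      using dim_hyperplane[of w] m(2) by (simp add: K_def)
  qed
  have "\<exists>V X. open V \<and> p0 \<in> V \<and> V \<subseteq> U \<and> (\<forall>i<m + 2. smooth_vf A V (X i)) \<and>
      (\<forall>q\<in>V. K a q = span ((\<lambda>i. X i q) ` {..<m + 2}))" if p0: "p0 \<in> U" for p0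
  proof -
    obtain V X where V: "open V" "p0 \<in> V" and X: "\<And>i. i < m \<Longrightarrow> smooth_vf A V (X i)"
      and span: "\<And>q. q \<in> V \<Longrightarrow> Q q = span ((\<lambda>i. X i q) ` {..<m})"
      by (rule subbundle_frame[OF m(1) UNIV_I]) blast
    define Y where "Y i = (if i < m then X i else if i = m then T (a + 1) else T (a + 2))" for i
    have "smooth_vf A (V \<inter> U) (Y i)" for i
      using smooth_vf_subset[OF X, of i "V \<inter> U"] smooth_vf_subset[OF smooth_T, of "V \<inter> U"]
      by (auto simp: Y_def)
    moreover have "K a q = span ((\<lambda>i. Y i q) ` {..<m + 2})" if q: "q \<in> V \<inter> U" for q
    proof
      interpret F: quaternionic_frame "Q q" "\<lambda>a. I a q" "\<lambda>a. \<eta> a q" "\<lambda>a. T a q"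
        using frame q by blast
      have ne: "a \<noteq> a + 1" "a \<noteq> a + 2" using exhaust_3[of a] by auto
      have X': "X i q \<in> Q q" if "i < m" for i using span q that by (auto intro: span_base)
      have "(\<lambda>i. Y i q) ` {..<m + 2} \<subseteq> K a q"
        using X' ne by (auto simp: Y_def K_def F.dual)
      then show "span ((\<lambda>i. Y i q) ` {..<m + 2}) \<subseteq> K a q"
        using dimK(1) q by (intro span_minimal) auto
      have "(\<lambda>i. X i q) ` {..<m} \<subseteq> (\<lambda>i. Y i q) ` {..<m + 2}"
        by (auto simp: Y_def image_iff Bex_def)
      then have QY: "Q q \<subseteq> span ((\<lambda>i. Y i q) ` {..<m + 2})"
        unfolding span[OF IntD1[OF q]] by (rule span_mono)
      have "T (a + 1) q = Y m q" "T (a + 2) q = Y (Suc m) q" by (simp_all add: Y_def)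
      then have TY: "T (a + 1) q \<in> span ((\<lambda>i. Y i q) ` {..<m + 2})"
        "T (a + 2) q \<in> span ((\<lambda>i. Y i q) ` {..<m + 2})"
        by (auto intro!: span_base)
      show "K a q \<subseteq> span ((\<lambda>i. Y i q) ` {..<m + 2})"
      proof
        fix x assume "x \<in> K a q"
        then have "x = F.proj x + \<eta> (a + 1) q x *\<^sub>R T (a + 1) q + \<eta> (a + 2) q x *\<^sub>R T (a + 2) q"
          using exhaust_3[of a] by (subst F.decompose[of x]) (auto simp: K_def)
        also have "\<dots> \<in> span ((\<lambda>i. Y i q) ` {..<m + 2})"
          using QY F.proj_in[of x] by (intro span_add span_scale TY) auto
        finally show "x \<in> span ((\<lambda>i. Y i q) ` {..<m + 2})" .
      qed
    qed
    ultimately show ?thesis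
      using V openU p0 by (intro exI[of _ "V \<inter> U"] exI[of _ Y]) auto
  qed
  then show ?thesis
    unfolding corank_subbundle_def subbundle_def using m(2) dimK
    by (intro exI[of _ "m + 2"]) simp
qed

text \<open>Smoothness of \<open>I a\<close> is available on sections of \<open>Q\<close> only. A
  section of \<open>K a\<close> is therefore split into its smooth \<open>Q\<close>-part
  \<open>Z\<close> and a combination of the \<open>T b\<close> with smooth coefficients.\<close>

lemma complex_structure_K: "complex_structure A U (K a) (J a)"
  unfolding complex_structure_def
proof (intro conjI ballI allI impI)
  fix p assume p: "p \<in> U"
  interpret F: quaternionic_frame "Q p" "\<lambda>a. I a p" "\<lambda>a. \<eta> a p" "\<lambda>a. T a p"
    using frame[OF p] .
  show "linear_complex_structure (K a p) (J a p)"
    by (simp add: linear_complex_structure_def linear_on_def J_def K_def F.ext_linear F.ext_ext F.\<eta>_ext)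
next
  fix V X assume "open V \<and> V \<subseteq> U \<and> section_of A V (K a) X"
  then have V: "open V" "V \<subseteq> U" and X: "smooth_vf A V X" by (auto simp: section_of_def)
  have \<eta>X: "smooth_fun A V (\<lambda>p. \<eta> b p (X p))" for b
    using smooth_fun_form_vf[OF atlas V(1) smooth_form_subset[OF form V(2)] X] .
  have TV: "smooth_vf A V (T b)" for b using smooth_vf_subset[OF smooth_T V(2)] .
  define Z where "Z p = X p - (\<Sum>b\<in>UNIV. \<eta> b p (X p) *\<^sub>R T b p)" for p
  have "section_of A V Q Z"
    unfolding section_of_def
  proof
    show "smooth_vf A V Z"
      unfolding Z_def using X
      by (intro smooth_vf_diff smooth_vf_sum smooth_vf_scaleR \<eta>X TV atlas V(1)) auto
    show "\<forall>p\<in>V. Z p \<in> Q p"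
      using quaternionic_frame.proj_in[OF frame] V(2) quaternionic_frame.proj_def[OF frame]
      by (auto simp: Z_def)
  qed
  from section_I[OF V this, of a] have IZ: "smooth_vf A V (\<lambda>p. I a p (Z p))"
    by (simp add: section_of_def)
  have "smooth_vf A V (\<lambda>p. I a p (Z p) + \<eta> (a + 1) p (X p) *\<^sub>R T (a + 2) p - \<eta> (a + 2) p (X p) *\<^sub>R T (a + 1) p)"
    by (intro smooth_vf_diff smooth_vf_add smooth_vf_scaleR \<eta>X TV atlas V(1) IZ)
  then show "smooth_vf A V (\<lambda>p. J a p (X p))"
    by (rule smooth_vf_cong[OF atlas V(1), rotated])
      (use V(2) in \<open>auto simp: J_def Z_def quaternionic_frame.ext_def[OF frame] quaternionic_frame.proj_def[OF frame]\<close>)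
qed

text \<open>Transversality holds because \<open>T 1\<close> lies in \<open>K 2\<close>. The two
  images in the anticommutation condition meet in \<open>Q\<close>, where the quaternion relations
  apply.\<close>

lemma almost_hyper_CR_structure_H: "almost_hyper_CR_structure A U H"
proof -
  have "{x + y |x y. x \<in> K 1 p \<and> y \<in> K 2 p} = UNIV"
    "\<forall>x \<in> J 1 p ` (K 1 p \<inter> K 2 p) \<inter> J 2 p ` (K 1 p \<inter> K 2 p). J 1 p (J 2 p x) = - J 2 p (J 1 p x)"
    if p: "p \<in> U" for p
  proof -
    interpret F: quaternionic_frame "Q p" "\<lambda>a. I a p" "\<lambda>a. \<eta> a p" "\<lambda>a. T a p"
      using frame[OF p] .
    have "z \<in> {x + y |x y. x \<in> K 1 p \<and> y \<in> K 2 p}" for z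
      unfolding mem_Collect_eq
      by (intro exI[of _ "z - \<eta> 1 p z *\<^sub>R T 1 p"] exI[of _ "\<eta> 1 p z *\<^sub>R T 1 p"])
        (simp add: K_def F.\<eta>_linear F.dual)
    then show "{x + y |x y. x \<in> K 1 p \<and> y \<in> K 2 p} = UNIV" by blast
    have *: "J 1 p ` (K 1 p \<inter> K 2 p) \<inter> J 2 p ` (K 1 p \<inter> K 2 p) \<subseteq> Q p"
      unfolding K_def J_def F.image_ext_1 F.image_ext_2 by (auto simp del: F.\<eta>_Q simp: F.in_Q_iff)
    show "\<forall>x \<in> J 1 p ` (K 1 p \<inter> K 2 p) \<inter> J 2 p ` (K 1 p \<inter> K 2 p).
        J 1 p (J 2 p x) = - J 2 p (J 1 p x)"
    proof
      fix x assume "x \<in> J 1 p ` (K 1 p \<inter> K 2 p) \<inter> J 2 p ` (K 1 p \<inter> K 2 p)"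
      then have "x \<in> Q p" using * by (rule subsetD[rotated])
      then show "J 1 p (J 2 p x) = - J 2 p (J 1 p x)" by (simp add: J_def)
    qed
  qed
  then show ?thesis
    unfolding H_def
    by (simp add: almost_CR_structure_def corank_subbundle_K[unfolded One_nat_def] complex_structure_K)
qed

lemma hyper_CR_structure_H: "hyper_CR_structure A U H"
  unfolding hyper_CR_structure_def Let_def
proof (intro conjI allI impI ballI almost_hyper_CR_structure_H)
  fix a X Y p
  assume "section_of A U (hcore H) X \<and> section_of A U (hcore H) Y" and p: "p \<in> U"
  then have X: "section_of A U Q X" and Y: "section_of A U Q Y"
    using hcore_H by (auto simp: section_of_def)
  define IX where "IX p = hI H a p (X p)" for p
  define IY where "IY p = hI H a p (Y p)" for p
  have sec: "section_of A U Q (\<lambda>p. hI H a p (X p))" if X: "section_of A U Q X" for X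
    using section_I[OF openU order_refl X, of a] smooth_vf_cong[OF atlas openU, of "\<lambda>p. I a p (X p)"]
      hI_H_Q X
    by (auto simp: section_of_def)
  have IX: "section_of A U Q IX" and IY: "section_of A U Q IY"
    unfolding IX_def IY_def using sec X Y by blast+
  \<comment> \<open>All \<open>\<eta> b\<close> vanish on both sections, so modulo \<open>Q\<close>
    a bracket is known from the exterior derivatives alone.\<close>
  have bracket: "\<eta> b p (lie_bracket A X Y p) = - ext_deriv A (\<eta> b) p (X p) (Y p)"
    if "section_of A U Q X" "section_of A U Q Y" for b X Y
    using that ker by (intro form_lie_bracket[OF atlas openU form]) (auto simp: section_of_def p)
  interpret F: quaternionic_frame "Q p" "\<lambda>a. I a p" "\<lambda>a. \<eta> a p" "\<lambda>a. T a p"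
    using frame[OF p] .
  interpret C: quaternionic_contact_space "Q p" "\<lambda>a. I a p" "\<gamma> p" "\<lambda>a. ext_deriv A (\<eta> a) p"
    using contact_space[OF p] .
  let ?x = "X p" and ?y = "Y p"
  have xy: "?x \<in> Q p" "?y \<in> Q p" using X Y p by (auto simp: section_of_def)
  have I: "IX p = I a p ?x" "IY p = I a p ?y"
    using hI_H_Q[OF p] xy by (auto simp: IX_def IY_def)
  have right: "\<gamma> p u (I b p v) = - \<gamma> p (I b p u) v" if "u \<in> Q p" "v \<in> Q p" for u v b
    using C.\<gamma>_I_left that by simp
  have neg: "\<gamma> p (- u) v = - \<gamma> p u v" if "u \<in> Q p" "v \<in> Q p" for u v
    using C.\<gamma>_sym[of "- u" v] C.\<gamma>_sym[of u v] C.\<gamma>_minus[of v u] that by simp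
  define Z where "Z = lie_bracket A X Y p - lie_bracket A IX IY p"
  define W where "W = J a p Z - lie_bracket A X IY p - lie_bracket A IX Y p"
  \<comment> \<open>\<open>I a I b I a\<close> is minus \<open>I a\<close> if \<open>b = a\<close>
    and \<open>I b\<close> otherwise, so this value is 0 for \<open>b = a\<close> and minus twice
    \<open>\<gamma> (I b x) y\<close> for the other two indices.\<close>
  have Z: "\<eta> b p Z = - \<gamma> p (I b p ?x) ?y - \<gamma> p (I a p (I b p (I a p ?x))) ?y" for b
    using xy by (simp add: Z_def F.\<eta>_linear bracket X Y IX IY I C.\<omega>_\<gamma> right)
  have ZK: "Z \<in> K a p"
    using Z[of a] xy by (simp add: K_def F.I_minus neg)
  have W: "\<eta> b p W = \<eta> b p (J a p Z) - \<gamma> p (I a p (I b p ?x)) ?y + \<gamma> p (I b p (I a p ?x)) ?y" for b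
    using xy by (simp add: W_def F.\<eta>_linear bracket X Y IX IY I C.\<omega>_\<gamma> right)
  \<comment> \<open>For \<open>b = a\<close> every contribution cancels. For the other two indices,
    \<open>J a\<close> exchanges the components of \<open>Z\<close> up to sign and so supplies plus
    or minus twice \<open>\<gamma> (I c x) y\<close> for the third index \<open>c\<close>, exactly
    opposite to the commutator of \<open>I a\<close> and \<open>I b\<close>.\<close>
  have "\<eta> b p W = 0" for b
    using exhaust_3[of a] exhaust_3[of b] xy ZK unfolding W J_def
    by (auto simp: Z neg F.I_minus K_def)
  then have "W \<in> Q p" using ker[OF p] by blast
  then show "lie_bracket A X Y p - lie_bracket A (\<lambda>p. hI H a p (X p)) (\<lambda>p. hI H a p (Y p)) p \<in> hQ H a p"
    "hI H a p (lie_bracket A X Y p - lie_bracket A (\<lambda>p. hI H a p (X p)) (\<lambda>p. hI H a p (Y p)) p) -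
      lie_bracket A X (\<lambda>p. hI H a p (Y p)) p - lie_bracket A (\<lambda>p. hI H a p (X p)) Y p \<in> hcore H p"
    using ZK hI_H[OF p ZK] hQ_H[OF p] hcore_H[OF p]
    by (simp_all add: Z_def W_def IX_def[abs_def] IY_def[abs_def])
qed

end

section \<open>Independence of the chosen admissible triple\<close>

context normalised_qc_frame
begin

text \<open>Provides a witness for the choice in \<open>some_triple\<close>, which otherwise would
  carry no information.\<close>

lemma admissible_triple_T: "admissible_triple A U H T"
  unfolding admissible_triple_def
proof (intro conjI allI ballI smooth_T)
  fix p assume p: "p \<in> U"
  interpret F: quaternionic_frame "Q p" "\<lambda>a. I a p" "\<lambda>a. \<eta> a p" "\<lambda>a. T a p"
    using frame[OF p] .
  have "x \<in> span (hcore H p \<union> range (\<lambda>a. T a p))" for x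
  proof -
    have "T b p \<in> span (hcore H p \<union> range (\<lambda>a. T a p))" for b by (intro span_base) auto
    moreover have "F.proj x \<in> span (hcore H p \<union> range (\<lambda>a. T a p))"
      using hcore_H[OF p] by (intro span_base) auto
    ultimately show ?thesis
      using F.decompose[of x] by (metis span_add span_scale)
  qed
  then show "span (hcore H p \<union> range (\<lambda>a. T a p)) = UNIV" by blast
  fix a :: 3
  have ne: "a + 1 \<noteq> a" "a + 2 \<noteq> a" "a \<noteq> a + 1" using exhaust_3[of a] by auto
  show "T a p \<in> hQ H (a + 1) p \<inter> hQ H (a + 2) p"
    using ne by (simp add: hQ_H[OF p] K_def F.dual)
  have "T (a + 1) p \<in> K a p" using ne by (simp add: K_def F.dual)
  then show "hI H a p (T (a + 1) p) = T (a + 2) p"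
    using hI_H[OF p] F.ext_T(2) by (simp add: J_def)
qed

text \<open>About the chosen triple only admissibility near \<open>p\<close> is known. The scalar
  \<open>t\<close> and the vector \<open>Y\<close> are the traces of the choice that enter the
  computation of \<open>hQv\<close> and \<open>hIv\<close>, and both cancel there.\<close>

lemma some_triple_H:
  assumes p: "p \<in> U"
  obtains t Y where "t \<noteq> 0" "\<And>a b. \<eta> a p (some_triple A H p b) = (if a = b then t else 0)"
    "\<And>a. J a p (some_triple A H p a) = Y"
proof -
  interpret F: quaternionic_frame "Q p" "\<lambda>a. I a p" "\<lambda>a. \<eta> a p" "\<lambda>a. T a p"
    using frame[OF p] .
  define T' where "T' = (SOME T. \<exists>V. open V \<and> p \<in> V \<and> admissible_triple A V H T)"
  have "\<exists>V. open V \<and> p \<in> V \<and> admissible_triple A V H T'"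
    unfolding T'_def by (rule someI[of _ T]) (use openU p admissible_triple_T in blast)
  then have span: "span (hcore H p \<union> range (\<lambda>a. T' a p)) = UNIV"
    and mem: "T' a p \<in> hQ H (a + 1) p \<inter> hQ H (a + 2) p" and I: "hI H a p (T' (a + 1) p) = T' (a + 2) p" for a
    unfolding admissible_triple_def by auto
  have \<eta>: "\<eta> (a + 1) p (T' a p) = 0" "\<eta> (a + 2) p (T' a p) = 0" for a
    using mem[of a] hQ_H[OF p] by (auto simp: K_def)
  have "T' (a + 1) p \<in> K a p" for a
    using \<eta>(2)[of "a + 1"] exhaust_3[of a] by (auto simp: K_def)
  then have "F.ext a (T' (a + 1) p) = T' (a + 2) p" for a
    using I[of a] hI_H[OF p] by (simp add: J_def)
  from F.admissible_frame[of "\<lambda>a. T' a p", OF \<eta> this span[unfolded hcore_H[OF p]]]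
  obtain t where "t \<noteq> 0" "\<And>a b. \<eta> a p (T' b p) = (if a = b then t else 0)"
    "\<And>a. F.ext a (T' a p) = F.ext 1 (T' 1 p)"
    by blast
  then show thesis
    by (intro that[of t "F.ext 1 (T' 1 p)"]) (simp_all add: some_triple_def T'_def[symmetric] J_def)
qed

lemma hQv_H:
  assumes p: "p \<in> U"
  shows "hQv A H v p = {x. (\<Sum>a\<in>UNIV. v $ a * \<eta> a p x) = 0}"
proof -
  interpret F: quaternionic_frame "Q p" "\<lambda>a. I a p" "\<lambda>a. \<eta> a p" "\<lambda>a. T a p"
    using frame[OF p] .
  obtain t Y where t: "t \<noteq> 0" and \<eta>: "\<And>a b. \<eta> a p (some_triple A H p b) = (if a = b then t else 0)"
    using some_triple_H[OF p] by metis
  show ?thesis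
  proof (intro equalityI subsetI)
    fix x assume "x \<in> hQv A H v p"
    then obtain q s where q: "q \<in> Q p" and s: "(\<Sum>a\<in>UNIV. s $ a * v $ a) = 0"
      and x: "x = q + (\<Sum>a\<in>UNIV. s $ a *\<^sub>R some_triple A H p a)"
      using hcore_H[OF p] by (auto simp: hQv_def)
    have "\<eta> a p x = s $ a * t" for a
      using q exhaust_3[of a] by (auto simp: x F.\<eta>_linear \<eta> sum_3)
    then have "(\<Sum>a\<in>UNIV. v $ a * \<eta> a p x) = t * (\<Sum>a\<in>UNIV. s $ a * v $ a)"
      by (simp add: sum_distrib_left mult_ac)
    then show "x \<in> {x. (\<Sum>a\<in>UNIV. v $ a * \<eta> a p x) = 0}" using s by simp
  next
    fix x assume x: "x \<in> {x. (\<Sum>a\<in>UNIV. v $ a * \<eta> a p x) = 0}"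
    define s :: "real^3" where "s = (\<chi> a. \<eta> a p x / t)"
    define q where "q = x - (\<Sum>a\<in>UNIV. s $ a *\<^sub>R some_triple A H p a)"
    have "\<eta> a p q = 0" for a
      using t exhaust_3[of a] by (auto simp: q_def F.\<eta>_linear \<eta> sum_3 s_def)
    then have "q \<in> hcore H p" using ker[OF p] hcore_H[OF p] by blast
    moreover have "(\<Sum>a\<in>UNIV. s $ a * v $ a) = 0"
    proof -
      have "(\<Sum>a\<in>UNIV. s $ a * v $ a) = (\<Sum>a\<in>UNIV. v $ a * \<eta> a p x) / t"
        by (simp add: s_def sum_divide_distrib mult.commute)
      then show ?thesis using x by simp
    qed
    ultimately show "x \<in> hQv A H v p"
      unfolding hQv_def mem_Collect_eq by (intro exI[of _ q] exI[of _ s]) (simp add: q_def)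
  qed
qed

text \<open>The extension that kills the chosen triple differs from \<open>J a\<close> by a multiple
  of \<open>Y\<close> proportional to \<open>\<eta> a p x\<close>; on \<open>hQv\<close> the
  combination of these multiples with weights \<open>v\<close> vanishes.\<close>

lemma hIv_H:
  assumes p: "p \<in> U"
  shows "hIv A H v p = restrict (\<lambda>x. \<Sum>a\<in>UNIV. v $ a *\<^sub>R J a p x) {x. (\<Sum>a\<in>UNIV. v $ a * \<eta> a p x) = 0}"
proof -
  interpret F: quaternionic_frame "Q p" "\<lambda>a. I a p" "\<lambda>a. \<eta> a p" "\<lambda>a. T a p"
    using frame[OF p] .
  obtain t Y where t: "t \<noteq> 0" and \<eta>: "\<And>a b. \<eta> a p (some_triple A H p b) = (if a = b then t else 0)"
    and Y: "\<And>a. J a p (some_triple A H p a) = Y"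
    using some_triple_H[OF p] by metis
  have lin: "J a p (x - r *\<^sub>R y) = J a p x - r *\<^sub>R J a p y" for a x y r
    by (simp add: J_def F.ext_linear)
  have ext: "hI_ext A H a p x = J a p x - (\<eta> a p x / t) *\<^sub>R Y" for a x
    unfolding hI_ext_def
  proof (rule the_equality)
    define y where "y = x - (\<eta> a p x / t) *\<^sub>R some_triple A H p a"
    have "y \<in> K a p" using t by (simp add: K_def y_def F.\<eta>_linear \<eta>)
    moreover have "J a p y = J a p x - (\<eta> a p x / t) *\<^sub>R Y" by (simp add: y_def lin Y)
    ultimately show "\<exists>y\<in>hQ H a p. \<exists>r. x = y + r *\<^sub>R some_triple A H p a \<and>
        J a p x - (\<eta> a p x / t) *\<^sub>R Y = hI H a p y"
      using hQ_H[OF p] hI_H[OF p]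
      by (intro bexI[of _ y] exI[of _ "\<eta> a p x / t"]) (auto simp: y_def)
  next
    fix w assume "\<exists>y\<in>hQ H a p. \<exists>r. x = y + r *\<^sub>R some_triple A H p a \<and> w = hI H a p y"
    then obtain y r where y: "y \<in> K a p" and x: "x = y + r *\<^sub>R some_triple A H p a" and w: "w = J a p y"
      using hQ_H[OF p] hI_H[OF p] by auto
    have "\<eta> a p x = r * t" using y by (simp add: x F.\<eta>_linear \<eta> K_def)
    moreover have "y = x - r *\<^sub>R some_triple A H p a" using x by simp
    ultimately show "w = J a p x - (\<eta> a p x / t) *\<^sub>R Y"
      using t lin[of a x r "some_triple A H p a"] Y by (simp add: w)
  qed
  have "(\<Sum>a\<in>UNIV. v $ a *\<^sub>R hI_ext A H a p x) = (\<Sum>a\<in>UNIV. v $ a *\<^sub>R J a p x)"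
    if "(\<Sum>a\<in>UNIV. v $ a * \<eta> a p x) = 0" for x
  proof -
    have "(\<Sum>a\<in>UNIV. v $ a *\<^sub>R hI_ext A H a p x) =
        (\<Sum>a\<in>UNIV. v $ a *\<^sub>R J a p x) - ((\<Sum>a\<in>UNIV. v $ a * \<eta> a p x) / t) *\<^sub>R Y"
      by (simp add: ext scaleR_diff_right sum_subtractf sum_divide_distrib scaleR_sum_left)
    then show ?thesis using that by simp
  qed
  then show ?thesis
    unfolding hIv_def hQv_H[OF p] by (intro restrict_ext) simp
qed

end

section \<open>Change of frame\<close>

text \<open>Products of the \<open>I' a\<close> are expanded in \<open>x\<close>,
  \<open>I 1 x\<close>, \<open>I 2 x\<close>, \<open>I 3 x\<close> and compared with the quaternion
  relations. Independence of these four vectors at a single nonzero \<open>x\<close> gives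
  orthonormal rows and the cross product rule.\<close>

lemma quaternionic_rotation:
  fixes S :: "3 \<Rightarrow> 3 \<Rightarrow> real"
  assumes "quaternionic_space Q I" "quaternionic_space Q I'" and x: "x \<in> Q" "x \<noteq> 0"
    and I': "\<And>a x. x \<in> Q \<Longrightarrow> I' a x = (\<Sum>b\<in>UNIV. S a b *\<^sub>R I b x)"
  shows "(\<Sum>c\<in>UNIV. S a c * S b c) = (if a = b then 1 else 0)"
    and "S (a + 2) 1 = S a 2 * S (a + 1) 3 - S a 3 * S (a + 1) 2"
    and "S (a + 2) 2 = S a 3 * S (a + 1) 1 - S a 1 * S (a + 1) 3"
    and "S (a + 2) 3 = S a 1 * S (a + 1) 2 - S a 2 * S (a + 1) 1"
proof -
  interpret quaternionic_space Q I by fact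
  interpret Q': quaternionic_space Q I' by fact
  have mult: "I' a (I' b x) = (- (\<Sum>c\<in>UNIV. S a c * S b c)) *\<^sub>R x
    + ((S a 2 * S b 3 - S a 3 * S b 2) *\<^sub>R I 1 x + (S a 3 * S b 1 - S a 1 * S b 3) *\<^sub>R I 2 x
       + (S a 1 * S b 2 - S a 2 * S b 1) *\<^sub>R I 3 x)" for a b
    unfolding I'[OF x(1)] I'[OF Q'.I_in[OF x(1)]] using x by (simp add: sum_3 I_linear algebra_simps I')
  have "1 - (\<Sum>c\<in>UNIV. S a c * S a c) = 0" for a
  proof (rule I_independent(1)[OF x, where t="\<lambda>_. 0"])
    show "(1 - (\<Sum>c\<in>UNIV. S a c * S a c)) *\<^sub>R x + (\<Sum>a\<in>UNIV. 0 *\<^sub>R I a x) = 0"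
      using mult[of a a] x(1) by (simp add: algebra_simps mult.commute)
  qed
  then have norm: "(\<Sum>c\<in>UNIV. S a c * S a c) = 1" for a by (simp add: algebra_simps)
  \<comment> \<open>The coefficient of \<open>I d x\<close> in
    \<open>I' a (I' (a + 1) x) - I' (a + 2) x\<close>.\<close>
  define t where "t a d = (if d = (1::3) then S a 2 * S (a + 1) 3 - S a 3 * S (a + 1) 2 - S (a + 2) 1
     else if d = 2 then S a 3 * S (a + 1) 1 - S a 1 * S (a + 1) 3 - S (a + 2) 2
     else S a 1 * S (a + 1) 2 - S a 2 * S (a + 1) 1 - S (a + 2) 3)" for a d
  have zero: "(- (\<Sum>c\<in>UNIV. S a c * S (a + 1) c)) *\<^sub>R x + (\<Sum>d\<in>UNIV. t a d *\<^sub>R I d x) = 0" for a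
    using mult[of a "a + 1"] Q'.I_cyclic(1)[OF x(1), of a] I'[OF x(1), of "a + 2"]
    by (simp add: sum_3 t_def algebra_simps)
  have orth: "(\<Sum>c\<in>UNIV. S a c * S (a + 1) c) = 0" for a
    using I_independent(1)[OF x zero[of a]] by simp
  have "t a d = 0" for d using I_independent(2)[OF x zero[of a]] .
  from this[of 1] this[of 2] this[of 3]
  show "S (a + 2) 1 = S a 2 * S (a + 1) 3 - S a 3 * S (a + 1) 2"
    "S (a + 2) 2 = S a 3 * S (a + 1) 1 - S a 1 * S (a + 1) 3"
    "S (a + 2) 3 = S a 1 * S (a + 1) 2 - S a 2 * S (a + 1) 1"
    by (simp_all add: t_def)
  show "(\<Sum>c\<in>UNIV. S a c * S b c) = (if a = b then 1 else 0)"
    using orth[of 1] orth[of 2] orth[of 3] norm[of a] exhaust_3[of a] exhaust_3[of b]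
    by (auto simp: sum_3 mult.commute)
qed

text \<open>The third row is the cross product of the first two, so the determinant is its squared
  length, 1. The transpose appears because rewriting the combination of the \<open>I' a\<close> with
  weights \<open>v\<close> in terms of the \<open>I b\<close> applies the transpose of
  \<open>S\<close> to \<open>v\<close>.\<close>

lemma rotation_matrix_of_cross:
  fixes S :: "3 \<Rightarrow> 3 \<Rightarrow> real"
  assumes orth: "\<And>a b. (\<Sum>c\<in>UNIV. S a c * S b c) = (if a = b then 1 else 0)"
    and cross: "S 3 1 = S 1 2 * S 2 3 - S 1 3 * S 2 2" "S 3 2 = S 1 3 * S 2 1 - S 1 1 * S 2 3"
      "S 3 3 = S 1 1 * S 2 2 - S 1 2 * S 2 1"
  shows "rotation_matrix (\<chi> a b. S b a)" "(\<Sum>c\<in>UNIV. S c a * S c b) = (if a = b then 1 else 0)"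
proof -
  let ?M = "(\<chi> a b. S b a) :: real^3^3"
  have "transpose ?M ** ?M = mat 1"
    using orth by (simp add: matrix_matrix_mult_def transpose_def vec_eq_iff mat_def)
  moreover from this have M: "?M ** transpose ?M = mat 1" by (simp add: matrix_left_right_inverse)
  ultimately have "orthogonal_matrix ?M" by (simp add: orthogonal_matrix_def)
  moreover have "det ?M = (\<Sum>c\<in>UNIV. S 3 c * S 3 c)"
    unfolding cross det_3 sum_3 by (simp add: algebra_simps cross)
  ultimately show "rotation_matrix ?M" using orth by (simp add: rotation_matrix_def)
  have "(?M ** transpose ?M) $ a $ b = (if a = b then 1 else 0)" unfolding M by (simp add: mat_def)
  then show "(\<Sum>c\<in>UNIV. S c a * S c b) = (if a = b then 1 else 0)"
    by (simp add: matrix_matrix_mult_def transpose_def)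
qed

lemma dir_deriv_cong:
  assumes "smooth_atlas A" "open W" "p \<in> W" "\<And>q. q \<in> W \<Longrightarrow> f q = g q"
  shows "dir_deriv A f p = dir_deriv A g p"
proof -
  note c = chart_at[OF assms(1), of p]
  note ic = smooth_atlasD(1)[OF assms(1) c(1)]
  have "frechet_derivative (f \<circ> chart_inv (chart_at A p)) (at (snd (chart_at A p) p)) =
    frechet_derivative (g \<circ> chart_inv (chart_at A p)) (at (snd (chart_at A p) p))"
    using assms(3,4) c chart_inv_mem[OF ic]
    by (intro frechet_derivative_cong_on[OF open_chart_image[OF ic assms(2)]]) auto
  then show ?thesis by (simp add: dir_deriv_def[abs_def])
qed

lemma linear_dir_deriv:
  "smooth_atlas A \<Longrightarrow> smooth_fun A W f \<Longrightarrow> p \<in> W \<Longrightarrow> linear (dir_deriv A f p)"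
  using has_derivative_linear[OF smooth_fun_has_derivative] .

lemma dir_deriv_const: "dir_deriv A (\<lambda>q. r) p v = 0"
  by (simp add: dir_deriv_def o_def)

lemma dir_deriv_sum_mult:
  assumes A: "smooth_atlas A" and p: "p \<in> W"
    and g: "\<And>c. smooth_fun A W (g c)" and h: "\<And>c. smooth_fun A W (h c)"
  shows "dir_deriv A (\<lambda>q. \<Sum>c\<in>(UNIV::'i::finite set). g c q * h c q) p v =
    (\<Sum>c\<in>UNIV. dir_deriv A (g c) p v * h c p + g c p * dir_deriv A (h c) p v)"
proof -
  note c = chart_at[OF A, of p]
  have inv: "chart_inv (chart_at A p) (snd (chart_at A p) p) = p"
    using chart_inv_left smooth_atlasD(1)[OF A] c by blast
  have "((\<lambda>x. \<Sum>c\<in>UNIV. (g c \<circ> chart_inv (chart_at A p)) x * (h c \<circ> chart_inv (chart_at A p)) x) has_derivative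
    (\<lambda>v. \<Sum>c\<in>UNIV. (g c \<circ> chart_inv (chart_at A p)) (snd (chart_at A p) p) * dir_deriv A (h c) p v
      + dir_deriv A (g c) p v * (h c \<circ> chart_inv (chart_at A p)) (snd (chart_at A p) p)))
    (at (snd (chart_at A p) p))"
    by (intro has_derivative_sum has_derivative_mult smooth_fun_has_derivative[OF A g p]
        smooth_fun_has_derivative[OF A h p])
  from frechet_derivative_eq[OF this] show ?thesis
    unfolding dir_deriv_def[of A "\<lambda>q. \<Sum>c\<in>UNIV. g c q * h c q"]
    by (simp add: o_def inv add.commute)
qed

text \<open>Transporting \<open>T\<close> by the rotation and the conformal factor gives a frame
  that is dual to \<open>\<eta>'\<close> and normalised for the primed data. So is
  \<open>T'\<close>; by uniqueness they differ by a harmless shift, and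
  \<open>ext_frame_change\<close> identifies the structures.\<close>

lemma normalised_frames_overlap:
  fixes A :: "('m::topological_space, 'e::euclidean_space) chart set"
  assumes "normalised_qc_frame A Q \<gamma> U I \<eta> T" "normalised_qc_frame A Q \<gamma>' U' I' \<eta>' T'"
    and f: "smooth_fun A (U \<inter> U') f" and f_pos: "\<And>p. f p > 0"
    and \<gamma>': "\<And>p x y. x \<in> Q p \<Longrightarrow> y \<in> Q p \<Longrightarrow> \<gamma>' p x y = f p * \<gamma> p x y"
    and Q_nontrivial: "\<And>p. \<exists>x\<in>Q p. x \<noteq> 0"
  shows "\<exists>S :: 'm \<Rightarrow> real^3^3. (\<forall>a b. smooth_fun A (U \<inter> U') (\<lambda>p. S p $ a $ b)) \<and>
    (\<forall>p\<in>U \<inter> U'. rotation_matrix (S p) \<and>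
      (\<forall>v. hQv A (normalised_qc_frame.H I' \<eta>' T') v p = hQv A (normalised_qc_frame.H I \<eta> T) (S p *v v) p \<and>
           hIv A (normalised_qc_frame.H I' \<eta>' T') v p = hIv A (normalised_qc_frame.H I \<eta> T) (S p *v v) p))"
proof -
  interpret L: normalised_qc_frame A Q \<gamma> U I \<eta> T by fact
  interpret L': normalised_qc_frame A Q \<gamma>' U' I' \<eta>' T' by fact
  define W where "W = U \<inter> U'"
  have W: "open W" "W \<subseteq> U" "W \<subseteq> U'" using L.openU L'.openU by (auto simp: W_def)
  \<comment> \<open>The coefficients of \<open>\<eta>'\<close> in terms of \<open>\<eta>\<close>:
    both triples vanish on \<open>Q\<close>, so evaluating on the dual frame determines
    them.\<close>
  define B where "B a b p = \<eta>' a p (T b p)" for a b p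
  have smB: "smooth_fun A W (B a b)" for a b
    unfolding B_def
    using smooth_fun_form_vf[OF L.atlas W(1) smooth_form_subset[OF L'.form W(3)] smooth_vf_subset[OF L.smooth_T W(2)]] .
  define S where "S p a b = B a b p / f p" for p a b
  have fB: "B a b p = f p * S p a b" for p a b using f_pos[of p] by (simp add: S_def)
  have f_nz: "f p \<noteq> 0" for p using f_pos[of p] by simp
  have smS: "smooth_fun A W (\<lambda>p. S p a b)" for a b
    unfolding S_def using f smB f_nz by (intro smooth_fun_divide L.atlas W(1)) (auto simp: W_def)
  have \<eta>': "\<eta>' a p v = (\<Sum>b\<in>UNIV. B a b p * \<eta> b p v)" if "p \<in> W" for a p v
  proof -
    interpret F: quaternionic_frame "Q p" "\<lambda>a. I a p" "\<lambda>a. \<eta> a p" "\<lambda>a. T a p"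
      using L.frame that W by blast
    have "linear (\<eta>' a p)" using smooth_formD[OF L'.form] that W by blast
    moreover have "\<eta>' a p (F.proj v) = 0" using L'.ker[of p] F.proj_in[of v] that W by blast
    ultimately show ?thesis
      by (subst F.decompose[of v]) (simp add: linear_add linear_cmul B_def sum_3)
  qed
  define D where "D p a b v = dir_deriv A (B a b) p v" for p a b v
  have d\<eta>': "ext_deriv A (\<eta>' a) p v w = (\<Sum>c\<in>UNIV. f p * S p a c * ext_deriv A (\<eta> c) p v w
      + D p a c v * \<eta> c p w - D p a c w * \<eta> c p v)" if "p \<in> W" for a p v w
    using ext_deriv_mult_sum[OF L.atlas W(1) smooth_form_subset[OF L.form W(2)] smB \<eta>' that, of a v w]
    by (simp add: D_def fB[symmetric])
  \<comment> \<open>On \<open>Q\<close> the terms with derivatives of \<open>B\<close> vanish, so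
    \<open>d\<eta>'\<close> is the \<open>B\<close>-combination of the \<open>d\<eta>\<close>. With
    \<open>\<gamma>' = f \<gamma>\<close> this says that the \<open>I' a\<close> are combinations of
    the \<open>I b\<close> with coefficients \<open>B / f = S\<close>.\<close>
  have I': "I' a p x = (\<Sum>b\<in>UNIV. S p a b *\<^sub>R I b p x)" if p: "p \<in> W" and x: "x \<in> Q p" for a p x
  proof -
    have pU: "p \<in> U" "p \<in> U'" using p W by auto
    interpret C: quaternionic_contact_space "Q p" "\<lambda>a. I a p" "\<gamma> p" "\<lambda>a. ext_deriv A (\<eta> a) p"
      using L.contact_space[OF pU(1)] .
    interpret C': quaternionic_contact_space "Q p" "\<lambda>a. I' a p" "\<gamma>' p" "\<lambda>a. ext_deriv A (\<eta>' a) p"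
      using L'.contact_space[OF pU(2)] .
    have sumQ: "(\<Sum>b\<in>UNIV. S p a b *\<^sub>R I b p x) \<in> Q p" using x by (intro C.Q_sum) simp
    show ?thesis
    proof (rule C.\<gamma>_eqI)
      fix y assume y: "y \<in> Q p"
      have "f p * \<gamma> p (I' a p x) y = ext_deriv A (\<eta>' a) p x y"
        using x y by (simp add: \<gamma>' C'.\<omega>_\<gamma>)
      also have "\<dots> = (\<Sum>c\<in>UNIV. f p * S p a c * \<gamma> p (I c p x) y)"
        using x y L.ker[OF pU(1)] unfolding d\<eta>'[OF p] by (simp add: C.\<omega>_\<gamma>)
      also have "\<dots> = f p * \<gamma> p y (\<Sum>b\<in>UNIV. S p a b *\<^sub>R I b p x)"
        using x y linear_on_sum[OF C.\<gamma>_linear[OF y] C.subspace_Q, of UNIV "\<lambda>b. I b p x" "S p a"]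
        by (simp add: sum_distrib_left mult.assoc C.\<gamma>_sym[of _ y])
      finally show "\<gamma> p (I' a p x) y = \<gamma> p (\<Sum>b\<in>UNIV. S p a b *\<^sub>R I b p x) y"
        using f_nz[of p] C.\<gamma>_sym[OF sumQ y] by simp
    qed (use x sumQ in auto)
  qed
  have rot: "(\<Sum>c\<in>UNIV. S p a c * S p b c) = (if a = b then 1 else 0)"
    "S p (a + 2) 1 = S p a 2 * S p (a + 1) 3 - S p a 3 * S p (a + 1) 2"
    "S p (a + 2) 2 = S p a 3 * S p (a + 1) 1 - S p a 1 * S p (a + 1) 3"
    "S p (a + 2) 3 = S p a 1 * S p (a + 1) 2 - S p a 2 * S p (a + 1) 1" if p: "p \<in> W" for p a b
  proof -
    obtain x where x: "x \<in> Q p" "x \<noteq> 0" using Q_nontrivial by blast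
    have q: "quaternionic_space (Q p) (\<lambda>a. I a p)" "quaternionic_space (Q p) (\<lambda>a. I' a p)"
      using L.contact_space[of p] L'.contact_space[of p] p W quaternionic_contact_space.axioms(1) by blast+
    note r = quaternionic_rotation[OF q x I'[OF p]]
    show "(\<Sum>c\<in>UNIV. S p a c * S p b c) = (if a = b then 1 else 0)"
      "S p (a + 2) 1 = S p a 2 * S p (a + 1) 3 - S p a 3 * S p (a + 1) 2"
      "S p (a + 2) 2 = S p a 3 * S p (a + 1) 1 - S p a 1 * S p (a + 1) 3"
      "S p (a + 2) 3 = S p a 1 * S p (a + 1) 2 - S p a 2 * S p (a + 1) 1"
      using r(1)[of a b] r(2-4)[of a] by auto
  qed
  have rotM: "rotation_matrix (\<chi> a b. S p b a)" "(\<Sum>c\<in>UNIV. S p c a * S p c b) = (if a = b then 1 else 0)"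
    if p: "p \<in> W" for p a b
    using rotation_matrix_of_cross[OF rot(1)[OF p]] rot(2-4)[OF p, of 1] by auto
  \<comment> \<open>Derivative of the identity \<open>B B^T = f^2\<close> times the unit matrix,
    which holds on the whole open set \<open>W\<close>.\<close>
  have D: "(\<Sum>c\<in>UNIV. D p a c v * (f p * S p b c) + f p * S p a c * D p b c v) =
      (if a = b then dir_deriv A (\<lambda>q. f q * f q) p v else 0)" if p: "p \<in> W" for p a b v
  proof -
    have "dir_deriv A (\<lambda>q. \<Sum>c\<in>UNIV. B a c q * B b c q) p =
        dir_deriv A (\<lambda>q. if a = b then f q * f q else 0) p"
    proof (rule dir_deriv_cong[OF L.atlas W(1) p])
      fix q assume q: "q \<in> W"
      have "(\<Sum>c\<in>UNIV. B a c q * B b c q) = f q * f q * (\<Sum>c\<in>UNIV. S q a c * S q b c)"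
        by (simp add: fB sum_distrib_left mult_ac)
      then show "(\<Sum>c\<in>UNIV. B a c q * B b c q) = (if a = b then f q * f q else 0)"
        using rot(1)[OF q, of a b] by simp
    qed
    moreover have "dir_deriv A (\<lambda>q. \<Sum>c\<in>UNIV. B a c q * B b c q) p v =
      (\<Sum>c\<in>UNIV. D p a c v * (f p * S p b c) + f p * S p a c * D p b c v)"
      using dir_deriv_sum_mult[OF L.atlas p, of "B a" "B b" v] smB by (simp add: D_def fB[symmetric])
    ultimately show ?thesis by (auto simp: dir_deriv_const)
  qed
  have smf2: "smooth_fun A W (\<lambda>q. f q * f q)"
    using f by (intro smooth_fun_mult L.atlas W(1)) (auto simp: W_def)
  have ext: "(\<Sum>a\<in>UNIV. v a *\<^sub>R L'.J a p x) = (\<Sum>b\<in>UNIV. (\<Sum>a\<in>UNIV. v a * S p a b) *\<^sub>R L.J b p x)"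
    if p: "p \<in> W" and 0: "(\<Sum>a\<in>UNIV. v a * \<eta>' a p x) = 0" for v p x
  proof -
    have pU: "p \<in> U" "p \<in> U'" using p W by auto
    note F = L.frame[OF pU(1)] and F' = L'.frame[OF pU(2)]
    interpret F: quaternionic_frame "Q p" "\<lambda>a. I a p" "\<lambda>a. \<eta> a p" "\<lambda>a. T a p" by (rule F)
    interpret F': quaternionic_frame "Q p" "\<lambda>a. I' a p" "\<lambda>a. \<eta>' a p" "\<lambda>a. T' a p" by (rule F')
    interpret C': quaternionic_contact_space "Q p" "\<lambda>a. I' a p" "\<gamma>' p" "\<lambda>a. ext_deriv A (\<eta>' a) p"
      using L'.contact_space[OF pU(2)] .
    \<comment> \<open>The frame dual to \<open>\<eta>'\<close> obtained from \<open>T\<close> alone: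
      \<open>f S\<close> has inverse transpose \<open>S / f\<close>.\<close>
    define T0 where "T0 b = inverse (f p) *\<^sub>R (\<Sum>c\<in>UNIV. S p b c *\<^sub>R T c p)" for b
    have norm0: "normalised (Q p) (\<lambda>a. I' a p) (\<lambda>a. ext_deriv A (\<eta>' a) p) T0"
      unfolding T0_def
    proof (rule normalised_frame_change[OF L.contact_space[OF pU(1)] F F'.quaternionic_space_axioms
          I'[OF p] rotM(2)[OF p] f_nz d\<eta>'[OF p] D[OF p] _ L.normalised_T[OF pU(1)]])
      show "dir_deriv A (\<lambda>q. f q * f q) p (- x) = - dir_deriv A (\<lambda>q. f q * f q) p x" for x
        using linear_neg[OF linear_dir_deriv[OF L.atlas smf2 p]] .
    qed
    define X where "X b = T' b p - T0 b" for b
    have \<eta>T0: "\<eta>' a p (T0 b) = (if a = b then 1 else 0)" for a b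
    proof -
      have "\<eta>' a p (T0 b) = inverse (f p) * (\<Sum>c\<in>UNIV. S p b c * (f p * S p a c))"
        by (simp add: T0_def F'.\<eta>_linear B_def[symmetric] fB)
      also have "\<dots> = (\<Sum>c\<in>UNIV. S p a c * S p b c)"
        using f_nz[of p] by (simp add: sum_3 field_simps)
      finally have "\<eta>' a p (T0 b) = (\<Sum>c\<in>UNIV. S p a c * S p b c)" .
      then show ?thesis using rot(1)[OF p] by simp
    qed
    have XQ: "X b \<in> Q p" for b
    proof -
      have "\<forall>a. \<eta>' a p (X b) = 0" by (simp add: X_def F'.\<eta>_linear F'.dual \<eta>T0)
      then show ?thesis using L'.ker[OF pU(2)] by blast
    qed
    have T'X: "T' b p = T0 b + X b" for b by (simp add: X_def)
    have IX: "I' b p (X b) = I' 1 p (X 1)" for b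
      using C'.normalised_unique[of X, OF XQ norm0] L'.normalised_T[OF pU(2)] unfolding T'X by blast
    show ?thesis
      unfolding L.J_def L'.J_def
      by (rule ext_frame_change[OF F F' I'[OF p] rot(2-4)[OF p] T'X[unfolded T0_def] XQ IX 0])
  qed
  have sumS: "((\<chi> a b. S p b a) *v v) $ b = (\<Sum>a\<in>UNIV. v $ a * S p a b)" for p v b
    by (simp add: matrix_vector_mult_def mult.commute)
  have set_eq: "(\<Sum>a\<in>UNIV. v $ a * \<eta>' a p x) = f p * (\<Sum>b\<in>UNIV. (\<Sum>a\<in>UNIV. v $ a * S p a b) * \<eta> b p x)"
    if "p \<in> W" for v p x
    unfolding \<eta>'[OF that] fB by (simp add: sum_3 algebra_simps)
  show ?thesis
    unfolding W_def[symmetric]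
  \<comment> \<open>The transpose of \<open>S\<close>, as it acts on the parameter \<open>v\<close>
    and not on the complex structures.\<close>
  proof (intro exI[of _ "\<lambda>p. \<chi> a b. S p b a"] conjI allI ballI)
    show "smooth_fun A W (\<lambda>p. (\<chi> a b. S p b a) $ a $ b)" for a b using smS by simp
    fix p assume p: "p \<in> W"
    then have pU: "p \<in> U" "p \<in> U'" using W by auto
    show "rotation_matrix (\<chi> a b. S p b a)" using rotM(1)[OF p] .
    fix v :: "real^3"
    show "hQv A L'.H v p = hQv A L.H ((\<chi> a b. S p b a) *v v) p"
      unfolding L.hQv_H[OF pU(1)] L'.hQv_H[OF pU(2)] sumS set_eq[OF p] using f_nz[of p] by simp
    show "hIv A L'.H v p = hIv A L.H ((\<chi> a b. S p b a) *v v) p"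
      unfolding L.hIv_H[OF pU(1)] L'.hIv_H[OF pU(2)] sumS
      using f_nz[of p] ext[OF p, of "\<lambda>a. v $ a"] set_eq[OF p, of v]
      by (simp add: restrict_def fun_eq_iff)
  qed
qed

section \<open>The quaternionic CR structure of a quaternionic contact structure\<close>

lemma sphere_comb_axis:
  "x \<in> V \<Longrightarrow> sphere_comb V J (axis a 1) x = J a x"
  using exhaust_3[of a] by (auto simp: sphere_comb_def sum_3 axis_def)

lemma conformal_class_ratio:
  assumes "smooth_atlas A" "conformal_class A Q G" "\<gamma> \<in> G" "\<gamma>' \<in> G"
  obtains f where "smooth_fun A UNIV f" "\<And>p. f p > 0"
    "\<And>p x y. x \<in> Q p \<Longrightarrow> y \<in> Q p \<Longrightarrow> \<gamma>' p x y = f p * \<gamma> p x y"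
proof -
  obtain \<gamma>0 where G: "G = {\<gamma>. bundle_metric A Q \<gamma> \<and> (\<exists>f. smooth_fun A UNIV f \<and> (\<forall>p. f p > 0) \<and>
            (\<forall>p. \<forall>x\<in>Q p. \<forall>y\<in>Q p. \<gamma> p x y = f p * \<gamma>0 p x y))}"
    using assms(2) by (auto simp: conformal_class_def)
  obtain g where g: "smooth_fun A UNIV g" "\<forall>p. g p > 0"
    "\<forall>p. \<forall>x\<in>Q p. \<forall>y\<in>Q p. \<gamma> p x y = g p * \<gamma>0 p x y"
    using assms(3) unfolding G by blast
  obtain g' where g': "smooth_fun A UNIV g'" "\<forall>p. g' p > 0"
    "\<forall>p. \<forall>x\<in>Q p. \<forall>y\<in>Q p. \<gamma>' p x y = g' p * \<gamma>0 p x y"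
    using assms(4) unfolding G by blast
  have nz: "g p \<noteq> 0" for p using g(2) by (metis less_irrefl)
  show thesis
  proof (rule that[of "\<lambda>p. g' p / g p"])
    show "smooth_fun A UNIV (\<lambda>p. g' p / g p)"
      using nz by (intro smooth_fun_divide assms(1) open_UNIV g(1) g'(1)) auto
  qed (use g(2,3) g'(2,3) nz in simp_all)
qed

lemma qc_structureE:
  assumes "qc_structure A Q G \<I>"
  obtains U I \<eta> \<gamma> where "\<gamma> \<in> G" "open U" "z \<in> U"
    "\<And>a::3. complex_structure A U Q (I a)" "\<And>a. smooth_form A U (\<eta> a)"
    "\<And>p x. p \<in> U \<Longrightarrow> x \<in> Q p \<Longrightarrow> I 1 p (I 2 p x) = I 3 p x"
    "\<And>p x. p \<in> U \<Longrightarrow> x \<in> Q p \<Longrightarrow> - I 2 p (I 1 p x) = I 3 p x"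
    "\<And>p. p \<in> U \<Longrightarrow> \<I> p = sphere_comb (Q p) (\<lambda>a. I a p) ` sphere 0 1"
    "\<And>p. p \<in> U \<Longrightarrow> inj_on (sphere_comb (Q p) (\<lambda>a. I a p)) (sphere 0 1)"
    "\<And>p. p \<in> U \<Longrightarrow> Q p = {x. \<forall>a. \<eta> a p x = 0}"
    "\<And>p a x y. p \<in> U \<Longrightarrow> x \<in> Q p \<Longrightarrow> y \<in> Q p \<Longrightarrow> \<gamma> p (I a p x) y = ext_deriv A (\<eta> a) p x y"
proof -
  have "\<exists>U I \<eta>. \<exists>\<gamma>\<in>G. open U \<and> z \<in> U \<and>
        (\<forall>a::3. complex_structure A U Q (I a) \<and> smooth_form A U (\<eta> a)) \<and>
        (\<forall>p\<in>U.
           (\<forall>x\<in>Q p. I 1 p (I 2 p x) = I 3 p x \<and> - I 2 p (I 1 p x) = I 3 p x) \<and>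
           \<I> p = sphere_comb (Q p) (\<lambda>a. I a p) ` sphere 0 1 \<and>
           inj_on (sphere_comb (Q p) (\<lambda>a. I a p)) (sphere 0 1) \<and>
           Q p = {x. \<forall>a. \<eta> a p x = 0} \<and>
           (\<forall>a. \<forall>x\<in>Q p. \<forall>y\<in>Q p. \<gamma> p (I a p x) y = ext_deriv A (\<eta> a) p x y))"
    using assms unfolding qc_structure_def by (elim conjE) (erule spec)
  then obtain U where "\<exists>I \<eta>. \<exists>\<gamma>\<in>G. open U \<and> z \<in> U \<and>
        (\<forall>a::3. complex_structure A U Q (I a) \<and> smooth_form A U (\<eta> a)) \<and>
        (\<forall>p\<in>U.
           (\<forall>x\<in>Q p. I 1 p (I 2 p x) = I 3 p x \<and> - I 2 p (I 1 p x) = I 3 p x) \<and>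
           \<I> p = sphere_comb (Q p) (\<lambda>a. I a p) ` sphere 0 1 \<and>
           inj_on (sphere_comb (Q p) (\<lambda>a. I a p)) (sphere 0 1) \<and>
           Q p = {x. \<forall>a. \<eta> a p x = 0} \<and>
           (\<forall>a. \<forall>x\<in>Q p. \<forall>y\<in>Q p. \<gamma> p (I a p x) y = ext_deriv A (\<eta> a) p x y))" ..
  then obtain I where "\<exists>\<eta>. \<exists>\<gamma>\<in>G. open U \<and> z \<in> U \<and>
        (\<forall>a::3. complex_structure A U Q (I a) \<and> smooth_form A U (\<eta> a)) \<and>
        (\<forall>p\<in>U.
           (\<forall>x\<in>Q p. I 1 p (I 2 p x) = I 3 p x \<and> - I 2 p (I 1 p x) = I 3 p x) \<and>
           \<I> p = sphere_comb (Q p) (\<lambda>a. I a p) ` sphere 0 1 \<and>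
           inj_on (sphere_comb (Q p) (\<lambda>a. I a p)) (sphere 0 1) \<and>
           Q p = {x. \<forall>a. \<eta> a p x = 0} \<and>
           (\<forall>a. \<forall>x\<in>Q p. \<forall>y\<in>Q p. \<gamma> p (I a p x) y = ext_deriv A (\<eta> a) p x y))" ..
  then obtain \<eta> where "\<exists>\<gamma>\<in>G. open U \<and> z \<in> U \<and>
        (\<forall>a::3. complex_structure A U Q (I a) \<and> smooth_form A U (\<eta> a)) \<and>
        (\<forall>p\<in>U.
           (\<forall>x\<in>Q p. I 1 p (I 2 p x) = I 3 p x \<and> - I 2 p (I 1 p x) = I 3 p x) \<and>
           \<I> p = sphere_comb (Q p) (\<lambda>a. I a p) ` sphere 0 1 \<and>
           inj_on (sphere_comb (Q p) (\<lambda>a. I a p)) (sphere 0 1) \<and>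
           Q p = {x. \<forall>a. \<eta> a p x = 0} \<and>
           (\<forall>a. \<forall>x\<in>Q p. \<forall>y\<in>Q p. \<gamma> p (I a p x) y = ext_deriv A (\<eta> a) p x y))" ..
  then obtain \<gamma> where \<gamma>: "\<gamma> \<in> G" and *: "open U \<and> z \<in> U \<and>
        (\<forall>a::3. complex_structure A U Q (I a) \<and> smooth_form A U (\<eta> a)) \<and>
        (\<forall>p\<in>U.
           (\<forall>x\<in>Q p. I 1 p (I 2 p x) = I 3 p x \<and> - I 2 p (I 1 p x) = I 3 p x) \<and>
           \<I> p = sphere_comb (Q p) (\<lambda>a. I a p) ` sphere 0 1 \<and>
           inj_on (sphere_comb (Q p) (\<lambda>a. I a p)) (sphere 0 1) \<and>
           Q p = {x. \<forall>a. \<eta> a p x = 0} \<and>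
           (\<forall>a. \<forall>x\<in>Q p. \<forall>y\<in>Q p. \<gamma> p (I a p x) y = ext_deriv A (\<eta> a) p x y))" ..
  note pt = *[THEN conjunct2, THEN conjunct2, THEN conjunct2, rule_format]
  show thesis
    by (rule that[of \<gamma> U I \<eta>]) (use \<gamma> * pt in \<open>simp_all del: mem_sphere\<close>)
qed

text \<open>Were \<open>Q p\<close> zero, the antipodal parameters \<open>v\<close> and
  \<open>- v\<close> would give the same map, against injectivity on the sphere. The nonzero vector
  is what the comparison of quaternion coefficients needs.\<close>

lemma qc_structure_nontrivial:
  assumes "qc_structure A Q G \<I>"
  shows "\<exists>x\<in>Q p. x \<noteq> 0"
proof (rule qc_structureE[OF assms, where z=p])
  fix U and I :: "3 \<Rightarrow> _" assume p: "p \<in> U" and cs: "\<And>a::3. complex_structure A U Q (I a)"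
    and inj: "\<And>p. p \<in> U \<Longrightarrow> inj_on (sphere_comb (Q p) (\<lambda>a. I a p)) (sphere 0 1)"
  show ?thesis
  proof (rule ccontr)
    assume "\<not> (\<exists>x\<in>Q p. x \<noteq> 0)"
    then have Q0: "x = 0" if "x \<in> Q p" for x using that by blast
    have "sphere_comb (Q p) (\<lambda>a. I a p) v = sphere_comb (Q p) (\<lambda>a. I a p) (- v)" for v
      unfolding sphere_comb_def
    proof (rule restrict_ext)
      fix x assume x: "x \<in> Q p"
      have "I a p x = 0" for a
        using cs[of a] p x Q0 unfolding complex_structure_def linear_complex_structure_def by blast
      then show "(\<Sum>a\<in>UNIV. v $ a *\<^sub>R I a p x) = (\<Sum>a\<in>UNIV. (- v) $ a *\<^sub>R I a p x)" by simp
    qed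
    from inj_onD[OF inj[OF p] this, of "axis 1 1"] have "axis 1 1 = - (axis 1 1 :: real^3)"
      by simp
    from arg_cong[OF this, of "\<lambda>w. w $ 1"] show False by (simp add: axis_def)
  qed
qed

lemma qc_structure_local_frame:
  assumes A: "smooth_atlas A" and qc: "qc_structure A Q G \<I>"
  shows "\<exists>U I \<eta> T. \<exists>\<gamma>\<in>G. p0 \<in> U \<and> normalised_qc_frame A Q \<gamma> U I \<eta> T \<and>
    (\<forall>p\<in>U. \<I> p = sphere_comb (Q p) (\<lambda>a. I a p) ` sphere 0 1)"
proof (rule qc_structureE[OF qc, where z=p0])
  have inv: "\<forall>\<gamma>\<in>G. \<forall>p. \<forall>J\<in>\<I> p. \<forall>x\<in>Q p. \<forall>y\<in>Q p. \<gamma> p (J x) (J y) = \<gamma> p x y"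
    and corank: "corank_subbundle A UNIV 3 Q" and conf: "conformal_class A Q G"
    using qc unfolding qc_structure_def by blast+
  fix U \<gamma> \<eta> and I :: "3 \<Rightarrow> _" assume \<gamma>: "\<gamma> \<in> G" and U: "open U" "p0 \<in> U"
    and sm: "\<And>a::3. complex_structure A U Q (I a)" "\<And>a. smooth_form A U (\<eta> a)"
    and I: "\<And>p x. p \<in> U \<Longrightarrow> x \<in> Q p \<Longrightarrow> I 1 p (I 2 p x) = I 3 p x"
      "\<And>p x. p \<in> U \<Longrightarrow> x \<in> Q p \<Longrightarrow> - I 2 p (I 1 p x) = I 3 p x"
    and \<I>: "\<And>p. p \<in> U \<Longrightarrow> \<I> p = sphere_comb (Q p) (\<lambda>a. I a p) ` sphere 0 1"
    and Q: "\<And>p. p \<in> U \<Longrightarrow> Q p = {x. \<forall>a. \<eta> a p x = 0}"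
    and d: "\<And>p a x y. p \<in> U \<Longrightarrow> x \<in> Q p \<Longrightarrow> y \<in> Q p \<Longrightarrow> \<gamma> p (I a p x) y = ext_deriv A (\<eta> a) p x y"
  have "qc_frame A Q \<gamma> U I \<eta>"
  proof
    show "bundle_metric A Q \<gamma>" using \<gamma> conf by (auto simp: conformal_class_def)
    fix p x y a assume p: "p \<in> U" and x: "x \<in> Q p" and y: "y \<in> Q p"
    \<comment> \<open>Metric invariance is given for the members of the sphere bundle; the unit
      vector \<open>axis a 1\<close> selects the member that is \<open>I a\<close> on
      \<open>Q\<close>.\<close>
    have "sphere_comb (Q p) (\<lambda>a. I a p) (axis a 1) \<in> \<I> p"
      unfolding \<I>[OF p] by (rule imageI) simp
    from inv[rule_format, OF \<gamma> this x y]
    show "\<gamma> p (I a p x) (I a p y) = \<gamma> p x y"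
      using x y by (simp add: sphere_comb_axis)
  qed (fact A U corank sm I Q d)+
  from qc_frame.local_normalised_frame[OF this U(2)] obtain V T
    where V: "p0 \<in> V" "V \<subseteq> U" and frame: "normalised_qc_frame A Q \<gamma> V I \<eta> T" by blast
  have "\<forall>p\<in>V. \<I> p = sphere_comb (Q p) (\<lambda>a. I a p) ` sphere 0 1"
    using \<I> V(2) by blast
  then show ?thesis using V(1) frame \<gamma> by blast
qed

text \<open>All normalised local frames are collected at once, for every metric of the conformal
  class, so no cover has to be selected; compatibility is available for any two of them.\<close>

definition qc_hyper_CR_atlas ::
  "('m::topological_space, 'e::euclidean_space) chart set \<Rightarrow> ('m \<Rightarrow> 'e set)
    \<Rightarrow> ('m \<Rightarrow> 'e \<Rightarrow> 'e \<Rightarrow> real) set \<Rightarrow> ('m \<Rightarrow> ('e \<Rightarrow> 'e) set)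
    \<Rightarrow> ('m set \<times> ('m, 'e) almost_hyper_CR) set" where
  "qc_hyper_CR_atlas A Q G \<I> = {(U, normalised_qc_frame.H I \<eta> T) |U I \<eta> T. \<exists>\<gamma>\<in>G.
     normalised_qc_frame A Q \<gamma> U I \<eta> T \<and> (\<forall>p\<in>U. \<I> p = sphere_comb (Q p) (\<lambda>a. I a p) ` sphere 0 1)}"

lemma quaternionic_CR_structure_qc:
  assumes A: "smooth_atlas A" and qc: "qc_structure A Q G \<I>"
  shows "quaternionic_CR_structure A (qc_hyper_CR_atlas A Q G \<I>)"
proof -
  let ?\<U> = "qc_hyper_CR_atlas A Q G \<I>"
  have conf: "conformal_class A Q G" using qc by (simp add: qc_structure_def)
  have 1: "open U \<and> hyper_CR_structure A U H" if UH: "(U, H) \<in> ?\<U>" for U H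
  proof -
    obtain \<gamma> I \<eta> T where "normalised_qc_frame A Q \<gamma> U I \<eta> T" and H: "H = normalised_qc_frame.H I \<eta> T"
      using UH by (auto simp: qc_hyper_CR_atlas_def)
    then interpret normalised_qc_frame A Q \<gamma> U I \<eta> T by simp
    show ?thesis using openU hyper_CR_structure_H by (simp add: H)
  qed
  have 2: "\<exists>U H. (U, H) \<in> ?\<U> \<and> p \<in> U" for p
    using qc_structure_local_frame[OF A qc, of p] unfolding qc_hyper_CR_atlas_def by blast
  have 3: "\<exists>S :: 'a \<Rightarrow> real^3^3.
           (\<forall>a b. smooth_fun A (U \<inter> U') (\<lambda>p. S p $ a $ b)) \<and>
           (\<forall>p\<in>U \<inter> U'. rotation_matrix (S p) \<and>
              (\<forall>v. hQv A H' v p = hQv A H (S p *v v) p \<and> hIv A H' v p = hIv A H (S p *v v) p))"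
    if UH: "(U, H) \<in> ?\<U>" and UH': "(U', H') \<in> ?\<U>" for U H U' H'
  proof -
    obtain \<gamma> I \<eta> T where \<gamma>: "\<gamma> \<in> G" and L: "normalised_qc_frame A Q \<gamma> U I \<eta> T"
      and H: "H = normalised_qc_frame.H I \<eta> T"
      using UH by (auto simp: qc_hyper_CR_atlas_def)
    obtain \<gamma>' I' \<eta>' T' where \<gamma>': "\<gamma>' \<in> G" and L': "normalised_qc_frame A Q \<gamma>' U' I' \<eta>' T'"
      and H': "H' = normalised_qc_frame.H I' \<eta>' T'"
      using UH' by (auto simp: qc_hyper_CR_atlas_def)
    obtain f where f: "smooth_fun A UNIV f" "\<And>p. f p > 0"
      "\<And>p x y. x \<in> Q p \<Longrightarrow> y \<in> Q p \<Longrightarrow> \<gamma>' p x y = f p * \<gamma> p x y"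
      using conformal_class_ratio[OF A conf \<gamma> \<gamma>'] by metis
    show ?thesis
      unfolding H H'
      using normalised_frames_overlap[OF L L' smooth_fun_subset[OF f(1) subset_UNIV] f(2,3)
          qc_structure_nontrivial[OF qc]] .
  qed
  show ?thesis
    unfolding quaternionic_CR_structure_def
  proof (intro conjI ballI)
    fix UH assume "UH \<in> ?\<U>"
    then show "case UH of (U, H) \<Rightarrow> open U \<and> hyper_CR_structure A U H" using 1 by (cases UH) simp
  next
    show "(\<Union>(U, H)\<in>?\<U>. U) = UNIV" using 2 by auto
  next
    fix UH assume "UH \<in> ?\<U>"
    moreover obtain U H where UH: "UH = (U, H)" by (cases UH)
    ultimately have mem: "(U, H) \<in> ?\<U>" by simp
    show "case UH of (U, H) \<Rightarrow> \<forall>(U', H')\<in>?\<U>. U \<inter> U' \<noteq> {} \<longrightarrow>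
      (\<exists>S :: 'a \<Rightarrow> real^3^3.
         (\<forall>a b. smooth_fun A (U \<inter> U') (\<lambda>p. S p $ a $ b)) \<and>
         (\<forall>p\<in>U \<inter> U'. rotation_matrix (S p) \<and>
            (\<forall>v\<in>sphere 0 1. hQv A H' v p = hQv A H (S p *v v) p \<and>
                             hIv A H' v p = hIv A H (S p *v v) p)))"
      unfolding UH prod.case
    proof (intro ballI, clarify)
      fix U' H' assume "(U', H') \<in> ?\<U>"
      from 3[OF mem this] obtain S :: "'a \<Rightarrow> real^3^3" where
        "(\<forall>a b. smooth_fun A (U \<inter> U') (\<lambda>p. S p $ a $ b)) \<and>
         (\<forall>p\<in>U \<inter> U'. rotation_matrix (S p) \<and>
            (\<forall>v. hQv A H' v p = hQv A H (S p *v v) p \<and> hIv A H' v p = hIv A H (S p *v v) p))" ..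
      then show "\<exists>S :: 'a \<Rightarrow> real^3^3.
         (\<forall>a b. smooth_fun A (U \<inter> U') (\<lambda>p. S p $ a $ b)) \<and>
         (\<forall>p\<in>U \<inter> U'. rotation_matrix (S p) \<and>
            (\<forall>v\<in>sphere 0 1. hQv A H' v p = hQv A H (S p *v v) p \<and>
                             hIv A H' v p = hIv A H (S p *v v) p))"
        by (intro exI[of _ S]) simp
    qed
  qed
qed

text \<open>\<open>Q\<close> lies in every \<open>hQv\<close>, and each \<open>J a\<close> restricts
  to \<open>I a\<close> there, so restricting \<open>hIv\<close> recovers the given sphere of
  complex structures.\<close>

lemma underlying_structure_qc:
  "underlying_structure A (qc_hyper_CR_atlas A Q G \<I>) Q \<I>"
  unfolding underlying_structure_def
proof (clarify, intro conjI)
  fix U H p assume "(U, H) \<in> qc_hyper_CR_atlas A Q G \<I>" and p: "p \<in> U"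
  then obtain \<gamma> I \<eta> T where L: "normalised_qc_frame A Q \<gamma> U I \<eta> T"
    and \<I>: "\<forall>p\<in>U. \<I> p = sphere_comb (Q p) (\<lambda>a. I a p) ` sphere 0 1"
    and H: "H = normalised_qc_frame.H I \<eta> T"
    by (auto simp: qc_hyper_CR_atlas_def)
  interpret normalised_qc_frame A Q \<gamma> U I \<eta> T by (rule L)
  interpret F: quaternionic_frame "Q p" "\<lambda>a. I a p" "\<lambda>a. \<eta> a p" "\<lambda>a. T a p" by (rule frame[OF p])
  show core: "Q p = hcore H p" using hcore_H[OF p] by (simp add: H)
  have "restrict (hIv A H v p) (Q p) = sphere_comb (Q p) (\<lambda>a. I a p) v" for v
    unfolding H hIv_H[OF p] sphere_comb_def by (rule restrict_ext) (simp add: J_def)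
  then show "\<I> p = (\<lambda>v. restrict (hIv A H v p) (hcore H p)) ` sphere 0 1"
    using \<I> p by (simp add: core[symmetric])
qed

theorem mainTheorem5:
  fixes A :: "('m::{t2_space, second_countable_topology}, real^'d) chart set"
    and n :: nat
    and Q :: "'m \<Rightarrow> (real^'d) set"
    and G :: "('m \<Rightarrow> real^'d \<Rightarrow> real^'d \<Rightarrow> real) set"
    and \<I> :: "'m \<Rightarrow> (real^'d \<Rightarrow> real^'d) set"
  assumes "smooth_atlas A"
    and "connected (UNIV :: 'm set)"
    and "orientable A"
    and "CARD('d) = 4 * n + 3"
    and "qc_structure A Q G \<I>"
  shows "\<exists>\<U>. quaternionic_CR_structure A \<U> \<and> underlying_structure A \<U> Q \<I>"
  using quaternionic_CR_structure_qc[OF assms(1,5)] underlying_structure_qc by blast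

end
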